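(* Let $\mathcal{H}_{v,v_0}(B_n)$ be the Iwahori-Hecke algebra of type $B_n$ with unequal parameters, $\alpha_0=v_0-v_0^{-1}$, and let $$\beta_n(y)=\prod_{i=1}^n\bigl(1+(\overline{y}+\alpha_0)\,j_i^B+a^{-1}J_i^B\bigr)\in\mathcal{H}_{v,v_0}(B_n)\otimes_{\mathcal{A}}\mathcal{R}.$$ Let $(\mathrm{tr}^B_{n,y})_{n\ge1}$ be the unique $\mathcal{R}$-valued Markov trace on the algebras $\mathcal{H}_{v,v_0}(B_n)$ with constants $\rho=1+a$, $\mu=v-v^{-1}$, normalization $\mathrm{tr}^B_{n,y}(1)=(1+a)^n$, and $\mathrm{tr}^B_{n,y}(T_1T_2\cdots T_n)=y^n$ for all $n\ge1$. Then for every $n\ge1$ one has $\mathrm{tr}^B_{n,y}=\mathrm{tr}_{\beta_n(y)}$, that is, $\mathrm{tr}^B_{n,y}(h)=\langle\beta_n(y),h\rangle$ for all $h\in\mathcal{H}_{v,v_0}(B_n)$.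
   Context: **Hecke algebra.** $\mathcal{A}=\mathbb{Q}(v)$ with involution $\overline{v}=v^{-1}$; $v_0\in\mathcal{A}$ is invertible with $\overline{v_0}=v_0^{-1}$. $\mathcal{H}_{v,v_0}(B_n)$ is the unital $\mathcal{A}$-algebra with generators $t_0,t_1,\dots,t_{n-1}$, the braid relations of type $B_n$ ($t_0t_1t_0t_1=t_1t_0t_1t_0$, $t_it_{i+1}t_i=t_{i+1}t_it_{i+1}$ for $i\ge1$, $t_it_j=t_jt_i$ for $|i-j|\ge2$), and $(t_i-v)(t_i+v^{-1})=0$ for $i\ge1$, $(t_0-v_0)(t_0+v_0^{-1})=0$. For a reduced expression $w=s_{i_1}\cdots s_{i_r}$ in the Coxeter group $W(B_n)$, put $t_w=t_{i_1}\cdots t_{i_r}$; $\{t_w\}$ and $\{t_w^{-1}\}$ are $\mathcal{A}$-bases. $\iota:\mathcal{H}_{v,v_0}(B_{n-1})\to\mathcal{H}_{v,v_0}(B_n)$ is the embedding $t_i\mapsto t_i$. **Coefficients.** $\mathcal{R}$ is a field extension of the rational function field $\mathcal{A}(a)$ containing an element $y$ (e.g. $y$ an indeterminate), equipped with an involutive field automorphism $x\mapsto\overline{x}$ extending that of $\mathcal{A}$, with $\overline{a}=a^{-1}$. **Pairing.** The bar involution on the Hecke algebra is the $\mathbb{Q}$-algebra involution extending that of $\mathcal{A}$ with $\overline{t_w}=t_{w^{-1}}^{-1}$; $i$ is the $\mathcal{A}$-linear anti-involution with $i(t_w)=t_{w^{-1}}$; $\tau(h)$ is the coefficient of $t_e^{-1}=1$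 of $h$ in the basis $\{t_w^{-1}\}$. $\langle h,h'\rangle=\tau(i(\overline{h})h')$, extended to $\mathcal{H}_{v,v_0}(B_n)\otimes_{\mathcal{A}}\mathcal{R}$, antilinearly (with respect to the involution of $\mathcal{R}$) in the first argument and linearly in the second. $\mathrm{tr}_z(h):=\langle z,h\rangle$. **Elements.** $j_i^B=t_{i-1}\cdots t_1t_0t_1\cdots t_{i-1}$ (so $j_1^B=t_0$), $J_i^B=(j_i^B)^2$; $T_1=t_0$ and $T_n=t_{n-1}\cdots t_1t_0t_1^{-1}\cdots t_{n-1}^{-1}$ for $n\ge2$. Elements of smaller algebras are regarded in larger ones via the embeddings. **Markov trace.** A family $(\phi_n)_{n\ge1}$ of $\mathcal{A}$-linear functionals $\phi_n:\mathcal{H}_{v,v_0}(B_n)\to\mathcal{R}$ is a Markov trace with constants $\rho,\mu\in\mathcal R$ if (M1) $\phi_n(hh')=\phi_n(h'h)$; and for $n\ge2$, $h\in\mathcal{H}_{v,v_0}(B_{n-1})$: (U1) $\phi_n(\iota(h))=\rho\,\phi_{n-1}(h)$; (M2) $\phi_n(\iota(h)t_{n-1})=\mu\,\phi_{n-1}(h)$. Existence and uniqueness of $(\mathrm{tr}^B_{n,y})$ with the listed properties is a theorem of Geck and Lambropoulou. *)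

theory Defs
  imports
    "HOL-Algebra.QuotRing"
    "HOL-Algebra.Module"
    "HOL-Library.Poly_Mapping"
    "HOL-Computational_Algebra.Polynomial_Factorial"
    "HOL-Combinatorics.Transposition"
begin

section \<open>Rational function fields\<close>

type_synonym 'k ratfun = "'k poly fract"

definition rf_const :: "'k::field \<Rightarrow> 'k ratfun" where
  "rf_const c = to_fract [:c:]"

definition rf_var :: "'k::field ratfun" where
  "rf_var = to_fract [:0, 1:]"

type_synonym qv = "rat ratfun"

text \<open>The involution of \<open>\<rat>(v)\<close>: \<open>f(v) / g(v)\<close> is sent to \<open>f(v\<^sup>-\<^sup>1) / g(v\<^sup>-\<^sup>1)\<close>.\<close>

definition qv_bar :: "qv \<Rightarrow> qv" where
  "qv_bar x =
    (let sub = (\<lambda>p. poly (map_poly rf_const p) (inverse rf_var)) in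
     THE y. \<exists>f g. g \<noteq> 0 \<and> x = Fract f g \<and> y = sub f / sub g)"

definition field_hom :: "('a::field \<Rightarrow> 'b::field) \<Rightarrow> bool" where
  "field_hom f \<longleftrightarrow> f 1 = 1 \<and> (\<forall>x y. f (x + y) = f x + f y) \<and> (\<forall>x y. f (x * y) = f x * f y)"


section \<open>Free associative algebras\<close>

text \<open>Words form the free monoid, written additively so that finitely supported functions on
  words carry the convolution product of \<open>Poly_Mapping\<close>, which is the product of
  the free algebra \<open>k\<langle>X\<^sub>0, X\<^sub>1, \<dots>\<rangle>\<close>.\<close>

datatype fword = Word (letters: "nat list")

instantiation fword :: monoid_add
begin

definition zero_fword :: fword where
  "0 = Word []"

definition plus_fword :: "fword \<Rightarrow> fword \<Rightarrow> fword" where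
  "x + y = Word (letters x @ letters y)"

instance
  by standard (auto simp: zero_fword_def plus_fword_def)

end

definition free_scal :: "'k::field \<Rightarrow> fword \<Rightarrow>\<^sub>0 'k" where
  "free_scal c = Poly_Mapping.single 0 c"

definition free_gen :: "nat \<Rightarrow> fword \<Rightarrow>\<^sub>0 'k::field" where
  "free_gen i = Poly_Mapping.single (Word [i]) 1"

definition free_alg :: "nat \<Rightarrow> (fword \<Rightarrow>\<^sub>0 'k::field) ring" where
  "free_alg n =
    \<lparr>carrier = {x. \<forall>w\<in>Poly_Mapping.keys x. set (letters w) \<subseteq> {..<n}},
     monoid.mult = (*), one = 1, zero = 0, add = (+)\<rparr>"


section \<open>The Hecke algebra of type \<open>B\<^sub>n\<close> with unequal parameters\<close>

definition hecke_relators :: "'k::field \<Rightarrow> 'k \<Rightarrow> nat \<Rightarrow> (fword \<Rightarrow>\<^sub>0 'k) set" where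
  "hecke_relators q q0 n =
    (let X = free_gen; c = free_scal in
     (if 0 < n then {(X 0 - c q0) * (X 0 + c (inverse q0))} else {})
     \<union> {(X i - c q) * (X i + c (inverse q)) |i. 1 \<le> i \<and> i < n}
     \<union> (if 1 < n then {X 0 * X 1 * X 0 * X 1 - X 1 * X 0 * X 1 * X 0} else {})
     \<union> {X i * X (i + 1) * X i - X (i + 1) * X i * X (i + 1) |i. 1 \<le> i \<and> i + 1 < n}
     \<union> {X i * X j - X j * X i |i j. i < n \<and> j < n \<and> (i + 2 \<le> j \<or> j + 2 \<le> i)})"

definition hecke_ideal :: "'k::field \<Rightarrow> 'k \<Rightarrow> nat \<Rightarrow> (fword \<Rightarrow>\<^sub>0 'k) set" where
  "hecke_ideal q q0 n = Idl\<^bsub>free_alg n\<^esub> (hecke_relators q q0 n)"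

definition hecke_class ::
  "'k::field \<Rightarrow> 'k \<Rightarrow> nat \<Rightarrow> (fword \<Rightarrow>\<^sub>0 'k) \<Rightarrow> (fword \<Rightarrow>\<^sub>0 'k) set" where
  "hecke_class q q0 n x = hecke_ideal q q0 n +>\<^bsub>free_alg n\<^esub> x"

text \<open>The algebra over an arbitrary field \<open>k\<close> with parameters \<open>q\<close> (for \<open>t\<^sub>i\<close>, \<open>i \<ge> 1\<close>) and
  \<open>q0\<close> (for \<open>t\<^sub>0\<close>). Over \<open>\<A> = \<rat>(v)\<close> with \<open>q = v\<close>, \<open>q0 = v\<^sub>0\<close> it is \<open>H(B\<^sub>n)\<close>; over an extension
  field \<open>\<R>\<close> of \<open>\<A>\<close>, with the images of \<open>v\<close> and \<open>v\<^sub>0\<close> as parameters, it is \<open>H(B\<^sub>n) \<otimes>\<^sub>\<A> \<R>\<close>, the base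
  change of a presented algebra having the same presentation over \<open>\<R>\<close>.\<close>

definition hecke_alg :: "'k::field \<Rightarrow> 'k \<Rightarrow> nat \<Rightarrow> ('k, (fword \<Rightarrow>\<^sub>0 'k) set) module" where
  "hecke_alg q q0 n =
    (let Q = free_alg n Quot hecke_ideal q q0 n in
     ring.extend Q (module.fields (\<lambda>c h. hecke_class q q0 n (free_scal c) \<otimes>\<^bsub>Q\<^esub> h)))"

definition hecke_gen :: "'k::field \<Rightarrow> 'k \<Rightarrow> nat \<Rightarrow> nat \<Rightarrow> (fword \<Rightarrow>\<^sub>0 'k) set" where
  "hecke_gen q q0 n i = hecke_class q q0 n (free_gen i)"

definition ring_prod_list :: "('b, 'm) monoid_scheme \<Rightarrow> 'b list \<Rightarrow> 'b" where
  "ring_prod_list R xs = foldr (\<otimes>\<^bsub>R\<^esub>) xs \<one>\<^bsub>R\<^esub>"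

definition hecke_word :: "'k::field \<Rightarrow> 'k \<Rightarrow> nat \<Rightarrow> nat list \<Rightarrow> (fword \<Rightarrow>\<^sub>0 'k) set" where
  "hecke_word q q0 n is = ring_prod_list (hecke_alg q q0 n) (map (hecke_gen q q0 n) is)"

text \<open>The map \<open>\<iota>: H(B\<^sub>m) \<rightarrow> H(B\<^sub>n)\<close>, \<open>t\<^sub>i \<mapsto> t\<^sub>i\<close>, for \<open>m \<le> n\<close>.\<close>

definition hecke_embed ::
  "'k::field \<Rightarrow> 'k \<Rightarrow> nat \<Rightarrow> (fword \<Rightarrow>\<^sub>0 'k) set \<Rightarrow> (fword \<Rightarrow>\<^sub>0 'k) set" where
  "hecke_embed q q0 n h = the_elem (hecke_class q q0 n ` h)"

text \<open>The base change map \<open>h \<mapsto> h \<otimes> 1\<close> for an embedding of fields \<open>\<kappa>\<close>.\<close>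

definition hecke_ext ::
  "('k::field \<Rightarrow> 'r::field) \<Rightarrow> 'k \<Rightarrow> 'k \<Rightarrow> nat \<Rightarrow> (fword \<Rightarrow>\<^sub>0 'k) set \<Rightarrow> (fword \<Rightarrow>\<^sub>0 'r) set" where
  "hecke_ext \<kappa> q q0 n h =
    the_elem ((\<lambda>x. hecke_class (\<kappa> q) (\<kappa> q0) n (Poly_Mapping.map \<kappa> x)) ` h)"


section \<open>The Coxeter group and the standard bases\<close>

text \<open>\<open>W(B\<^sub>n)\<close> is realised by signed permutations: \<open>s\<^sub>0\<close> exchanges \<open>1\<close> and \<open>-1\<close>, and \<open>s\<^sub>i\<close> exchanges
  \<open>i\<close> with \<open>i + 1\<close> and \<open>-i\<close> with \<open>-(i + 1)\<close>.\<close>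

definition refl_B :: "nat \<Rightarrow> int \<Rightarrow> int" where
  "refl_B i =
    (if i = 0 then Transposition.transpose 1 (- 1)
     else Transposition.transpose (int i) (int i + 1) \<circ> Transposition.transpose (- int i) (- (int i + 1)))"

definition refl_word :: "nat list \<Rightarrow> int \<Rightarrow> int" where
  "refl_word is = foldr (\<circ>) (map refl_B is) id"

definition W_B :: "nat \<Rightarrow> (int \<Rightarrow> int) set" where
  "W_B n = refl_word ` lists {..<n}"

definition reduced_expr :: "nat \<Rightarrow> (int \<Rightarrow> int) \<Rightarrow> nat list \<Rightarrow> bool" where
  "reduced_expr n w is \<longleftrightarrow>
    is \<in> lists {..<n} \<and> refl_word is = w \<and>
    (\<forall>js\<in>lists {..<n}. refl_word js = w \<longrightarrow> length is \<le> length js)"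

definition hecke_t :: "'k::field \<Rightarrow> 'k \<Rightarrow> nat \<Rightarrow> (int \<Rightarrow> int) \<Rightarrow> (fword \<Rightarrow>\<^sub>0 'k) set" where
  "hecke_t q q0 n w = hecke_word q q0 n (SOME is. reduced_expr n w is)"

definition hecke_t_inv :: "'k::field \<Rightarrow> 'k \<Rightarrow> nat \<Rightarrow> (int \<Rightarrow> int) \<Rightarrow> (fword \<Rightarrow>\<^sub>0 'k) set" where
  "hecke_t_inv q q0 n w = inv\<^bsub>hecke_alg q q0 n\<^esub> (hecke_t q q0 n w)"

text \<open>Coefficients of \<open>h\<close> with respect to a basis \<open>b\<close> indexed by \<open>W(B\<^sub>n)\<close>.\<close>

definition hecke_coeff ::
  "'k::field \<Rightarrow> 'k \<Rightarrow> nat \<Rightarrow> ((int \<Rightarrow> int) \<Rightarrow> (fword \<Rightarrow>\<^sub>0 'k) set) \<Rightarrow> (fword \<Rightarrow>\<^sub>0 'k) set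
    \<Rightarrow> (int \<Rightarrow> int) \<Rightarrow> 'k" where
  "hecke_coeff q q0 n b h =
    (THE c. (\<forall>w. w \<notin> W_B n \<longrightarrow> c w = 0) \<and>
       h = (\<Oplus>\<^bsub>hecke_alg q q0 n\<^esub>w\<in>W_B n. c w \<odot>\<^bsub>hecke_alg q q0 n\<^esub> b w))"


section \<open>The sesquilinear pairing\<close>

text \<open>The bar involution is semilinear with respect to an involution \<open>cj\<close> of the ground field.
  On \<open>H(B\<^sub>n) \<otimes>\<^sub>\<A> \<R>\<close>, with \<open>cj\<close> the involution of \<open>\<R>\<close>, it yields the extension of the pairing that is
  antilinear in the first argument and linear in the second.\<close>

definition hecke_bar ::
  "('k::field \<Rightarrow> 'k) \<Rightarrow> 'k \<Rightarrow> 'k \<Rightarrow> nat \<Rightarrow> (fword \<Rightarrow>\<^sub>0 'k) set \<Rightarrow> (fword \<Rightarrow>\<^sub>0 'k) set" where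
  "hecke_bar cj q q0 n h =
    (\<Oplus>\<^bsub>hecke_alg q q0 n\<^esub>w\<in>W_B n.
       cj (hecke_coeff q q0 n (hecke_t q q0 n) h w)
         \<odot>\<^bsub>hecke_alg q q0 n\<^esub> hecke_t_inv q q0 n (inv_into UNIV w))"

definition hecke_anti ::
  "'k::field \<Rightarrow> 'k \<Rightarrow> nat \<Rightarrow> (fword \<Rightarrow>\<^sub>0 'k) set \<Rightarrow> (fword \<Rightarrow>\<^sub>0 'k) set" where
  "hecke_anti q q0 n h =
    (\<Oplus>\<^bsub>hecke_alg q q0 n\<^esub>w\<in>W_B n.
       hecke_coeff q q0 n (hecke_t q q0 n) h w
         \<odot>\<^bsub>hecke_alg q q0 n\<^esub> hecke_t q q0 n (inv_into UNIV w))"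

definition hecke_tau :: "'k::field \<Rightarrow> 'k \<Rightarrow> nat \<Rightarrow> (fword \<Rightarrow>\<^sub>0 'k) set \<Rightarrow> 'k" where
  "hecke_tau q q0 n h = hecke_coeff q q0 n (hecke_t_inv q q0 n) h id"

definition hecke_pairing ::
  "('k::field \<Rightarrow> 'k) \<Rightarrow> 'k \<Rightarrow> 'k \<Rightarrow> nat \<Rightarrow> (fword \<Rightarrow>\<^sub>0 'k) set \<Rightarrow> (fword \<Rightarrow>\<^sub>0 'k) set \<Rightarrow> 'k" where
  "hecke_pairing cj q q0 n h h' =
    hecke_tau q q0 n
      (hecke_anti q q0 n (hecke_bar cj q q0 n h) \<otimes>\<^bsub>hecke_alg q q0 n\<^esub> h')"


section \<open>Jucys--Murphy elements and \<open>\<beta>\<^sub>n(y)\<close>\<close>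

definition jm_B :: "'k::field \<Rightarrow> 'k \<Rightarrow> nat \<Rightarrow> nat \<Rightarrow> (fword \<Rightarrow>\<^sub>0 'k) set" where
  "jm_B q q0 n i = hecke_word q q0 n (rev [1..<i] @ [0] @ [1..<i])"

definition T_B :: "'k::field \<Rightarrow> 'k \<Rightarrow> nat \<Rightarrow> nat \<Rightarrow> (fword \<Rightarrow>\<^sub>0 'k) set" where
  "T_B q q0 n k =
    ring_prod_list (hecke_alg q q0 n)
      (map (hecke_gen q q0 n) (rev [1..<k] @ [0])
       @ map (\<lambda>i. inv\<^bsub>hecke_alg q q0 n\<^esub> (hecke_gen q q0 n i)) [1..<k])"

text \<open>The argument \<open>yb\<close> stands for the conjugate of \<open>y\<close>.\<close>

definition beta_B :: "'k::field \<Rightarrow> 'k \<Rightarrow> 'k \<Rightarrow> 'k \<Rightarrow> nat \<Rightarrow> (fword \<Rightarrow>\<^sub>0 'k) set" where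
  "beta_B q q0 a yb n =
    (let H = hecke_alg q q0 n; j = jm_B q q0 n in
     ring_prod_list H
       (map (\<lambda>i. \<one>\<^bsub>H\<^esub> \<oplus>\<^bsub>H\<^esub> (yb + (q0 - inverse q0)) \<odot>\<^bsub>H\<^esub> j i
                    \<oplus>\<^bsub>H\<^esub> inverse a \<odot>\<^bsub>H\<^esub> (j i [^]\<^bsub>H\<^esub> (2::nat)))
         [1..<Suc n]))"


section \<open>Markov traces\<close>

text \<open>\<open>\<kappa>\<close> is the inclusion of the ground field into the field of values.\<close>

definition linear_functional ::
  "('k::field \<Rightarrow> 'r::field) \<Rightarrow> 'k \<Rightarrow> 'k \<Rightarrow> nat \<Rightarrow> ((fword \<Rightarrow>\<^sub>0 'k) set \<Rightarrow> 'r) \<Rightarrow> bool" where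
  "linear_functional \<kappa> q q0 n f \<longleftrightarrow>
    (let H = hecke_alg q q0 n in
     (\<forall>h\<in>carrier H. \<forall>h'\<in>carrier H. f (h \<oplus>\<^bsub>H\<^esub> h') = f h + f h') \<and>
     (\<forall>c. \<forall>h\<in>carrier H. f (c \<odot>\<^bsub>H\<^esub> h) = \<kappa> c * f h))"

definition markov_trace ::
  "('k::field \<Rightarrow> 'r::field) \<Rightarrow> 'k \<Rightarrow> 'k \<Rightarrow> 'r \<Rightarrow> 'r
    \<Rightarrow> (nat \<Rightarrow> (fword \<Rightarrow>\<^sub>0 'k) set \<Rightarrow> 'r) \<Rightarrow> bool" where
  "markov_trace \<kappa> q q0 \<rho> \<mu> \<phi> \<longleftrightarrow>
    (\<forall>n\<ge>1. linear_functional \<kappa> q q0 n (\<phi> n)) \<and>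
    (\<forall>n\<ge>1. \<forall>h\<in>carrier (hecke_alg q q0 n). \<forall>h'\<in>carrier (hecke_alg q q0 n).
       \<phi> n (h \<otimes>\<^bsub>hecke_alg q q0 n\<^esub> h') = \<phi> n (h' \<otimes>\<^bsub>hecke_alg q q0 n\<^esub> h)) \<and>
    (\<forall>n\<ge>2. \<forall>h\<in>carrier (hecke_alg q q0 (n - 1)).
       \<phi> n (hecke_embed q q0 n h) = \<rho> * \<phi> (n - 1) h) \<and>
    (\<forall>n\<ge>2. \<forall>h\<in>carrier (hecke_alg q q0 (n - 1)).
       \<phi> n (hecke_embed q q0 n h \<otimes>\<^bsub>hecke_alg q q0 n\<^esub> hecke_gen q q0 n (n - 1))
         = \<mu> * \<phi> (n - 1) h)"

end

theory Submission
  imports Defs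
begin

text \<open>
  Put \<open>u\<^sub>i = t\<^sub>i\<^sup>-\<^sup>1\<close> and let \<open>k\<^sub>n\<close> be the Jucys--Murphy elements in the \<open>u\<^sub>i\<close>. The map \<open>h \<mapsto> i(bar h)\<close> is a
  semilinear anti-automorphism inverting the generators, so \<open>\<langle>\<beta>\<^sub>n(y), h\<rangle> = \<tau>(b\<^sub>n h)\<close> with \<open>b\<^sub>n\<close> the product
  of the \<open>f(k\<^sub>i) = 1 + (y - \<alpha>\<^sub>0) k\<^sub>i + a k\<^sub>i\<^sup>2\<close>, and \<open>\<tau>\<close> is the standard symmetrising trace for the generators
  \<open>u\<^sub>i\<close>. As a symmetric polynomial in the \<open>k\<^sub>i\<close>, \<open>b\<^sub>n\<close> is central, which gives (M1). With
  \<open>H\<^sub>n = H\<^sub>n\<^sub>-\<^sub>1 + H\<^sub>n\<^sub>-\<^sub>1 u\<^sub>n\<^sub>-\<^sub>1 H\<^sub>n\<^sub>-\<^sub>1 + H\<^sub>n\<^sub>-\<^sub>1 k\<^sub>n\<close>, where \<open>\<tau>\<close> kills the last two summands, (U1), (M2) and the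
  values on \<open>T\<^sub>1 \<cdots> T\<^sub>n\<close> follow by computing \<open>f(k\<^sub>n)\<close>, \<open>f(k\<^sub>n) u\<^sub>n\<^sub>-\<^sub>1\<close> and \<open>f(k\<^sub>n) T\<^sub>n\<close> modulo those summands. The same
  decomposition yields uniqueness: for a trace \<open>D\<close> on \<open>H\<^sub>n\<close> that vanishes on the first two summands,
  \<open>h \<mapsto> D(h k\<^sub>n)\<close> is such a trace on \<open>H\<^sub>n\<^sub>-\<^sub>1\<close>, so \<open>D\<close> is determined by \<open>D(T\<^sub>1 \<cdots> T\<^sub>n)\<close>.

  The standard bases are controlled by the regular representation on functions on signed
  permutations. Its operators commute with right multiplications, so an identity between them may be
  checked at one point; it is faithful because \<open>H\<^sub>n\<close> is spanned over \<open>H\<^sub>n\<^sub>-\<^sub>1\<close> by \<open>2n\<close> coset words, which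
  have disjoint supports.
\<close>

section \<open>Signed permutations\<close>

text \<open>The coefficients of \<open>f\<close> come from the tower. Modulo \<open>NN m\<close>,
  with \<open>k = kU (m + 1)\<close>, \<open>u = U m\<close> and \<open>\<alpha> = al m\<close>, the
  element \<open>k * k\<close> is congruent to \<open>1\<close> and \<open>k * k * u\<close> to
  \<open>- \<alpha>\<close>. So \<open>f(k)\<close> has the value \<open>1 + a\<close>, and
  \<open>f(k) * (u + \<alpha>)\<close> has the value
  \<open>\<alpha> * (1 + a) - a * \<alpha> = \<alpha>\<close>, which is \<open>\<mu>\<close>. The
  shift of \<open>y\<close> by \<open>\<alpha>\<^sub>0\<close> makes the value of
  \<open>f(k) * T\<close> equal to \<open>y\<close>. The main obstacle is that coefficients, bar
  involution and \<open>\<tau>\<close> are given by choice and description operators on a quotient,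
  and mean nothing before both standard bases are under control. Therefore everything is moved to
  one ring of operators, in which the algebras of all ranks lie and the embeddings are inclusions.
  Two representations occur, because the pairing uses the \<open>t\<^sub>w\<close> and also their
  inverses: in each of them one of the two families is sent to point masses. A last difficulty is
  that the given trace is linear only over \<open>\<A>\<close>, while the uniqueness argument takes
  place over \<open>\<R>\<close>.\<close>

definition lo :: "nat \<Rightarrow> int" where "lo i = (if i = 0 then - 1 else int i)"
definition hi :: "nat \<Rightarrow> int" where "hi i = int i + 1"

text \<open>One formula covers both kinds of generators: for \<open>i = 0\<close> the pair is
  \<open>(- 1, 1)\<close>, so \<open>hi 0 = - lo 0\<close> and the last two cases repeat the first
  two.\<close>

lemma refl_B_eq:
  "refl_B i x = (if x = lo i then hi i else if x = hi i then lo i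
     else if x = - lo i then - hi i else if x = - hi i then - lo i else x)"
  by (auto simp: refl_B_def lo_def hi_def Transposition.transpose_def)

lemma lo_less_hi [simp]: "lo i < hi i" "lo i \<noteq> hi i" "hi i \<noteq> lo i" "\<not> hi i < lo i"
  by (auto simp: lo_def hi_def)

lemma lo_hi_neq0 [simp]: "lo i \<noteq> 0" "hi i \<noteq> 0" "0 < hi i"
  by (auto simp: lo_def hi_def)

lemma refl_B_lo [simp]: "refl_B i (lo i) = hi i"
  and refl_B_hi [simp]: "refl_B i (hi i) = lo i"
  by (auto simp: refl_B_eq)

lemma refl_B_minus [simp]: "refl_B i (- x) = - refl_B i x"
  by (auto simp: refl_B_eq lo_def hi_def)

lemma refl_B_refl_B [simp]: "refl_B i (refl_B i x) = x"
  by (auto simp: refl_B_eq lo_def hi_def)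

lemma refl_B_fixed: "refl_B i x = x \<longleftrightarrow> x \<notin> {lo i, hi i, - lo i, - hi i}"
  by (auto simp: refl_B_eq lo_def hi_def)

text \<open>\<open>lo i\<close> and \<open>hi i\<close> are neighbours among the nonzero integers,
  and so are their negatives; exchanging neighbours reverses no other comparison. The value
  \<open>0\<close> is excluded because it lies between \<open>- 1\<close> and
  \<open>1\<close>.\<close>

lemma refl_B_less_iff:
  assumes "x \<noteq> 0" "y \<noteq> 0" "x \<noteq> y" "x \<noteq> refl_B i y"
  shows "refl_B i x < refl_B i y \<longleftrightarrow> x < y"
proof (cases "i = 0")
  case True
  have "refl_B 0 z = (if z = 1 then - 1 else if z = - 1 then 1 else z)" for z
    by (simp add: refl_B_eq lo_def hi_def)
  then show ?thesis using assms unfolding True by (smt (verit))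
next
  case False
  then have "refl_B i z = (if z = int i then int i + 1 else if z = int i + 1 then int i
      else if z = - int i then - int i - 1 else if z = - int i - 1 then - int i else z)" for z
    by (simp add: refl_B_eq lo_def hi_def)
  moreover have "int i > 0" using False by simp
  ultimately show ?thesis using assms by (smt (verit))
qed

lemma refl_word_simps [simp]:
  "refl_word [] = id" "refl_word (i # is) = refl_B i \<circ> refl_word is"
  by (auto simp: refl_word_def)

lemma refl_word_append [simp]: "refl_word (xs @ ys) = refl_word xs \<circ> refl_word ys"
  by (induction xs) (auto simp: comp_assoc)

lemma refl_word_rev: "refl_word (rev is) (refl_word is x) = x"
  by (induction "is" arbitrary: x) auto

lemma refl_word_rev': "refl_word is (refl_word (rev is) x) = x"
  using refl_word_rev[of "rev is"] by simp

lemma inv_refl_word: "inv_into UNIV (refl_word is) = refl_word (rev is)"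
  by (rule inv_equality) (auto simp: refl_word_rev refl_word_rev')

lemma refl_word_minus [simp]: "refl_word is (- x) = - refl_word is x"
  by (induction "is" arbitrary: x) auto

text \<open>The union of all \<open>W_B n\<close>, with no bound on the rank: operators of every
  rank then act on the same functions.\<close>

typedef sperm = "range refl_word" morphisms sp Abs_sperm by auto

setup_lifting type_definition_sperm

lemma sp_cases: obtains "is" where "sp w = refl_word is"
  using sp[of w] by auto

lemma sp_minus [simp]: "sp w (- x) = - sp w x"
  using sp[of w] by auto

lemma sp_inj [simp]: "sp w x = sp w y \<longleftrightarrow> x = y"
  by (rule sp_cases[of w]) (metis refl_word_rev)

lemma sp_zero [simp]: "sp w 0 = 0"
  using sp_minus[of w 0] by simp

lemma sp_eq_0 [simp]: "sp w x = 0 \<longleftrightarrow> x = 0"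
  using sp_inj[of w x 0] by (simp del: sp_inj)

lift_definition sone :: sperm is id by (rule image_eqI[of _ _ "[]"]) auto

lift_definition rmul :: "sperm \<Rightarrow> nat \<Rightarrow> sperm" is "\<lambda>w i. w \<circ> refl_B i"
proof -
  fix f :: "int \<Rightarrow> int" and i assume "f \<in> range refl_word"
  then obtain xs where "f = refl_word xs" by auto
  then have "f \<circ> refl_B i = refl_word (xs @ [i])" by simp
  then show "f \<circ> refl_B i \<in> range refl_word" by blast
qed

lift_definition lmul :: "nat \<Rightarrow> sperm \<Rightarrow> sperm" is "\<lambda>i w. refl_B i \<circ> w"
proof -
  fix f :: "int \<Rightarrow> int" and i assume "f \<in> range refl_word"
  then obtain xs where "f = refl_word xs" by auto
  then have "refl_B i \<circ> f = refl_word (i # xs)" by simp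
  then show "refl_B i \<circ> f \<in> range refl_word" by blast
qed

lift_definition sinv :: "sperm \<Rightarrow> sperm" is "inv_into UNIV"
  by (auto simp: inv_refl_word)

lift_definition sword :: "nat list \<Rightarrow> sperm" is refl_word by auto

lemma sp_sinv_sp [simp]: "sp (sinv w) (sp w x) = x"
  and sp_sp_sinv [simp]: "sp w (sp (sinv w) x) = x"
  by (transfer, auto simp: inv_refl_word refl_word_rev refl_word_rev')+

lemma sperm_eqI: "(\<And>x. sp v x = sp w x) \<Longrightarrow> v = w"
  by (metis ext sp_inject)

lemma sp_sone [simp]: "sp sone x = x"
  by transfer simp
lemma sp_rmul [simp]: "sp (rmul w i) x = sp w (refl_B i x)"
  by transfer simp
lemma sp_lmul [simp]: "sp (lmul i w) x = refl_B i (sp w x)"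
  by transfer simp
lemma sp_sword [simp]: "sp (sword is) = refl_word is"
  by transfer simp

lemma sinv_lmul [simp]: "sinv (lmul j w) = rmul (sinv w) j"
  by (rule sperm_eqI) (metis refl_B_refl_B sp_lmul sp_rmul sp_sinv_sp sp_sp_sinv)
lemma sinv_rmul [simp]: "sinv (rmul w j) = lmul j (sinv w)"
  by (rule sperm_eqI) (metis refl_B_refl_B sp_lmul sp_rmul sp_sinv_sp sp_sp_sinv)
lemma sinv_sinv [simp]: "sinv (sinv w) = w"
  by (rule sperm_eqI) (metis sp_sinv_sp sp_sp_sinv)
lemma sinv_sone [simp]: "sinv sone = sone"
  by (rule sperm_eqI) (metis sp_sinv_sp sp_sone)
lemma rmul_rmul [simp]: "rmul (rmul w i) i = w"
  by (rule sperm_eqI) simp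
lemma lmul_lmul [simp]: "lmul i (lmul i w) = w"
  by (rule sperm_eqI) simp
lemma lmul_rmul: "lmul j (rmul w i) = rmul (lmul j w) i"
  by (rule sperm_eqI) simp
lemma lmul_sone: "lmul i sone = rmul sone i"
  by (rule sperm_eqI) simp
lemma sword_Nil [simp]: "sword [] = sone"
  by (rule sperm_eqI) simp
lemma sword_Cons [simp]: "sword (i # is) = lmul i (sword is)"
  by (rule sperm_eqI) simp
lemma sword_snoc: "sword (is @ [i]) = rmul (sword is) i"
  by (rule sperm_eqI) simp
lemma sinv_sword: "sinv (sword is) = sword (rev is)"
  by (rule sperm_eqI) (metis refl_word_rev' sp_inj sp_sp_sinv sp_sword)
lemma sperm_induct [case_names one lmul]:
  assumes "P sone" "\<And>i w. P w \<Longrightarrow> P (lmul i w)"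
  shows "P w"
proof -
  have "P (sword is)" for "is" using assms by (induction "is") auto
  moreover obtain "is" where "w = sword is"
    by (metis sp_cases sp_sword sperm_eqI)
  ultimately show ?thesis by simp
qed

text \<open>Right descents, read off from the one-line notation; \<open>(lo i, hi i)\<close> encodes the simple root
  of the \<open>i\<close>-th generator.\<close>

definition desc :: "nat \<Rightarrow> sperm \<Rightarrow> bool" where
  "desc i w \<longleftrightarrow> sp w (hi i) < sp w (lo i)"

lemma desc_sone [simp]: "\<not> desc i sone"
  by (simp add: desc_def)

lemma desc_rmul [simp]: "desc i (rmul w i) \<longleftrightarrow> \<not> desc i w"
proof -
  have "sp w (hi i) < sp w (lo i) \<or> sp w (lo i) < sp w (hi i)"
    using linorder_neq_iff[of "sp w (hi i)" "sp w (lo i)"] by simp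
  then show ?thesis unfolding desc_def by auto
qed

text \<open>The hypotheses say that \<open>w\<close> carries the simple root of \<open>i\<close> to
  plus or minus the simple root of \<open>j\<close>, so conjugating the reflection \<open>i\<close>
  by \<open>w\<close> gives the reflection \<open>j\<close>.\<close>

lemma rmul_eq_lmulI:
  assumes "sp w (hi i) = refl_B j (sp w (lo i))"
    "refl_B j (sp w (lo i)) \<noteq> sp w (lo i)"
  shows "rmul w i = lmul j w"
proof (rule sperm_eqI)
  fix x
  have 1: "sp w (lo i) = refl_B j (sp w (hi i))" using assms(1) by simp
  have mem: "sp w (lo i) \<in> {lo j, hi j, - lo j, - hi j}"
    using assms(2) refl_B_fixed by blast
  show "sp (rmul w i) x = sp (lmul j w) x"
  proof (cases "x \<in> {lo i, hi i, - lo i, - hi i}")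
    case True
    then show ?thesis using assms(1) 1 by auto
  next
    case False
    then have "refl_B i x = x" by (simp add: refl_B_fixed)
    moreover have "sp w x \<notin> {lo j, hi j, - lo j, - hi j}"
    proof -
      have "{sp w (lo i), sp w (hi i), sp w (- lo i), sp w (- hi i)} = {lo j, hi j, - lo j, - hi j}"
        using mem assms(1) by auto
      moreover have "sp w x \<notin> {sp w (lo i), sp w (hi i), sp w (- lo i), sp w (- hi i)}"
        using False by (auto simp del: sp_minus)
      ultimately show ?thesis by metis
    qed
    ultimately show ?thesis by (simp add: refl_B_fixed[THEN iffD2])
  qed
qed

text \<open>A left reflection can change the order of \<open>sp w (lo i)\<close> and
  \<open>sp w (hi i)\<close> only by exchanging these two values, which is the excluded
  case.\<close>

lemma desc_lmul:
  assumes "rmul w i \<noteq> lmul j w"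
  shows "desc i (lmul j w) \<longleftrightarrow> desc i w"
proof -
  have "sp w (hi i) \<noteq> refl_B j (sp w (lo i))"
  proof
    assume e: "sp w (hi i) = refl_B j (sp w (lo i))"
    then have "refl_B j (sp w (lo i)) \<noteq> sp w (lo i)"
      by (metis lo_less_hi(2) sp_inj)
    then show False using rmul_eq_lmulI e assms by blast
  qed
  then show ?thesis unfolding desc_def sp_lmul
    by (subst refl_B_less_iff) auto
qed

lemma desc_sinv_rmul:
  assumes "rmul w i \<noteq> lmul j w"
  shows "desc j (sinv (rmul w i)) \<longleftrightarrow> desc j (sinv w)"
proof -
  have "rmul (sinv w) j \<noteq> lmul i (sinv w)"
  proof
    assume "rmul (sinv w) j = lmul i (sinv w)"
    then have "sinv (rmul (sinv w) j) = sinv (lmul i (sinv w))" by simp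
    then show False using assms by simp
  qed
  then show ?thesis using desc_lmul[of "sinv w" j i] by simp
qed

text \<open>In the exceptional case \<open>w\<close> maps the root of \<open>i\<close> to that of
  \<open>j\<close> up to a sign, and the sign decides both descents. Roots of equal length
  correspond, so the two operators carry the same parameter.\<close>

lemma
  assumes "rmul w i = lmul j w"
  shows desc_sinv_eq: "desc j (sinv w) \<longleftrightarrow> desc i w"
    and rmul_eq_lmul_zero: "i = 0 \<longleftrightarrow> j = 0"
proof -
  have e: "sp w (hi i) = refl_B j (sp w (lo i))"
    using assms by (metis refl_B_lo sp_lmul sp_rmul)
  have ne: "refl_B j (sp w (lo i)) \<noteq> sp w (lo i)"
    using e by (metis lo_less_hi(2) sp_inj)
  consider "sp w (lo i) = lo j" "sp w (hi i) = hi j" | "sp w (lo i) = hi j" "sp w (hi i) = lo j"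
    | "sp w (lo i) = - lo j" "sp w (hi i) = - hi j" | "sp w (lo i) = - hi j" "sp w (hi i) = - lo j"
    using ne e refl_B_fixed[of j "sp w (lo i)"] by auto
  note cs = this
  have inv: "sp w x = y \<Longrightarrow> sp (sinv w) y = x" for x y by auto
  have inv': "sp w x = - y \<Longrightarrow> sp (sinv w) y = - x" for x y
    by (metis add.inverse_inverse inv sp_minus)
  from cs show "desc j (sinv w) \<longleftrightarrow> desc i w"
    by cases (auto simp: desc_def dest!: inv inv')
  show "i = 0 \<longleftrightarrow> j = 0"
  proof -
    have "i = 0 \<longleftrightarrow> hi i = - lo i" by (auto simp: hi_def lo_def)
    also have "\<dots> \<longleftrightarrow> sp w (hi i) = - sp w (lo i)" by (simp flip: sp_minus)
    also have "\<dots> \<longleftrightarrow> hi j = - lo j" using cs by cases auto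
    also have "\<dots> \<longleftrightarrow> j = 0" by (auto simp: hi_def lo_def)
    finally show ?thesis .
  qed
qed

text \<open>Reading the word from the right, the descent first appears when some letter
  \<open>j\<close> is added; at that point multiplying by \<open>i\<close> on the right cancels
  \<open>j\<close>. The remaining letters lie in \<open>set js\<close>, so the shorter word competes
  within the same rank.\<close>

lemma exchange:
  assumes "desc i (sword js)"
  shows "\<exists>ks. set ks \<subseteq> set js \<and> length ks < length js \<and> sword ks = rmul (sword js) i"
  using assms
proof (induction js)
  case Nil
  then show ?case by simp
next
  case (Cons j js)
  show ?case
  proof (cases "desc i (sword js)")
    case True
    then obtain ks where "set ks \<subseteq> set js" "length ks < length js" "sword ks = rmul (sword js) i"
      using Cons.IH by blast
    then show ?thesis by (intro exI[of _ "j # ks"]) (auto simp flip: lmul_rmul)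
  next
    case False
    then have "rmul (sword js) i = lmul j (sword js)"
      using Cons.prems desc_lmul by auto
    then have "rmul (sword (j # js)) i = sword js" by (metis lmul_lmul lmul_rmul sword_Cons)
    then show ?thesis by (intro exI[of _ js]) auto
  qed
qed

section \<open>Reduced words and the finite subgroups of rank \<open>n\<close>\<close>

definition reduced :: "nat \<Rightarrow> nat list \<Rightarrow> bool" where
  "reduced n is \<longleftrightarrow> set is \<subseteq> {..<n} \<and>
     (\<forall>js. set js \<subseteq> {..<n} \<longrightarrow> sword js = sword is \<longrightarrow> length is \<le> length js)"

lemma sword_eq_iff: "sword is = sword js \<longleftrightarrow> refl_word is = refl_word js"
  by (metis sp_sword sword.abs_eq)

lemma reduced_expr_iff: "reduced_expr n (refl_word w) is \<longleftrightarrow> reduced n is \<and> sword is = sword w"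
  unfolding reduced_expr_def reduced_def sword_eq_iff lists_eq_set by auto

lemma reduced_snoc:
  assumes "reduced n (is @ [i])"
  shows "reduced n is" "\<not> desc i (sword is)" "i < n"
proof -
  show "i < n" using assms by (simp add: reduced_def)
  have len: "length is + 1 \<le> length js" if "set js \<subseteq> {..<n}" "sword js = rmul (sword is) i" for js
    using assms that by (simp add: reduced_def sword_snoc)
  show "reduced n is"
    unfolding reduced_def
  proof (intro conjI allI impI)
    show "set is \<subseteq> {..<n}" using assms by (simp add: reduced_def)
    fix js assume js: "set js \<subseteq> {..<n}" "sword js = sword is"
    show "length is \<le> length js"
      using len[of "js @ [i]"] js assms by (simp add: reduced_def sword_snoc)
  qed
  show "\<not> desc i (sword is)"
  proof
    assume "desc i (sword is)"
    then obtain ks where "set ks \<subseteq> set is" "length ks < length is" "sword ks = rmul (sword is) i"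
      using exchange by blast
    moreover have "set is \<subseteq> {..<n}" using assms by (simp add: reduced_def)
    ultimately show False using len[of ks] by auto
  qed
qed

lemma reduced_rev: "reduced n (rev is)" if "reduced n is"
  unfolding reduced_def
proof (intro conjI allI impI)
  show "set (rev is) \<subseteq> {..<n}" using that by (simp add: reduced_def)
  fix js assume js: "set js \<subseteq> {..<n}" "sword js = sword (rev is)"
  have "sword (rev js) = sword is" by (metis js(2) rev_rev_ident sinv_sword)
  then show "length (rev is) \<le> length js"
    using that js unfolding reduced_def by (metis length_rev set_rev)
qed

definition WS :: "nat \<Rightarrow> sperm set" where "WS n = sword ` lists {..<n}"

lemma sp_image_WS: "sp ` WS n = W_B n"
  by (simp add: WS_def W_B_def image_image)

lemma WS_sone [simp]: "sone \<in> WS n"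
  unfolding WS_def by (rule image_eqI[of _ _ "[]"]) auto

lemma WS_rmul [simp]: "w \<in> WS n \<Longrightarrow> i < n \<Longrightarrow> rmul w i \<in> WS n"
  unfolding WS_def lists_eq_set
proof (clarify)
  fix js assume "set js \<subseteq> {..<n}" "i < n"
  then show "rmul (sword js) i \<in> sword ` {xs. set xs \<subseteq> {..<n}}"
    by (intro image_eqI[of _ _ "js @ [i]"]) (auto simp: sword_snoc)
qed

lemma WS_rmul_iff [simp]: "i < n \<Longrightarrow> rmul w i \<in> WS n \<longleftrightarrow> w \<in> WS n"
  by (metis WS_rmul rmul_rmul)

lemma refl_B_abs:
  assumes "i < n"
  shows "\<bar>refl_B i x\<bar> \<le> int n \<longleftrightarrow> \<bar>x\<bar> \<le> int n" "int n < \<bar>x\<bar> \<Longrightarrow> refl_B i x = x"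
  using assms by (auto simp: refl_B_eq lo_def hi_def)

lemma WS_fix: "w \<in> WS n \<Longrightarrow> int n < \<bar>x\<bar> \<Longrightarrow> sp w x = x"
proof -
  have "set is \<subseteq> {..<n} \<Longrightarrow> int n < \<bar>x\<bar> \<Longrightarrow> refl_word is x = x" for "is"
    by (induction "is") (auto simp: refl_B_abs)
  then show "w \<in> WS n \<Longrightarrow> int n < \<bar>x\<bar> \<Longrightarrow> sp w x = x" by (auto simp: WS_def lists_eq_set subset_iff)
qed

lemma WS_abs: "w \<in> WS n \<Longrightarrow> \<bar>x\<bar> \<le> int n \<Longrightarrow> \<bar>sp w x\<bar> \<le> int n"
proof -
  have "set is \<subseteq> {..<n} \<Longrightarrow> \<bar>x\<bar> \<le> int n \<Longrightarrow> \<bar>refl_word is x\<bar> \<le> int n" for "is"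
    by (induction "is") (auto simp: refl_B_abs)
  then show "w \<in> WS n \<Longrightarrow> \<bar>x\<bar> \<le> int n \<Longrightarrow> \<bar>sp w x\<bar> \<le> int n" by (auto simp: WS_def lists_eq_set subset_iff)
qed

text \<open>An element fixes everything outside the window from \<open>- n\<close> to
  \<open>n\<close> and maps the window to itself, so restriction to the window is injective.\<close>

lemma finite_WS: "finite (WS n)"
proof (rule finite_imageD)
  let ?r = "\<lambda>w. restrict (sp w) {- int n..int n}"
  show "finite (?r ` WS n)"
  proof (rule finite_subset)
    show "?r ` WS n \<subseteq> ({- int n..int n} \<rightarrow>\<^sub>E {- int n..int n})"
      using WS_abs by (auto simp: abs_le_iff) (smt (verit))+
    show "finite ({- int n..int n} \<rightarrow>\<^sub>E {- int n..int n})"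
      by (rule finite_PiE) auto
  qed
  show "inj_on ?r (WS n)"
  proof (rule inj_onI, rule sperm_eqI)
    fix v w x assume *: "v \<in> WS n" "w \<in> WS n" "?r v = ?r w"
    show "sp v x = sp w x"
    proof (cases "int n < \<bar>x\<bar>")
      case True
      then show ?thesis using * WS_fix by metis
    next
      case False
      then have "x \<in> {- int n..int n}" by auto
      then show ?thesis using *(3) by (metis restrict_apply)
    qed
  qed
qed

lemma exists_reduced: "w \<in> WS n \<Longrightarrow> \<exists>is. reduced n is \<and> sword is = w"
proof -
  assume "w \<in> WS n"
  then obtain is0 where "set is0 \<subseteq> {..<n}" "sword is0 = w" by (auto simp: WS_def lists_eq_set subset_iff)
  then obtain "is" where "set is \<subseteq> {..<n} \<and> sword is = w"
    "\<forall>js. set js \<subseteq> {..<n} \<and> sword js = w \<longrightarrow> length is \<le> length js"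
    using ex_has_least_nat[of "\<lambda>is. set is \<subseteq> {..<n} \<and> sword is = w" is0 length] by blast
  then show ?thesis unfolding reduced_def by blast
qed

section \<open>Operators on functions on signed permutations\<close>

text \<open>Linear endomorphisms form a type, so that they are an instance of \<open>ring_1\<close>
  and ordinary algebraic rewriting applies without membership conditions.\<close>

typedef (overloaded) 'k lin_op =
  "{f :: (sperm \<Rightarrow> 'k::field) \<Rightarrow> sperm \<Rightarrow> 'k.
     (\<forall>x y. f (\<lambda>w. x w + y w) = (\<lambda>w. f x w + f y w)) \<and>
     (\<forall>c x. f (\<lambda>w. c * x w) = (\<lambda>w. c * f x w))}"
  morphisms app Abs_lin_op
  by (rule exI[of _ "\<lambda>x. x"]) simp

setup_lifting type_definition_lin_op

instantiation lin_op :: (field) ring_1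
begin

lift_definition zero_lin_op :: "'a lin_op" is "\<lambda>x w. 0" by simp
lift_definition one_lin_op :: "'a lin_op" is "\<lambda>x. x" by simp
lift_definition plus_lin_op :: "'a lin_op \<Rightarrow> 'a lin_op \<Rightarrow> 'a lin_op" is
  "\<lambda>f g x w. f x w + g x w" by (simp add: algebra_simps)
lift_definition minus_lin_op :: "'a lin_op \<Rightarrow> 'a lin_op \<Rightarrow> 'a lin_op" is
  "\<lambda>f g x w. f x w - g x w" by (simp add: algebra_simps)
lift_definition uminus_lin_op :: "'a lin_op \<Rightarrow> 'a lin_op" is
  "\<lambda>f x w. - f x w" by simp
lift_definition times_lin_op :: "'a lin_op \<Rightarrow> 'a lin_op \<Rightarrow> 'a lin_op" is
  "\<lambda>f g x. f (g x)" by simp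

instance
proof
  show "(0 :: 'a lin_op) \<noteq> 1"
    by transfer (metis zero_neq_one)
qed (transfer; simp add: algebra_simps)+

end

lemma app_zero [simp]: "app 0 x w = 0" by transfer simp
lemma app_one [simp]: "app 1 x = x" by transfer simp
lemma app_plus [simp]: "app (f + g) x w = app f x w + app g x w" by transfer simp
lemma app_minus [simp]: "app (f - g) x w = app f x w - app g x w" by transfer simp
lemma app_uminus [simp]: "app (- f) x w = - app f x w" by transfer simp
lemma app_times [simp]: "app (f * g) x = app f (app g x)" by transfer simp

lemma app_scale_arg: "app f (\<lambda>w. c * x w) w = c * app f x w"
  by transfer simp
lemma app_zero_arg: "app f (\<lambda>w. 0) w = 0"
  using app_scale_arg[of f 0 "\<lambda>w. 0" w] by simp
lemma app_sum: "app (\<Sum>i\<in>I. f i) x w = (\<Sum>i\<in>I. app (f i) x w)"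
  by (induction I rule: infinite_finite_induct) simp_all

lemma lin_op_eqI: "(\<And>x w. app f x w = app g x w) \<Longrightarrow> f = g"
  by (metis app_inject ext)

lift_definition scal :: "'k::field \<Rightarrow> 'k lin_op" is "\<lambda>c x w. c * x w"
  by (simp add: algebra_simps)

lemma app_scal [simp]: "app (scal c) x w = c * x w" by transfer simp

lemma scal_zero [simp]: "scal 0 = 0" by (rule lin_op_eqI) simp
lemma scal_one [simp]: "scal 1 = 1" by (rule lin_op_eqI) simp
lemma scal_add: "scal (a + b) = scal a + scal b" by (rule lin_op_eqI) (simp add: algebra_simps)
lemma scal_diff: "scal (a - b) = scal a - scal b" by (rule lin_op_eqI) (simp add: algebra_simps)
lemma scal_minus: "scal (- a) = - scal a" by (rule lin_op_eqI) (simp add: algebra_simps)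
lemma scal_mult: "scal (a * b) = scal a * scal b" by (rule lin_op_eqI) (simp add: algebra_simps)
lemma scal_comm: "f * scal c = scal c * f"
proof (rule lin_op_eqI)
  fix x w
  have "app (scal c) x = (\<lambda>w. c * x w)" by auto
  then show "app (f * scal c) x w = app (scal c * f) x w" by (simp add: app_scale_arg)
qed

text \<open>Let the point mass at \<open>w\<close> stand for \<open>T\<close> at the inverse of
  \<open>w\<close>. Then \<open>opU\<close> is left multiplication by the generator satisfying
  \<open>T\<^sub>i\<^sup>2 = 1 + g T\<^sub>i\<close> (with \<open>g0\<close> for
  \<open>i = 0\<close>), and \<open>opR\<close> is right multiplication.\<close>

lift_definition opU :: "'k::field \<Rightarrow> 'k \<Rightarrow> nat \<Rightarrow> 'k lin_op" is
  "\<lambda>g g0 i x w. x (rmul w i) + (if desc i w then (if i = 0 then g0 else g) * x w else 0)"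
  by (auto simp: fun_eq_iff algebra_simps)

lift_definition opR :: "'k::field \<Rightarrow> 'k \<Rightarrow> nat \<Rightarrow> 'k lin_op" is
  "\<lambda>g g0 j x w. x (lmul j w) + (if desc j (sinv w) then (if j = 0 then g0 else g) * x w else 0)"
  by (auto simp: fun_eq_iff algebra_simps)

lemma app_opU: "app (opU g g0 i) x w =
    x (rmul w i) + (if desc i w then (if i = 0 then g0 else g) * x w else 0)"
  by (simp add: opU.rep_eq)
lemma app_opR: "app (opR g g0 j) x w =
    x (lmul j w) + (if desc j (sinv w) then (if j = 0 then g0 else g) * x w else 0)"
  by (simp add: opR.rep_eq)

lemma opU_square: "opU g g0 i * opU g g0 i = 1 + scal (if i = 0 then g0 else g) * opU g g0 i"
  by (rule lin_op_eqI) (simp add: app_opU algebra_simps)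

text \<open>The delicate case is \<open>rmul w i = lmul j w\<close>: both sides then involve only
  \<open>w\<close> and one neighbour, and they agree because the two descents and the two parameters
  coincide. Otherwise neither descent is affected by the other multiplication.\<close>

lemma opR_opU: "opR g g0 j * opU g g0 i = opU g g0 i * opR g g0 j"
proof (rule lin_op_eqI)
  fix x w
  show "app (opR g g0 j * opU g g0 i) x w = app (opU g g0 i * opR g g0 j) x w"
  proof (cases "rmul w i = lmul j w")
    case True
    have "desc j (sinv w) \<longleftrightarrow> desc i w" "i = 0 \<longleftrightarrow> j = 0"
      using True desc_sinv_eq rmul_eq_lmul_zero by blast+
    moreover obtain w' where w': "lmul j w = w'" "rmul w i = w'" "rmul w' i = w" "lmul j w' = w"
      using True by (metis rmul_rmul lmul_lmul)
    moreover have "desc i w' \<longleftrightarrow> \<not> desc i w" "desc j (sinv w') \<longleftrightarrow> \<not> desc j (sinv w)"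
      using desc_rmul[of i w] desc_rmul[of j "sinv w"] w' by (auto simp flip: sinv_lmul)
    ultimately show ?thesis by (simp add: app_opU app_opR)
  next
    case False
    have "desc i (lmul j w) \<longleftrightarrow> desc i w" "desc j (sinv (rmul w i)) \<longleftrightarrow> desc j (sinv w)"
      using False desc_lmul desc_sinv_rmul by auto
    moreover have "rmul (lmul j w) i = lmul j (rmul w i)" by (simp add: lmul_rmul)
    ultimately show ?thesis
      by (simp add: app_opU app_opR algebra_simps del: sinv_rmul)
  qed
qed

definition commR :: "'k::field \<Rightarrow> 'k \<Rightarrow> 'k lin_op \<Rightarrow> bool" where
  "commR g g0 X \<longleftrightarrow> (\<forall>j. opR g g0 j * X = X * opR g g0 j)"

lemma commR_simps [intro, simp]:
  "commR g g0 (opU g g0 i)" "commR g g0 (scal c)" "commR g g0 1" "commR g g0 0"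
  "commR g g0 X \<Longrightarrow> commR g g0 Y \<Longrightarrow> commR g g0 (X * Y)"
  "commR g g0 X \<Longrightarrow> commR g g0 Y \<Longrightarrow> commR g g0 (X + Y)"
  "commR g g0 X \<Longrightarrow> commR g g0 Y \<Longrightarrow> commR g g0 (X - Y)"
  unfolding commR_def
  by (auto simp: opR_opU scal_comm algebra_simps) (metis mult.assoc)

lemma commR_app: "commR g g0 X \<Longrightarrow> app X (app (opR g g0 j) x) = app (opR g g0 j) (app X x)"
  unfolding commR_def by (metis app_times)

text \<open>\<open>opR\<close> expresses the value of a function at \<open>lmul j w\<close> through
  values at \<open>w\<close>. For an operator commuting with every \<open>opR\<close>, vanishing at
  \<open>w\<close> for all arguments therefore spreads from \<open>sone\<close> to the whole
  group.\<close>

lemma commR_eqI: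
  assumes X: "commR g g0 X" "commR g g0 Y" "\<And>x. app X x sone = app Y x sone"
  shows "X = Y"
proof -
  define Z where "Z = X - Y"
  have Z: "commR g g0 Z" using X by (simp add: Z_def)
  have "\<forall>x. app Z x w = 0" for w
  proof (induction w rule: sperm_induct)
    case one
    then show ?case using X by (simp add: Z_def)
  next
    case (lmul j w)
    show ?case
    proof
      fix x
      have "app (opR g g0 j) (app Z x) w = 0"
        using lmul commR_app[OF Z, of j x] by metis
      then show "app Z x (lmul j w) = 0" using lmul by (simp add: app_opR split: if_splits)
    qed
  qed
  then have "Z = 0" by (intro lin_op_eqI) simp
  then show ?thesis by (simp add: Z_def)
qed

section \<open>Braid relations for reflections and for operators\<close>

lemma refl_B_far:
  assumes "z \<in> {lo l, hi l, - lo l, - hi l}" "k + 2 \<le> l \<or> l + 2 \<le> k"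
  shows "refl_B k z = z"
  unfolding refl_B_fixed using assms by (auto simp: lo_def hi_def split: if_splits)

lemma refl_B_commute:
  assumes "i + 2 \<le> j \<or> j + 2 \<le> i"
  shows "refl_B i (refl_B j x) = refl_B j (refl_B i x)"
proof -
  note * = refl_B_far
  have j: "refl_B j z \<in> {lo j, hi j, - lo j, - hi j}" if "z \<in> {lo j, hi j, - lo j, - hi j}" for j z
    using that by auto
  show ?thesis
  proof (cases "x \<in> {lo j, hi j, - lo j, - hi j}")
    case True
    have "refl_B i x = x" "refl_B i (refl_B j x) = refl_B j x"
      using *[OF True] *[OF j[OF True]] assms by auto
    then show ?thesis by simp
  next
    case False
    then have f: "refl_B j x = x" by (rule refl_B_fixed[THEN iffD2])
    show ?thesis
    proof (cases "x \<in> {lo i, hi i, - lo i, - hi i}")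
      case True
      then have "refl_B j (refl_B i x) = refl_B i x"
        using *[OF j[OF True]] assms by auto
      then show ?thesis using f by simp
    next
      case False
      then have "refl_B i x = x" by (rule refl_B_fixed[THEN iffD2])
      then show ?thesis using f by simp
    qed
  qed
qed

lemma refl_B_braid:
  assumes "1 \<le> i"
  shows "refl_B i (refl_B (i + 1) (refl_B i x)) = refl_B (i + 1) (refl_B i (refl_B (i + 1) x))"
proof -
  have r: "refl_B k z = (if z = int k then int k + 1 else if z = int k + 1 then int k
      else if z = - int k then - int k - 1 else if z = - int k - 1 then - int k else z)" if "1 \<le> k" for k z
    using that by (simp add: refl_B_eq lo_def hi_def)
  have "int i > 0" using assms by simp
  moreover consider "x = int i" | "x = int i + 1" | "x = int i + 2" | "x = - int i" | "x = - int i - 1"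
    | "x = - int i - 2" | "x \<notin> {int i, int i + 1, int i + 2, - int i, - int i - 1, - int i - 2}" by blast
  ultimately show ?thesis using assms by cases (simp_all add: r)
qed

lemma refl_B_braid0:
  "refl_B 0 (refl_B 1 (refl_B 0 (refl_B 1 x))) = refl_B 1 (refl_B 0 (refl_B 1 (refl_B 0 x)))"
proof -
  consider "x = 1" | "x = - 1" | "x = 2" | "x = - 2" | "x \<notin> {1, - 1, 2, - 2}" by blast
  then show ?thesis by cases (simp_all add: refl_B_eq lo_def hi_def)
qed

text \<open>At \<open>sone\<close> no descent occurs along the two words, so each side is a single
  value of \<open>x\<close> and the claim reduces to the relation in the group. The two braid
  relations below are treated in the same way.\<close>

lemma opU_commute:
  assumes "i + 2 \<le> j \<or> j + 2 \<le> i"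
  shows "opU g g0 i * opU g g0 j = opU g g0 j * opU g g0 i"
proof (rule commR_eqI[of g g0])
  have "rmul (rmul sone i) j = rmul (rmul sone j) i"
    by (rule sperm_eqI) (use assms refl_B_commute in simp)
  moreover have "\<not> desc j (rmul sone i)" "\<not> desc i (rmul sone j)"
    using assms refl_B_far[of "hi j" j i] refl_B_far[of "lo j" j i]
      refl_B_far[of "hi i" i j] refl_B_far[of "lo i" i j]
    by (auto simp: desc_def)
  ultimately show "app (opU g g0 i * opU g g0 j) x sone = app (opU g g0 j * opU g g0 i) x sone" for x
    by (simp add: app_opU)
qed auto

lemma opU_braid:
  assumes "1 \<le> i"
  shows "opU g g0 i * opU g g0 (i + 1) * opU g g0 i = opU g g0 (i + 1) * opU g g0 i * opU g g0 (i + 1)"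
proof (rule commR_eqI[of g g0])
  have vals: "lo i = int i" "hi i = int i + 1" "lo (i + 1) = int i + 1" "hi (i + 1) = int i + 2"
    "refl_B i (int i) = int i + 1" "refl_B i (int i + 1) = int i" "refl_B i (int i + 2) = int i + 2"
    "refl_B (i + 1) (int i) = int i" "refl_B (i + 1) (int i + 1) = int i + 2"
    "refl_B (i + 1) (int i + 2) = int i + 1"
    using assms by (simp_all add: refl_B_eq lo_def hi_def)
  have "rmul (rmul (rmul sone i) (i + 1)) i = rmul (rmul (rmul sone (i + 1)) i) (i + 1)"
    by (rule sperm_eqI) (use assms refl_B_braid in simp)
  moreover have "\<not> desc (i + 1) (rmul sone i)" "\<not> desc i (rmul (rmul sone i) (i + 1))"
    "\<not> desc i (rmul sone (i + 1))" "\<not> desc (i + 1) (rmul (rmul sone (i + 1)) i)"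
    unfolding desc_def sp_rmul sp_sone vals by simp_all
  ultimately show "app (opU g g0 i * opU g g0 (i + 1) * opU g g0 i) x sone
      = app (opU g g0 (i + 1) * opU g g0 i * opU g g0 (i + 1)) x sone" for x
    by (simp add: app_opU)
qed auto

lemma opU_braid0:
  "opU g g0 0 * opU g g0 1 * opU g g0 0 * opU g g0 1 = opU g g0 1 * opU g g0 0 * opU g g0 1 * opU g g0 0"
proof (rule commR_eqI[of g g0])
  have vals: "lo 0 = - 1" "hi 0 = 1" "lo 1 = 1" "hi 1 = 2"
    "refl_B 0 1 = - 1" "refl_B 0 (- 1) = 1" "refl_B 0 2 = 2" "refl_B 0 (- 2) = - 2"
    "refl_B 1 1 = 2" "refl_B 1 2 = 1" "refl_B 1 (- 1) = - 2" "refl_B 1 (- 2) = - 1"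
    by (simp_all add: refl_B_eq lo_def hi_def)
  have "rmul (rmul (rmul (rmul sone 0) 1) 0) 1 = rmul (rmul (rmul (rmul sone 1) 0) 1) 0"
    by (rule sperm_eqI) (use refl_B_braid0 in simp)
  moreover have "\<not> desc 1 (rmul sone 0)" "\<not> desc 0 (rmul (rmul sone 0) 1)"
    "\<not> desc 1 (rmul (rmul (rmul sone 0) 1) 0)"
    "\<not> desc 0 (rmul sone 1)" "\<not> desc 1 (rmul (rmul sone 1) 0)"
    "\<not> desc 0 (rmul (rmul (rmul sone 1) 0) 1)"
    unfolding desc_def sp_rmul sp_sone vals by simp_all
  ultimately show "app (opU g g0 0 * opU g g0 1 * opU g g0 0 * opU g g0 1) x sone
      = app (opU g g0 1 * opU g g0 0 * opU g g0 1 * opU g g0 0) x sone" for x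
    by (simp add: app_opU)
qed auto

section \<open>Point masses and the trace functional\<close>

definition ev :: "sperm \<Rightarrow> sperm \<Rightarrow> 'k::field" where
  "ev w = (\<lambda>x. if x = w then 1 else 0)"

lemma rmul_eq_iff: "rmul x i = w \<longleftrightarrow> x = rmul w i"
  by (metis rmul_rmul)

lemma app_opU_ev: "\<not> desc i w \<Longrightarrow> app (opU g g0 i) (ev w) = ev (rmul w i)"
  by (auto simp: fun_eq_iff app_opU ev_def rmul_eq_iff)

definition wprod :: "(nat \<Rightarrow> 'a::monoid_mult) \<Rightarrow> nat list \<Rightarrow> 'a" where
  "wprod f is = prod_list (map f is)"

lemma wprod_simps [simp]:
  "wprod f [] = 1" "wprod f (i # is) = f i * wprod f is"
  "wprod f (xs @ ys) = wprod f xs * wprod f ys"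
  by (auto simp: wprod_def)

text \<open>Every letter of a reduced word is an ascent, so no correction term appears. The word is
  reversed because its first letter has to act first.\<close>

lemma app_wprod_reduced:
  "reduced n is \<Longrightarrow> app (wprod (opU g g0) (rev is)) (ev sone) = ev (sword is)"
proof (induction "is" rule: rev_induct)
  case Nil
  then show ?case by simp
next
  case (snoc i "is")
  then show ?case using reduced_snoc[OF snoc.prems] by (simp add: app_opU_ev sword_snoc)
qed

definition tau :: "'k::field lin_op \<Rightarrow> 'k" where
  "tau X = app X (ev sone) sone"

lemma tau_simps [simp]:
  "tau (X + Y) = tau X + tau Y" "tau (X - Y) = tau X - tau Y" "tau 0 = 0"
  "tau (scal c * X) = c * tau X" "tau 1 = 1" "tau (scal c) = c"
  by (auto simp: tau_def ev_def)

text \<open>On the point mass at \<open>sone\<close> left and right multiplication by a generator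
  agree, and the right multiplication can be moved past \<open>X\<close>.\<close>

lemma tau_opU_comm:
  assumes "commR g g0 X"
  shows "tau (X * opU g g0 i) = tau (opU g g0 i * X)" "tau (opU g g0 i * X) = app X (ev sone) (rmul sone i)"
proof -
  have "app (opR g g0 i) (ev sone) = ev (lmul i sone)"
  proof
    fix x
    have "lmul i x = sone \<longleftrightarrow> x = lmul i sone" by (metis lmul_lmul)
    then show "app (opR g g0 i) (ev sone) x = ev (lmul i sone) x"
      by (auto simp: app_opR ev_def)
  qed
  also have "\<dots> = app (opU g g0 i) (ev sone)"
    by (simp add: app_opU_ev lmul_sone)
  finally have "app (opU g g0 i) (ev sone) = app (opR g g0 i) (ev sone)" by simp
  then have "tau (X * opU g g0 i) = app (opR g g0 i) (app X (ev sone)) sone"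
    by (simp add: tau_def commR_app[OF assms])
  also have "\<dots> = app X (ev sone) (rmul sone i)" by (simp add: app_opR lmul_sone)
  finally show "tau (X * opU g g0 i) = tau (opU g g0 i * X)" "tau (opU g g0 i * X) = app X (ev sone) (rmul sone i)"
    by (simp_all add: tau_def app_opU)
qed

section \<open>Braid relations\<close>

text \<open>Stated for arbitrary monoids, so that the same identities serve for words modulo braid
  moves and for the operators \<open>U\<close>.\<close>

locale braid_gens =
  fixes f :: "nat \<Rightarrow> 'a::monoid_mult"
  assumes far: "i + 2 \<le> j \<or> j + 2 \<le> i \<Longrightarrow> f i * f j = f j * f i"
    and braid: "1 \<le> i \<Longrightarrow> f i * f (i + 1) * f i = f (i + 1) * f i * f (i + 1)"
    and braid0: "f 0 * f 1 * f 0 * f 1 = f 1 * f 0 * f 1 * f 0"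
begin

lemma far_word:
  "(\<And>j. j \<in> set is \<Longrightarrow> i + 2 \<le> j \<or> j + 2 \<le> i) \<Longrightarrow> f i * wprod f is = wprod f is * f i"
proof (induction "is")
  case Nil
  then show ?case by simp
next
  case (Cons j "is")
  have "f i * wprod f (j # is) = f j * (f i * wprod f is)"
    using far[of i j] Cons.prems[of j] by (simp flip: mult.assoc)
  then show ?case using Cons by (simp add: mult.assoc)
qed

text \<open>A generator that passes through an ascending word has its index lowered by one. For
  \<open>m = 0\<close> the index \<open>i = 1\<close> is excluded, as the relation between
  \<open>f 0\<close> and \<open>f 1\<close> has length four.\<close>

lemma up:
  assumes "m < i" "i < n" "m = 0 \<longrightarrow> 2 \<le> i"
  shows "f i * wprod f [m..<n] = wprod f [m..<n] * f (i - 1)"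
proof -
  define a b where "a = wprod f [m..<i - 1]" and "b = wprod f [i + 1..<n]"
  have "[m..<n] = [m..<i - 1] @ [i - 1..<n]"
    using assms upt_add_eq_append[of m "i - 1" "n - (i - 1)"] by simp
  also have "[i - 1..<n] = [i - 1, i] @ [i + 1..<n]"
    using assms by (simp add: upt_conv_Cons)
  finally have w: "wprod f [m..<n] = a * (f (i - 1) * f i * b)"
    by (simp add: a_def b_def mult.assoc)
  have a: "f i * a = a * f i" unfolding a_def using assms by (intro far_word) auto
  have b: "f (i - 1) * b = b * f (i - 1)" unfolding b_def using assms by (intro far_word) auto
  have br: "f i * f (i - 1) * f i = f (i - 1) * f i * f (i - 1)"
  proof -
    have "1 \<le> i - 1" "i - 1 + 1 = i" using assms by auto
    then show ?thesis using braid[of "i - 1"] by metis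
  qed
  have "f i * wprod f [m..<n] = a * (f i * f (i - 1) * f i) * b"
    unfolding w by (simp add: a mult.assoc flip: mult.assoc[of "f i" a])
  also have "\<dots> = a * (f (i - 1) * f i * (f (i - 1) * b))" unfolding br by (simp only: mult.assoc)
  also have "\<dots> = wprod f [m..<n] * f (i - 1)" unfolding w b by (simp add: mult.assoc)
  finally show ?thesis .
qed

lemma down:
  assumes "1 \<le> i" "i + 1 < m"
  shows "f i * wprod f (rev [1..<m]) = wprod f (rev [1..<m]) * f (i + 1)"
proof -
  define a b where "a = wprod f (rev [i + 2..<m])" and "b = wprod f (rev [1..<i])"
  have "[1..<m] = [1..<i] @ [i..<m]"
    using assms upt_add_eq_append[of 1 i "m - i"] by simp
  also have "[i..<m] = [i, i + 1] @ [i + 2..<m]"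
    using assms by (simp add: upt_conv_Cons)
  finally have w: "wprod f (rev [1..<m]) = a * (f (i + 1) * f i * b)"
    by (simp add: a_def b_def mult.assoc)
  have a: "f i * a = a * f i" unfolding a_def using assms by (intro far_word) auto
  have b: "f (i + 1) * b = b * f (i + 1)" unfolding b_def using assms by (intro far_word) auto
  have br: "f i * f (i + 1) * f i = f (i + 1) * f i * f (i + 1)"
    using braid assms by simp
  have "f i * wprod f (rev [1..<m]) = a * (f i * f (i + 1) * f i) * b"
    unfolding w by (simp add: a mult.assoc flip: mult.assoc[of "f i" a])
  also have "\<dots> = a * (f (i + 1) * f i * (f (i + 1) * b))" unfolding br by (simp only: mult.assoc)
  also have "\<dots> = wprod f (rev [1..<m]) * f (i + 1)" unfolding w b by (simp add: mult.assoc)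
  finally show ?thesis .
qed

text \<open>The descending half raises the index and the ascending half lowers it again. For
  \<open>m = n\<close> the word is that of a Jucys--Murphy element, which is thus seen to commute
  with smaller generators.\<close>

lemma neg_low:
  assumes "1 \<le> i" "i + 1 < m" "m \<le> n"
  shows "f i * wprod f (rev [1..<m] @ [0..<n]) = wprod f (rev [1..<m] @ [0..<n]) * f i"
proof -
  have "f i * wprod f (rev [1..<m] @ [0..<n]) = wprod f (rev [1..<m]) * (f (i + 1) * wprod f [0..<n])"
    using down[of i m] assms by (simp flip: mult.assoc)
  also have "f (i + 1) * wprod f [0..<n] = wprod f [0..<n] * f i"
    using up[of 0 "i + 1" n] assms by simp
  finally show ?thesis by (simp add: mult.assoc)
qed

lemma neg_high:
  assumes "1 \<le> m" "m < i" "i < n"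
  shows "f i * wprod f (rev [1..<m] @ [0..<n]) = wprod f (rev [1..<m] @ [0..<n]) * f (i - 1)"
proof -
  have "f i * wprod f (rev [1..<m]) = wprod f (rev [1..<m]) * f i"
    using assms by (intro far_word) auto
  moreover have "f i * wprod f [0..<n] = wprod f [0..<n] * f (i - 1)"
    using assms by (intro up) auto
  ultimately show ?thesis by (metis mult.assoc wprod_simps(3))
qed

lemma neg_zero:
  assumes "2 \<le> m" "m \<le> n"
  shows "f 0 * wprod f (rev [1..<m] @ [0..<n]) = wprod f (rev [1..<m] @ [0..<n]) * f 0"
proof -
  define a b where "a = wprod f (rev [2..<m])" and "b = wprod f [2..<n]"
  have "[1..<m] = 1 # [2..<m]" "[0..<n] = [0, 1] @ [2..<n]"
    using assms by (simp_all add: upt_conv_Cons numeral_2_eq_2)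
  then have w: "wprod f (rev [1..<m] @ [0..<n]) = a * (f 1 * f 0 * f 1 * b)"
    by (simp add: a_def b_def mult.assoc)
  have a: "f 0 * a = a * f 0" unfolding a_def using assms by (intro far_word) auto
  have b: "f 0 * b = b * f 0" unfolding b_def using assms by (intro far_word) auto
  have "f 0 * wprod f (rev [1..<m] @ [0..<n]) = a * (f 0 * f 1 * f 0 * f 1) * b"
    unfolding w by (simp add: a mult.assoc flip: mult.assoc[of "f 0" a])
  also have "\<dots> = a * (f 1 * f 0 * f 1 * (f 0 * b))" unfolding braid0 by (simp only: mult.assoc)
  also have "\<dots> = wprod f (rev [1..<m] @ [0..<n]) * f 0" unfolding w b by (simp add: mult.assoc)
  finally show ?thesis .
qed

end

text \<open>The monoid of the infinite braid group of type \<open>B\<close>: the identities above, proved once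
  in monoids, can be read as statements about words.\<close>

inductive beq :: "nat list \<Rightarrow> nat list \<Rightarrow> bool" where
  beq_refl: "beq xs xs"
| beq_sym: "beq xs ys \<Longrightarrow> beq ys xs"
| beq_trans: "beq xs ys \<Longrightarrow> beq ys zs \<Longrightarrow> beq xs zs"
| beq_far: "i + 2 \<le> j \<or> j + 2 \<le> i \<Longrightarrow> beq (p @ [i, j] @ s) (p @ [j, i] @ s)"
| beq_braid: "1 \<le> i \<Longrightarrow> beq (p @ [i, i + 1, i] @ s) (p @ [i + 1, i, i + 1] @ s)"
| beq_braid0: "beq (p @ [0, 1, 0, 1] @ s) (p @ [1, 0, 1, 0] @ s)"

text \<open>Braid moves keep the set of letters, so a chain of moves never leaves the generators of
  a given rank.\<close>

lemma beq_set: "beq xs ys \<Longrightarrow> set xs = set ys"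
  by (induction rule: beq.induct) auto

lemma beq_append_left: "beq xs ys \<Longrightarrow> beq (zs @ xs) (zs @ ys)"
proof (induction rule: beq.induct)
  case (beq_far i j p s)
  then show ?case using beq.beq_far[of i j "zs @ p" s] by simp
next
  case (beq_braid i p s)
  then show ?case using beq.beq_braid[of i "zs @ p" s] by simp
next
  case (beq_braid0 p s)
  then show ?case using beq.beq_braid0[of "zs @ p" s] by simp
qed (auto intro: beq.beq_refl beq.beq_sym beq.beq_trans)

lemma beq_append_right: "beq xs ys \<Longrightarrow> beq (xs @ zs) (ys @ zs)"
proof (induction rule: beq.induct)
  case (beq_far i j p s)
  then show ?case using beq.beq_far[of i j p "s @ zs"] by simp
next
  case (beq_braid i p s)
  then show ?case using beq.beq_braid[of i p "s @ zs"] by simp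
next
  case (beq_braid0 p s)
  then show ?case using beq.beq_braid0[of p "s @ zs"] by simp
qed (auto intro: beq.beq_refl beq.beq_sym beq.beq_trans)

quotient_type braid_monoid = "nat list" / beq
  by (rule equivpI) (auto intro: reflpI sympI transpI beq_refl beq_sym elim: beq_trans)

instantiation braid_monoid :: monoid_mult
begin

lift_definition one_braid_monoid :: braid_monoid is "[]" .
lift_definition times_braid_monoid :: "braid_monoid \<Rightarrow> braid_monoid \<Rightarrow> braid_monoid" is append
  by (meson beq_append_left beq_append_right beq_trans)

instance by standard (transfer; simp add: beq_refl)+

end

lift_definition bgen :: "nat \<Rightarrow> braid_monoid" is "\<lambda>i. [i]" .

lemma wprod_bgen: "wprod bgen is = abs_braid_monoid is"
  by (induction "is") (simp_all add: one_braid_monoid_def bgen_def times_braid_monoid.abs_eq)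

interpretation bgen: braid_gens bgen
proof
  show "bgen i * bgen j = bgen j * bgen i" if "i + 2 \<le> j \<or> j + 2 \<le> i" for i j
    using beq_far[OF that, of "[]" "[]"] by transfer simp
  show "bgen i * bgen (i + 1) * bgen i = bgen (i + 1) * bgen i * bgen (i + 1)" if "1 \<le> i" for i
    using beq_braid[OF that, of "[]" "[]"] by transfer simp
  show "bgen 0 * bgen 1 * bgen 0 * bgen 1 = bgen 1 * bgen 0 * bgen 1 * bgen 0"
    using beq_braid0[of "[]" "[]"] by transfer simp
qed

lemma beq_iff: "beq xs ys \<longleftrightarrow> wprod bgen xs = wprod bgen ys"
  by (simp add: wprod_bgen braid_monoid.abs_eq_iff)

lemma beq_up:
  "m < i \<Longrightarrow> i < n \<Longrightarrow> m = 0 \<longrightarrow> 2 \<le> i \<Longrightarrow> beq (i # [m..<n]) ([m..<n] @ [i - 1])"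
  unfolding beq_iff using bgen.up[of m i n] by simp

lemma beq_far_word:
  "(\<And>j. j \<in> set is \<Longrightarrow> i + 2 \<le> j \<or> j + 2 \<le> i) \<Longrightarrow> beq (i # is) (is @ [i])"
  unfolding beq_iff using bgen.far_word[of "is" i] by simp

lemma beq_neg_low: "1 \<le> i \<Longrightarrow> i + 1 < m \<Longrightarrow> m \<le> n \<Longrightarrow>
    beq (i # rev [1..<m] @ [0..<n]) ((rev [1..<m] @ [0..<n]) @ [i])"
  unfolding beq_iff using bgen.neg_low[of i m n] by (simp add: mult.assoc)

lemma beq_neg_high: "1 \<le> m \<Longrightarrow> m < i \<Longrightarrow> i < n \<Longrightarrow>
    beq (i # rev [1..<m] @ [0..<n]) ((rev [1..<m] @ [0..<n]) @ [i - 1])"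
  unfolding beq_iff using bgen.neg_high[of m i n] by (simp add: mult.assoc)

lemma beq_neg_zero: "2 \<le> m \<Longrightarrow> m \<le> n \<Longrightarrow>
    beq (0 # rev [1..<m] @ [0..<n]) ((rev [1..<m] @ [0..<n]) @ [0])"
  unfolding beq_iff using bgen.neg_zero[of m n] by (simp add: mult.assoc)


section \<open>Linear extension from words\<close>

definition fmono :: "nat list \<Rightarrow> fword \<Rightarrow>\<^sub>0 'k::field" where
  "fmono is = Poly_Mapping.single (Word is) 1"

text \<open>One construction for the representations, the anti-involution, the semilinear bar map,
  extension of scalars and linear functionals: \<open>\<sigma>\<close> transports coefficients and
  \<open>G\<close> gives the values on words.\<close>

definition lext :: "('k::field \<Rightarrow> 'a::ring_1) \<Rightarrow> (nat list \<Rightarrow> 'a) \<Rightarrow> (fword \<Rightarrow>\<^sub>0 'k) \<Rightarrow> 'a" where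
  "lext \<sigma> G x = (\<Sum>w\<in>Poly_Mapping.keys x. \<sigma> (Poly_Mapping.lookup x w) * G (letters w))"

lemma pm_induct [case_names single add]:
  assumes "\<And>w c. P (Poly_Mapping.single w c)" "\<And>x y. P x \<Longrightarrow> P y \<Longrightarrow> P (x + y)"
  shows "P (x :: 'b \<Rightarrow>\<^sub>0 'k::field)"
proof -
  have "P (\<Sum>w\<in>S. Poly_Mapping.single w (Poly_Mapping.lookup x w))" if "finite S" for S
    using that
  proof (induction S)
    case empty
    then show ?case using assms(1)[of undefined 0] by simp
  qed (auto intro: assms)
  moreover have "x = (\<Sum>w\<in>Poly_Mapping.keys x. Poly_Mapping.single w (Poly_Mapping.lookup x w))"
    by (rule poly_mapping_eqI)
      (simp add: lookup_sum lookup_single when_def sum.delta in_keys_iff if_distrib cong: if_cong)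
  ultimately show ?thesis by (metis finite_keys)
qed

lemma single_word: "Poly_Mapping.single w c = free_scal c * fmono (letters w)"
  by (simp add: free_scal_def fmono_def mult_single)

lemma mono_Nil [simp]: "fmono [] = 1"
  by (simp add: fmono_def flip: zero_fword_def)

lemma mono_append: "fmono (xs @ ys) = fmono xs * fmono ys"
  by (simp add: fmono_def mult_single plus_fword_def)

lemma free_gen_mono: "free_gen i = fmono [i]"
  by (simp add: free_gen_def fmono_def)

lemma wprod_free_gen: "wprod free_gen is = fmono is"
  by (induction "is") (simp_all add: free_gen_mono flip: mono_append)

lemma mono_Cons: "fmono (i # is) = free_gen i * fmono is"
  by (simp add: free_gen_mono flip: mono_append)

lemma free_scal_simps [simp]:
  "free_scal 0 = 0" "free_scal 1 = 1"
  by (simp_all add: free_scal_def)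

lemma free_scal_add: "free_scal (a + b) = free_scal a + free_scal b"
  and free_scal_diff: "free_scal (a - b) = free_scal a - free_scal b"
  and free_scal_minus: "free_scal (- a) = - free_scal a"
  and free_scal_mult: "free_scal (a * b) = free_scal a * free_scal b"
  by (simp_all add: free_scal_def single_add single_diff single_uminus mult_single)

lemma free_scal_comm: "x * free_scal c = free_scal c * x"
proof (induction x rule: pm_induct)
  case (single w d)
  then show ?case by (simp add: free_scal_def mult_single mult.commute)
qed (simp add: algebra_simps)

locale lin_ext =
  fixes \<sigma> :: "'k::field \<Rightarrow> 'a::ring_1" and G :: "nat list \<Rightarrow> 'a"
  assumes sig_add: "\<sigma> (a + b) = \<sigma> a + \<sigma> b"
begin

lemma sig_zero: "\<sigma> 0 = 0"
  using sig_add[of 0 0] by simp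

lemma ext_superset:
  assumes "finite S" "Poly_Mapping.keys x \<subseteq> S"
  shows "lext \<sigma> G x = (\<Sum>w\<in>S. \<sigma> (Poly_Mapping.lookup x w) * G (letters w))"
  unfolding lext_def using assms
  by (intro sum.mono_neutral_left) (auto simp: sig_zero in_keys_iff)

lemma ext_add: "lext \<sigma> G (x + y) = lext \<sigma> G x + lext \<sigma> G y"
proof -
  let ?S = "Poly_Mapping.keys x \<union> Poly_Mapping.keys y"
  have "lext \<sigma> G z = (\<Sum>w\<in>?S. \<sigma> (Poly_Mapping.lookup z w) * G (letters w))"
    if "z \<in> {x, y, x + y}" for z
    using that keys_add[of x y] by (intro ext_superset) auto
  then show ?thesis by (simp add: lookup_add sig_add algebra_simps sum.distrib)
qed

lemma ext_zero [simp]: "lext \<sigma> G 0 = 0"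
  by (simp add: lext_def)

lemma ext_minus: "lext \<sigma> G (- x) = - lext \<sigma> G x"
  using ext_add[of x "- x"] by (simp add: eq_neg_iff_add_eq_0 add.commute)

lemma ext_diff: "lext \<sigma> G (x - y) = lext \<sigma> G x - lext \<sigma> G y"
  using ext_add[of x "- y"] by (simp add: ext_minus)

lemma ext_sum: "lext \<sigma> G (\<Sum>i\<in>I. x i) = (\<Sum>i\<in>I. lext \<sigma> G (x i))"
  by (induction I rule: infinite_finite_induct) (simp_all add: ext_add)

lemma ext_single: "lext \<sigma> G (Poly_Mapping.single w c) = \<sigma> c * G (letters w)"
  by (simp add: lext_def sig_zero)

lemma ext_mono': "lext \<sigma> G (free_scal c * fmono is) = \<sigma> c * G is"
  using ext_single[of "Word is" c] by (simp add: single_word)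

end

locale alg_ext = lin_ext +
  assumes sig_one: "\<sigma> 1 = 1" and sig_mult: "\<sigma> (a * b) = \<sigma> a * \<sigma> b"
    and sig_comm: "z * \<sigma> c = \<sigma> c * z"
    and G_Nil: "G [] = 1"
begin

lemma ext_mono: "lext \<sigma> G (fmono is) = G is"
  using ext_mono'[of 1 "is"] by (simp add: sig_one)

lemma ext_gen: "lext \<sigma> G (free_gen i) = G [i]"
  by (simp add: free_gen_mono ext_mono)

lemma ext_one [simp]: "lext \<sigma> G 1 = 1"
  using ext_mono[of "[]"] by (simp add: G_Nil)

lemma ext_scal: "lext \<sigma> G (free_scal c) = \<sigma> c"
  using ext_mono'[of c "[]"] by (simp add: G_Nil)

lemma ext_mult:
  assumes "\<And>xs ys. G (xs @ ys) = G xs * G ys"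
  shows "lext \<sigma> G (x * y) = lext \<sigma> G x * lext \<sigma> G y"
proof (induction x rule: pm_induct)
  case (single w c)
  show ?case
  proof (induction y rule: pm_induct)
    case (single v d)
    show ?case
      by (simp add: mult_single ext_single plus_fword_def assms sig_mult)
        (metis mult.assoc sig_comm)
  qed (simp add: ext_add algebra_simps)
qed (simp add: ext_add algebra_simps)

lemma ext_anti_mult:
  assumes "\<And>xs ys. G (xs @ ys) = G ys * G xs"
  shows "lext \<sigma> G (x * y) = lext \<sigma> G y * lext \<sigma> G x"
proof (induction x rule: pm_induct)
  case (single w c)
  show ?case
  proof (induction y rule: pm_induct)
    case (single v d)
    show ?case
      by (simp add: mult_single ext_single plus_fword_def assms sig_mult)
        (metis mult.assoc sig_comm)
  qed (simp add: ext_add algebra_simps)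
qed (simp add: ext_add algebra_simps)

end

section \<open>The Hecke algebra as a quotient\<close>

definition FA :: "nat \<Rightarrow> (fword \<Rightarrow>\<^sub>0 'k::field) set" where
  "FA n = {x. \<forall>w\<in>Poly_Mapping.keys x. set (letters w) \<subseteq> {..<n}}"

lemma free_alg_simps [simp]:
  "carrier (free_alg n) = FA n" "x \<otimes>\<^bsub>free_alg n\<^esub> y = x * y" "x \<oplus>\<^bsub>free_alg n\<^esub> y = x + y"
  "\<one>\<^bsub>free_alg n\<^esub> = 1" "\<zero>\<^bsub>free_alg n\<^esub> = 0"
  by (simp_all add: free_alg_def FA_def)

lemma FA_single: "set (letters w) \<subseteq> {..<n} \<Longrightarrow> Poly_Mapping.single w c \<in> FA n"
  by (auto simp: FA_def split: if_splits)

lemma FA_zero [simp, intro]: "0 \<in> FA n"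
  by (simp add: FA_def)

lemma FA_add [simp, intro]: "x \<in> FA n \<Longrightarrow> y \<in> FA n \<Longrightarrow> x + y \<in> FA n"
  unfolding FA_def using keys_add[of x y] by blast

lemma FA_mono [simp]: "set is \<subseteq> {..<n} \<Longrightarrow> fmono is \<in> FA n"
  by (simp add: fmono_def FA_single)

lemma FA_scal [simp, intro]: "free_scal c \<in> FA n"
  unfolding free_scal_def by (rule FA_single) (simp add: zero_fword_def)

lemma FA_one [simp, intro]: "1 \<in> FA n"
  using FA_scal[of 1] by (simp del: FA_scal)

lemma FA_gen [simp]: "i < n \<Longrightarrow> free_gen i \<in> FA n"
  by (simp add: free_gen_mono)

lemma FA_mult [simp, intro]: "x \<in> FA n \<Longrightarrow> y \<in> FA n \<Longrightarrow> x * y \<in> FA n"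
  unfolding FA_def
proof (clarify)
  fix w i
  assume *: "\<forall>w\<in>Poly_Mapping.keys x. set (letters w) \<subseteq> {..<n}" "\<forall>w\<in>Poly_Mapping.keys y. set (letters w) \<subseteq> {..<n}"
    "w \<in> Poly_Mapping.keys (x * y)" "i \<in> set (letters w)"
  then obtain a b where "a \<in> Poly_Mapping.keys x" "b \<in> Poly_Mapping.keys y" "w = a + b"
    using keys_mult[of x y] by blast
  then show "i < n" using * by (auto simp: plus_fword_def)
qed

lemma FA_uminus [simp, intro]: "x \<in> FA n \<Longrightarrow> - x \<in> FA n"
  by (simp add: FA_def keys_minus in_keys_iff)

lemma FA_diff [simp, intro]: "x \<in> FA n \<Longrightarrow> y \<in> FA n \<Longrightarrow> x - y \<in> FA n"
  using FA_add[of x n "- y"] by simp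

lemma FA_sum [intro]: "(\<And>i. i \<in> I \<Longrightarrow> x i \<in> FA n) \<Longrightarrow> (\<Sum>i\<in>I. x i) \<in> FA n"
  by (induction I rule: infinite_finite_induct) auto

lemma FA_wprod [intro]: "(\<And>i. i \<in> set is \<Longrightarrow> f i \<in> FA n) \<Longrightarrow> wprod f is \<in> FA n"
  by (induction "is") auto

lemma FA_le: "m \<le> n \<Longrightarrow> FA m \<subseteq> FA n"
  by (force simp: FA_def subset_iff)

lemma FA_sum_single:
  "x = (\<Sum>w\<in>Poly_Mapping.keys x. free_scal (Poly_Mapping.lookup x w) * fmono (letters w))"
  unfolding single_word[symmetric]
  by (rule poly_mapping_eqI)
    (simp add: lookup_sum lookup_single when_def sum.delta in_keys_iff if_distrib cong: if_cong)

lemma FA_induct [consumes 1, case_names mono add]: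
  assumes "x \<in> FA n"
    and "\<And>c is. set is \<subseteq> {..<n} \<Longrightarrow> P (free_scal c * fmono is)"
    and "\<And>x y. x \<in> FA n \<Longrightarrow> y \<in> FA n \<Longrightarrow> P x \<Longrightarrow> P y \<Longrightarrow> P (x + y)"
  shows "P x"
proof -
  have "(\<forall>w\<in>S. set (letters w) \<subseteq> {..<n}) \<Longrightarrow>
      (\<Sum>w\<in>S. free_scal (Poly_Mapping.lookup x w) * fmono (letters w)) \<in> FA n \<and>
      P (\<Sum>w\<in>S. free_scal (Poly_Mapping.lookup x w) * fmono (letters w))" if "finite S" for S
    using that
  proof (induction S)
    case empty
    then show ?case using assms(2)[of "[]" 0] by simp
  next
    case (insert w S)
    then show ?case by (auto intro!: assms(2,3) FA_mult FA_add)
  qed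
  from this[of "Poly_Mapping.keys x"] show ?thesis
    using assms(1) FA_sum_single[of x] by (simp add: FA_def)
qed

lemma ring_free_alg: "ring (free_alg n :: (fword \<Rightarrow>\<^sub>0 'k::field) ring)"
proof (rule ringI)
  show "abelian_group (free_alg n :: (fword \<Rightarrow>\<^sub>0 'k::field) ring)"
  proof (rule abelian_groupI)
    show "\<exists>y\<in>carrier (free_alg n). y \<oplus>\<^bsub>free_alg n\<^esub> x = \<zero>\<^bsub>free_alg n\<^esub>"
      if "x \<in> carrier (free_alg n)" for x :: "fword \<Rightarrow>\<^sub>0 'k"
      using that by (intro bexI[of _ "- x"]) auto
  qed (auto simp: algebra_simps)
  show "Group.monoid (free_alg n :: (fword \<Rightarrow>\<^sub>0 'k::field) ring)"
    by (rule monoidI) (auto simp: algebra_simps)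
qed (auto simp: algebra_simps)

lemma free_alg_minus: "x \<in> FA n \<Longrightarrow> \<ominus>\<^bsub>free_alg n\<^esub> x = - x"
  using abelian_group.minus_equality[OF ring.is_abelian_group[OF ring_free_alg[of n]], of "- x" x]
  by simp

section \<open>The defining ideal and computation with classes\<close>

locale hecke =
  fixes q q0 :: "'k::field"
  assumes q_nz: "q \<noteq> 0" and q0_nz: "q0 \<noteq> 0"
begin

definition al :: "nat \<Rightarrow> 'k" where
  "al i = (if i = 0 then q0 - inverse q0 else q - inverse q)"

abbreviation J :: "nat \<Rightarrow> (fword \<Rightarrow>\<^sub>0 'k) set" where "J n \<equiv> hecke_ideal q q0 n"
abbreviation cls :: "nat \<Rightarrow> (fword \<Rightarrow>\<^sub>0 'k) \<Rightarrow> (fword \<Rightarrow>\<^sub>0 'k) set" where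
  "cls n \<equiv> hecke_class q q0 n"
abbreviation H :: "nat \<Rightarrow> ('k, (fword \<Rightarrow>\<^sub>0 'k) set) module" where "H n \<equiv> hecke_alg q q0 n"

lemma quad_relator:
  "(free_gen 0 - free_scal q0) * (free_gen 0 + free_scal (inverse q0))
     = free_gen 0 * free_gen 0 - 1 - free_scal (al 0) * free_gen 0"
  "i \<ge> 1 \<Longrightarrow> (free_gen i - free_scal q) * (free_gen i + free_scal (inverse q))
     = free_gen i * free_gen i - 1 - free_scal (al i) * free_gen i"
  using q_nz q0_nz
  by (simp_all add: algebra_simps al_def free_scal_diff free_scal_comm[of "free_gen _"]
      flip: free_scal_mult)

lemma relators_FA: "hecke_relators q q0 n \<subseteq> FA n"
  by (auto simp: hecke_relators_def Let_def)

lemma ideal_J: "ideal (J n) (free_alg n)"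
  unfolding hecke_ideal_def
  using ring.genideal_ideal[OF ring_free_alg] relators_FA by auto

lemma J_FA: "x \<in> J n \<Longrightarrow> x \<in> FA n"
  using ideal.Icarr[OF ideal_J] by simp

lemma J_zero [simp]: "0 \<in> J n"
  using additive_subgroup.zero_closed[OF ideal.axioms(1)[OF ideal_J[of n]]] by simp
lemma J_add: "x \<in> J n \<Longrightarrow> y \<in> J n \<Longrightarrow> x + y \<in> J n"
  using additive_subgroup.a_closed[OF ideal.axioms(1)[OF ideal_J[of n]]] by simp
lemma J_uminus: "x \<in> J n \<Longrightarrow> - x \<in> J n"
  using additive_subgroup.a_inv_closed[OF ideal.axioms(1)[OF ideal_J[of n]], of x]
    free_alg_minus[OF J_FA] by simp
lemma J_lmult: "x \<in> J n \<Longrightarrow> a \<in> FA n \<Longrightarrow> a * x \<in> J n"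
  using ideal.I_l_closed[OF ideal_J[of n]] by simp
lemma J_rmult: "x \<in> J n \<Longrightarrow> a \<in> FA n \<Longrightarrow> x * a \<in> J n"
  using ideal.I_r_closed[OF ideal_J[of n]] by simp
lemma J_relator: "x \<in> hecke_relators q q0 n \<Longrightarrow> x \<in> J n"
  unfolding hecke_ideal_def
  using ring.genideal_self[OF ring_free_alg[of n], of "hecke_relators q q0 n"] relators_FA by auto

lemma J_sum: "(\<And>i. i \<in> I \<Longrightarrow> x i \<in> J n) \<Longrightarrow> (\<Sum>i\<in>I. x i) \<in> J n"
  by (induction I rule: infinite_finite_induct) (auto intro: J_add)

lemma J_quad: "i < n \<Longrightarrow> free_gen i * free_gen i - 1 - free_scal (al i) * free_gen i \<in> J n"
proof -
  assume i: "i < n"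
  have "free_gen i * free_gen i - 1 - free_scal (al i) * free_gen i \<in> hecke_relators q q0 n"
  proof (cases "i = 0")
    case True
    then show ?thesis using i by (simp add: hecke_relators_def Let_def quad_relator(1))
  next
    case False
    then have "1 \<le> i" by simp
    then show ?thesis unfolding quad_relator(2)[OF \<open>1 \<le> i\<close>, symmetric] hecke_relators_def Let_def
      using i by blast
  qed
  then show ?thesis by (rule J_relator)
qed

lemma J_far: "i < n \<Longrightarrow> j < n \<Longrightarrow> i + 2 \<le> j \<or> j + 2 \<le> i \<Longrightarrow>
    free_gen i * free_gen j - free_gen j * free_gen i \<in> J n"
  by (intro J_relator) (unfold hecke_relators_def Let_def, blast)

lemma J_braid: "1 \<le> i \<Longrightarrow> i + 1 < n \<Longrightarrow>
    free_gen i * free_gen (i + 1) * free_gen i - free_gen (i + 1) * free_gen i * free_gen (i + 1) \<in> J n"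
  by (intro J_relator) (unfold hecke_relators_def Let_def, blast)

lemma J_braid0: "1 < n \<Longrightarrow>
    free_gen 0 * free_gen 1 * free_gen 0 * free_gen 1
      - free_gen 1 * free_gen 0 * free_gen 1 * free_gen 0 \<in> J n"
  by (intro J_relator) (simp add: hecke_relators_def Let_def)

text \<open>The elements of \<open>J n\<close> that satisfy \<open>P\<close> form an ideal
  containing the relators, and \<open>J n\<close> is the smallest such ideal. This turns every map
  that respects the relators into a map on the quotient.\<close>

lemma J_induct [consumes 1, case_names zero add uminus lmult rmult quad far braid braid0]:
  assumes "x \<in> J n" and "P 0"
    and "\<And>x y. x \<in> J n \<Longrightarrow> y \<in> J n \<Longrightarrow> P x \<Longrightarrow> P y \<Longrightarrow> P (x + y)"
    and "\<And>x. x \<in> J n \<Longrightarrow> P x \<Longrightarrow> P (- x)"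
    and "\<And>x a. x \<in> J n \<Longrightarrow> a \<in> FA n \<Longrightarrow> P x \<Longrightarrow> P (a * x)"
    and "\<And>x a. x \<in> J n \<Longrightarrow> a \<in> FA n \<Longrightarrow> P x \<Longrightarrow> P (x * a)"
    and quad: "\<And>i. i < n \<Longrightarrow> P (free_gen i * free_gen i - 1 - free_scal (al i) * free_gen i)"
    and far: "\<And>i j. i < n \<Longrightarrow> j < n \<Longrightarrow> i + 2 \<le> j \<or> j + 2 \<le> i \<Longrightarrow>
      P (free_gen i * free_gen j - free_gen j * free_gen i)"
    and braid: "\<And>i. 1 \<le> i \<Longrightarrow> i + 1 < n \<Longrightarrow>
      P (free_gen i * free_gen (i + 1) * free_gen i - free_gen (i + 1) * free_gen i * free_gen (i + 1))"
    and braid0: "1 < n \<Longrightarrow> P (free_gen 0 * free_gen 1 * free_gen 0 * free_gen 1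
      - free_gen 1 * free_gen 0 * free_gen 1 * free_gen 0)"
  shows "P x"
proof -
  define K where "K = {x \<in> J n. P x}"
  have grp: "group (add_monoid (free_alg n :: (fword \<Rightarrow>\<^sub>0 'k) ring))"
    using abelian_group.a_group[OF ring.is_abelian_group[OF ring_free_alg]] by simp
  have inv: "inv\<^bsub>add_monoid (free_alg n)\<^esub> a = - a" if "a \<in> FA n" for a :: "fword \<Rightarrow>\<^sub>0 'k"
    using free_alg_minus[OF that] by (simp add: a_inv_def)
  have "subgroup K (add_monoid (free_alg n))"
  proof (rule group.subgroupI[OF grp])
    have "0 \<in> K" using assms(2) by (simp add: K_def)
    then show "K \<noteq> {}" by blast
  qed (use assms inv J_FA in \<open>auto simp: K_def J_add J_uminus\<close>)
  then have "additive_subgroup K (free_alg n)" by (rule additive_subgroup.intro)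
  then have "ideal K (free_alg n)"
    by (intro ideal.intro ring_free_alg ideal_axioms.intro)
      (use assms in \<open>auto simp: K_def J_lmult J_rmult\<close>)
  moreover have "hecke_relators q q0 n \<subseteq> K"
  proof
    fix x assume x: "x \<in> hecke_relators q q0 n"
    have "P x"
      using x quad_relator quad far braid braid0 unfolding hecke_relators_def Let_def
      by (auto split: if_splits)
    then show "x \<in> K" using x J_relator by (auto simp: K_def)
  qed
  ultimately have "J n \<subseteq> K"
    unfolding hecke_ideal_def by (rule ring.genideal_minimal[OF ring_free_alg])
  then show ?thesis using assms(1) by (auto simp: K_def)
qed

lemma J_le:
  assumes "m \<le> n" "x \<in> J m"
  shows "x \<in> J n"
  using assms(2)
proof (induction rule: J_induct)
  case (quad i)
  then show ?case using assms(1) by (intro J_quad) simp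
next
  case (far i j)
  then show ?case using assms(1) by (intro J_far) simp_all
next
  case (braid i)
  then show ?case using assms(1) by (intro J_braid) simp_all
next
  case braid0
  then show ?case using assms(1) by (intro J_braid0) simp
qed (use FA_le[OF assms(1)] in \<open>auto intro: J_add J_uminus J_lmult J_rmult\<close>)

lemma cls_eq_iff: "x \<in> FA n \<Longrightarrow> y \<in> FA n \<Longrightarrow> cls n x = cls n y \<longleftrightarrow> x - y \<in> J n"
proof -
  assume xy: "x \<in> FA n" "y \<in> FA n"
  interpret ideal "J n" "free_alg n" by (rule ideal_J)
  have m: "x \<ominus>\<^bsub>free_alg n\<^esub> y = x - y" using xy by (simp add: a_minus_def free_alg_minus)
  show "cls n x = cls n y \<longleftrightarrow> x - y \<in> J n"
    unfolding hecke_class_def using quotient_eq_iff_same_a_r_cos[OF ideal_J, of x y] xy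
    by (simp add: m)
qed

lemma mem_cls: "x \<in> FA n \<Longrightarrow> y \<in> cls n x \<longleftrightarrow> y \<in> FA n \<and> y - x \<in> J n"
proof -
  assume x: "x \<in> FA n"
  have "y \<in> cls n x \<longleftrightarrow> (\<exists>h\<in>J n. y = h + x)"
    by (simp add: hecke_class_def a_r_coset_def')
  also have "\<dots> \<longleftrightarrow> y \<in> FA n \<and> y - x \<in> J n"
    using x J_FA by (metis FA_add add_diff_cancel diff_add_cancel)
  finally show ?thesis .
qed

lemma carrier_H: "carrier (H n) = cls n ` FA n"
  by (auto simp: hecke_alg_def Let_def ring.defs FactRing_def A_RCOSETS_def' hecke_class_def)

lemma carrier_H_I [simp]: "x \<in> FA n \<Longrightarrow> cls n x \<in> carrier (H n)"
  by (simp add: carrier_H)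

lemma one_H: "\<one>\<^bsub>H n\<^esub> = cls n 1"
  by (simp add: hecke_alg_def Let_def ring.defs FactRing_def hecke_class_def)

lemma zero_H: "\<zero>\<^bsub>H n\<^esub> = cls n 0"
proof -
  have "cls n 0 = J n"
    using mem_cls[of 0 n] J_FA by auto
  then show ?thesis by (simp add: hecke_alg_def Let_def ring.defs FactRing_def)
qed

lemma mult_H: "x \<in> FA n \<Longrightarrow> y \<in> FA n \<Longrightarrow> cls n x \<otimes>\<^bsub>H n\<^esub> cls n y = cls n (x * y)"
  using ideal.rcoset_mult_add[OF ideal_J[of n], of x y]
  by (simp add: hecke_alg_def Let_def ring.defs FactRing_def hecke_class_def)

lemma add_H: "x \<in> FA n \<Longrightarrow> y \<in> FA n \<Longrightarrow> cls n x \<oplus>\<^bsub>H n\<^esub> cls n y = cls n (x + y)"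
  using abelian_subgroup.a_rcos_sum[OF abelian_subgroupI3[OF ideal.axioms(1)[OF ideal_J[of n]]
        ring.is_abelian_group[OF ring_free_alg]], of x y]
  by (simp add: hecke_alg_def Let_def ring.defs FactRing_def hecke_class_def)

lemma smult_H: "x \<in> FA n \<Longrightarrow> c \<odot>\<^bsub>H n\<^esub> cls n x = cls n (free_scal c * x)"
  using ideal.rcoset_mult_add[OF ideal_J[of n], of "free_scal c" x]
  by (simp add: hecke_alg_def Let_def ring.defs module.defs FactRing_def hecke_class_def)

lemma ring_H: "ring (H n)"
proof (rule ringI)
  show "abelian_group (H n)"
  proof (rule abelian_groupI)
    show "\<exists>y\<in>carrier (H n). y \<oplus>\<^bsub>H n\<^esub> x = \<zero>\<^bsub>H n\<^esub>" if x: "x \<in> carrier (H n)" for x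
    proof -
      obtain x' where "x' \<in> FA n" "x = cls n x'" using x by (auto simp: carrier_H)
      then show ?thesis
        by (intro bexI[of _ "cls n (- x')"]) (auto simp: add_H zero_H)
    qed
  qed (auto simp: carrier_H add_H zero_H algebra_simps)
  show "Group.monoid (H n)"
    by (rule monoidI) (auto simp: carrier_H mult_H one_H algebra_simps)
qed (auto simp: carrier_H mult_H add_H algebra_simps)

lemma pow2_H: "x \<in> FA n \<Longrightarrow> cls n x [^]\<^bsub>H n\<^esub> (2::nat) = cls n (x * x)"
proof -
  assume x: "x \<in> FA n"
  interpret ring "H n" by (rule ring_H)
  have "cls n x [^]\<^bsub>H n\<^esub> (2::nat) = cls n x \<otimes>\<^bsub>H n\<^esub> cls n x"
    using x by (simp add: numeral_2_eq_2)
  then show ?thesis using x by (simp add: mult_H)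
qed

lemma finsum_H:
  "finite I \<Longrightarrow> (\<And>i. i \<in> I \<Longrightarrow> x i \<in> FA n) \<Longrightarrow>
    (\<Oplus>\<^bsub>H n\<^esub>i\<in>I. cls n (x i)) = cls n (\<Sum>i\<in>I. x i)"
proof (induction I rule: finite_induct)
  case empty
  interpret ring "H n" by (rule ring_H)
  show ?case by (simp add: zero_H)
next
  case (insert i I)
  interpret ring "H n" by (rule ring_H)
  have "(\<Oplus>\<^bsub>H n\<^esub>i\<in>insert i I. cls n (x i)) = cls n (x i) \<oplus>\<^bsub>H n\<^esub> (\<Oplus>\<^bsub>H n\<^esub>i\<in>I. cls n (x i))"
    using insert by (intro finsum_insert) auto
  then show ?case using insert by (simp add: add_H FA_sum)
qed

lemma prod_list_H:
  "(\<And>i. i \<in> set is \<Longrightarrow> x i \<in> FA n) \<Longrightarrow>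
    ring_prod_list (H n) (map (\<lambda>i. cls n (x i)) is) = cls n (wprod x is)"
  by (induction "is") (auto simp: ring_prod_list_def one_H mult_H FA_wprod)

lemma hecke_word_cls: "set is \<subseteq> {..<n} \<Longrightarrow> hecke_word q q0 n is = cls n (fmono is)"
  unfolding hecke_word_def hecke_gen_def
  using prod_list_H[of "is" free_gen n] by (auto simp: wprod_free_gen subset_iff)

lemma inv_H:
  assumes "x \<in> FA n" "y \<in> FA n" "x * y - 1 \<in> J n" "y * x - 1 \<in> J n"
  shows "inv\<^bsub>H n\<^esub> (cls n x) = cls n y"
proof -
  interpret ring "H n" by (rule ring_H)
  have "cls n x \<otimes>\<^bsub>H n\<^esub> cls n y = \<one>\<^bsub>H n\<^esub>" "cls n y \<otimes>\<^bsub>H n\<^esub> cls n x = \<one>\<^bsub>H n\<^esub>"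
    using assms by (simp_all add: mult_H one_H cls_eq_iff)
  then show ?thesis
    using assms inv_unique'[of "cls n x" "cls n y"] by simp
qed

text \<open>\<open>the_elem\<close> is meaningful because all representatives of a class have the
  same image, \<open>J m\<close> being contained in \<open>J n\<close>.\<close>

lemma embed_cls:
  assumes "m \<le> n" "x \<in> FA m"
  shows "hecke_embed q q0 n (cls m x) = cls n x"
proof -
  have "cls n ` cls m x = {cls n x}"
  proof -
    have *: "cls n y = cls n x" if "y \<in> cls m x" for y
    proof -
      have "y \<in> FA m" "y - x \<in> J m" using that assms(2) by (simp_all add: mem_cls)
      then have "y \<in> FA n" "x \<in> FA n" "y - x \<in> J n"
        using subsetD[OF FA_le[OF assms(1)]] J_le[OF assms(1)] assms(2) by simp_all
      then show ?thesis by (simp add: cls_eq_iff)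
    qed
    have "x \<in> cls m x" using assms by (simp add: mem_cls)
    then have "(\<lambda>_. cls n x) ` cls m x = {cls n x}" by (rule image_constant)
    moreover have "cls n ` cls m x = (\<lambda>_. cls n x) ` cls m x"
      by (rule image_cong[OF refl *])
    ultimately show ?thesis by metis
  qed
  then show ?thesis by (simp add: hecke_embed_def)
qed

text \<open>Modulo the ideal, \<open>ui i\<close> is the inverse of the generator.\<close>

definition ui :: "nat \<Rightarrow> fword \<Rightarrow>\<^sub>0 'k" where
  "ui i = free_gen i - free_scal (al i)"

lemma ui_FA [simp]: "i < n \<Longrightarrow> ui i \<in> FA n"
  by (auto simp: ui_def)

lemma ui_inv:
  assumes "i < n"
  shows "ui i * free_gen i - 1 \<in> J n" "free_gen i * ui i - 1 \<in> J n"
  using J_quad[OF assms]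
  by (simp_all add: ui_def algebra_simps free_scal_comm[of "free_gen _"])

lemma wprod_ui_inv:
  "set is \<subseteq> {..<n} \<Longrightarrow> wprod ui (rev is) * fmono is - 1 \<in> J n \<and> fmono is * wprod ui (rev is) - 1 \<in> J n"
proof (induction "is")
  case Nil
  then show ?case by simp
next
  case (Cons i "is")
  let ?u = "wprod ui (rev is)" and ?m = "fmono is"
  have FA: "?u \<in> FA n" "?m \<in> FA n" "ui i \<in> FA n" "free_gen i \<in> FA n"
    using Cons.prems by (auto intro!: FA_wprod)
  have "wprod ui (rev (i # is)) * fmono (i # is) - 1 = ?u * (ui i * free_gen i - 1) * ?m + (?u * ?m - 1)"
    by (simp add: mono_Cons algebra_simps)
  moreover have "fmono (i # is) * wprod ui (rev (i # is)) - 1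
      = free_gen i * (?m * ?u - 1) * ui i + (free_gen i * ui i - 1)"
    by (simp add: mono_Cons algebra_simps)
  moreover have "?u * (ui i * free_gen i - 1) * ?m + (?u * ?m - 1) \<in> J n"
    using Cons.IH Cons.prems by (intro J_add[OF J_rmult[OF J_lmult]] FA ui_inv) simp_all
  moreover have "free_gen i * (?m * ?u - 1) * ui i + (free_gen i * ui i - 1) \<in> J n"
    using Cons.IH Cons.prems by (intro J_add[OF J_rmult[OF J_lmult]] FA ui_inv) simp_all
  ultimately show ?case by (simp only:)
qed

lemma inv_cls_mono: "set is \<subseteq> {..<n} \<Longrightarrow> inv\<^bsub>H n\<^esub> (cls n (fmono is)) = cls n (wprod ui (rev is))"
  using wprod_ui_inv[of "is" n] by (intro inv_H) (auto intro!: FA_wprod)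

lemma inv_gen: "i < n \<Longrightarrow> inv\<^bsub>H n\<^esub> (hecke_gen q q0 n i) = cls n (ui i)"
  using inv_cls_mono[of "[i]" n] by (simp add: hecke_gen_def free_gen_mono)

end

section \<open>Faithfulness of the regular representations\<close>

text \<open>The minimal representatives of the left cosets of the subgroup of rank
  \<open>n - 1\<close>, labelled by the image \<open>m\<close> of \<open>n\<close>. For
  \<open>m > 0\<close> the letters bring \<open>n\<close> down to \<open>m\<close>; for
  \<open>m < 0\<close> they bring it down to \<open>1\<close>, change the sign and continue to
  \<open>m\<close>.\<close>

definition coset_word :: "nat \<Rightarrow> int \<Rightarrow> nat list" where
  "coset_word n m = (if 0 < m then [nat m..<n] else rev [1..<nat (- m)] @ [0..<n])"

definition idx :: "nat \<Rightarrow> int set" where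
  "idx n = {m. m \<noteq> 0 \<and> \<bar>m\<bar> \<le> int n}"

lemma finite_idx [simp]: "finite (idx n)"
proof -
  have "idx n \<subseteq> {- int n..int n}" by (auto simp: idx_def)
  then show ?thesis by (rule finite_subset) simp
qed

lemma idx_refl_B: "m \<in> idx n \<Longrightarrow> i < n \<Longrightarrow> refl_B i m \<in> idx n"
proof -
  assume m: "m \<in> idx n" "i < n"
  have "refl_B i m \<noteq> 0"
  proof
    assume "refl_B i m = 0"
    then have "refl_B i (refl_B i m) = refl_B i 0" by simp
    then show False using m refl_B_minus[of i 0] by (simp add: idx_def)
  qed
  then show ?thesis using m refl_B_abs(1)[of i n m] by (simp add: idx_def)
qed

lemma set_coset_word: "m \<in> idx n \<Longrightarrow> set (coset_word n m) \<subseteq> {..<n}"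
  by (auto simp: coset_word_def idx_def)

text \<open>If the reflection \<open>i\<close> fixes the label, the coset is unchanged, and braid
  moves push the letter through the coset word, where it comes out as a generator of rank
  \<open>n - 1\<close>.\<close>

lemma coset_word_fixed:
  assumes m: "m \<in> idx n" and "i < n" "refl_B i m = m"
  obtains j where "j < n - 1" "beq (i # coset_word n m) (coset_word n m @ [j])"
proof -
  have ne: "m \<noteq> lo i" "m \<noteq> hi i" "m \<noteq> - lo i" "m \<noteq> - hi i"
    using assms(3) by (auto simp: refl_B_fixed)
  show thesis
  proof (cases "0 < m")
    case True
    define k where "k = nat m"
    have k: "m = int k" "1 \<le> k" "k \<le> n" using True m by (auto simp: k_def idx_def)
    have w: "coset_word n m = [k..<n]" using True by (simp add: coset_word_def k_def)
    have "k \<noteq> i" "k \<noteq> i + 1" using ne k by (auto simp: lo_def hi_def split: if_splits)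
    then consider "i + 2 \<le> k" | "k < i" by linarith
    then show thesis
    proof cases
      case 1
      have "beq (i # [k..<n]) ([k..<n] @ [i])" by (rule beq_far_word) (use 1 in auto)
      then show ?thesis using that[of i] 1 k w by auto
    next
      case 2
      then show ?thesis using that[of "i - 1"] beq_up[of k i n] k w assms(2) by auto
    qed
  next
    case False
    define k where "k = nat (- m)"
    have k: "m = - int k" "1 \<le> k" "k \<le> n" using False m by (auto simp: k_def idx_def)
    have w: "coset_word n m = rev [1..<k] @ [0..<n]" using False by (simp add: coset_word_def k_def)
    have "k \<noteq> i" "k \<noteq> i + 1" using ne k by (auto simp: lo_def hi_def split: if_splits)
    then consider "1 \<le> i" "i + 1 < k" | "i = 0" "2 \<le> k" | "k < i" using k(2) by linarith
    then show thesis
    proof cases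
      case 1
      then show ?thesis using that[of i] beq_neg_low[of i k n] k w by auto
    next
      case 2
      then show ?thesis using that[of 0] beq_neg_zero[of k n] k w by auto
    next
      case 3
      then show ?thesis using that[of "i - 1"] beq_neg_high[of k i n] k w assms(2) by auto
    qed
  qed
qed

lemma coset_word_up:
  assumes "m \<in> idx n" "i < n" "m = hi i \<or> m = - lo i"
  shows "coset_word n (refl_B i m) = i # coset_word n m"
proof (cases "i = 0")
  case True
  then have "m = 1" "refl_B i m = - 1" using assms(3) by (auto simp: lo_def hi_def refl_B_eq)
  then show ?thesis using True assms(2) by (simp add: coset_word_def upt_conv_Cons)
next
  case i: False
  show ?thesis
  proof (cases "m = hi i")
    case True
    then have "refl_B i m = lo i" by simp
    then have "m = int (i + 1)" "refl_B i m = int i" using i True by (auto simp: lo_def hi_def)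
    then have "coset_word n m = [i + 1..<n]" "coset_word n (refl_B i m) = [i..<n]"
      using i by (simp_all only: coset_word_def nat_int) simp_all
    then show ?thesis using assms(2) by (simp add: upt_conv_Cons)
  next
    case False
    then have "m = - lo i" "refl_B i m = - hi i" using assms(3) by auto
    then have m: "m = - int i" "refl_B i m = - int (i + 1)" using i by (auto simp: lo_def hi_def)
    have "coset_word n m = rev [1..<i] @ [0..<n]"
      unfolding m(1) using i by (simp add: coset_word_def)
    moreover have "coset_word n (refl_B i m) = rev [1..<i + 1] @ [0..<n]"
      unfolding m(2) coset_word_def by (simp only: minus_minus nat_int) simp
    ultimately show ?thesis using i by simp
  qed
qed

lemma coset_word_move:
  assumes "m \<in> idx n" "i < n" "refl_B i m \<noteq> m"
  shows "coset_word n (refl_B i m) = i # coset_word n m \<or> coset_word n m = i # coset_word n (refl_B i m)"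
proof -
  consider "m = hi i \<or> m = - lo i" | "m = lo i \<or> m = - hi i" using assms(3) by (auto simp: refl_B_fixed)
  then show ?thesis
  proof cases
    case 1
    then show ?thesis using coset_word_up assms by blast
  next
    case 2
    then have "refl_B i m = hi i \<or> refl_B i m = - lo i" by auto
    then show ?thesis
      using coset_word_up[of "refl_B i m" n i] idx_refl_B assms by simp
  qed
qed

definition supp :: "(sperm \<Rightarrow> 'k::field) \<Rightarrow> sperm set" where
  "supp v = {w. v w \<noteq> 0}"

lemma supp_opU_WS: "supp v \<subseteq> WS n \<Longrightarrow> i < n \<Longrightarrow> supp (app (opU g g0 i) v) \<subseteq> WS n"
proof
  fix w assume *: "supp v \<subseteq> WS n" "i < n" "w \<in> supp (app (opU g g0 i) v)"
  then have "v (rmul w i) \<noteq> 0 \<or> v w \<noteq> 0" by (auto simp: supp_def app_opU split: if_splits)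
  then have "rmul w i \<in> WS n \<or> w \<in> WS n" using *(1) by (auto simp: supp_def)
  then show "w \<in> WS n" using *(2) by simp
qed

text \<open>\<open>n\<close> is the largest value in rank \<open>n\<close>, so
  \<open>sp w (hi i) = n\<close> as well as \<open>sp w (lo i) = - n\<close> excludes a descent at
  \<open>i\<close>. Hence the correction term of \<open>opU\<close> vanishes and only the
  translation remains.\<close>

lemma supp_opU_up:
  assumes v: "supp v \<subseteq> {w \<in> WS n. sp w m = int n}" and "i < n" "m = hi i \<or> m = - lo i"
  shows "supp (app (opU g g0 i) v) \<subseteq> {w \<in> WS n. sp w (refl_B i m) = int n}"
proof
  fix w assume w: "w \<in> supp (app (opU g g0 i) v)"
  have "\<not> (desc i w \<and> v w \<noteq> 0)"
  proof
    assume d: "desc i w \<and> v w \<noteq> 0"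
    then have "w \<in> WS n" "sp w m = int n" using v by (auto simp: supp_def)
    moreover have "\<bar>sp w (lo i)\<bar> \<le> int n" "\<bar>sp w (hi i)\<bar> \<le> int n"
      using WS_abs[OF \<open>w \<in> WS n\<close>] \<open>i < n\<close> by (auto simp: lo_def hi_def)
    ultimately show False using assms(3) d by (auto simp: desc_def)
  qed
  then have "v (rmul w i) \<noteq> 0" using w by (auto simp: supp_def app_opU split: if_splits)
  then have "rmul w i \<in> WS n" "sp (rmul w i) m = int n" using v by (auto simp: supp_def)
  then show "w \<in> {w \<in> WS n. sp w (refl_B i m) = int n}" using \<open>i < n\<close> by simp
qed

lemma supp_coset_word:
  assumes v: "supp v \<subseteq> {w \<in> WS n. sp w (int n) = int n}" and m: "m \<in> idx n"
  shows "supp (app (wprod (opU g g0) (coset_word n m)) v) \<subseteq> {w \<in> WS n. sp w m = int n}"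
proof -
  have up: "supp (app (wprod (opU g g0) (coset_word n (refl_B i m'))) v) \<subseteq> {w \<in> WS n. sp w (refl_B i m') = int n}"
    if "supp (app (wprod (opU g g0) (coset_word n m')) v) \<subseteq> {w \<in> WS n. sp w m' = int n}"
      "i < n" "m' = hi i \<or> m' = - lo i" "m' \<in> idx n" for i m'
    using supp_opU_up[OF that(1-3)] coset_word_up[OF that(4,2,3)] by simp
  \<comment> \<open>The labels are reached in the order \<open>n, ..., 1, - 1, ..., - n\<close>,
    each from its predecessor by one generator. \<open>pos\<close> counts downwards from
    \<open>n\<close>, and the passage from \<open>1\<close> to \<open>- 1\<close> is the base case
    of \<open>neg\<close>.\<close>
  have pos: "k < n \<Longrightarrow> supp (app (wprod (opU g g0) (coset_word n (int (n - k)))) v)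
      \<subseteq> {w \<in> WS n. sp w (int (n - k)) = int n}" for k
  proof (induction k)
    case 0
    then show ?case using v by (simp add: coset_word_def)
  next
    case (Suc k)
    define i where "i = n - Suc k"
    have i: "1 \<le> i" "i < n" "n - k = i + 1" using Suc.prems by (auto simp: i_def)
    have h: "int (n - k) = hi i" and l: "lo i = int (n - Suc k)"
      using i by (auto simp: hi_def lo_def i_def)
    have "hi i \<in> idx n" using i by (auto simp: idx_def hi_def)
    then show ?case using up[of "hi i" i] Suc.IH Suc.prems i(2) unfolding refl_B_hi h l by simp
  qed
  have neg: "1 \<le> k \<Longrightarrow> k \<le> n \<Longrightarrow> supp (app (wprod (opU g g0) (coset_word n (- int k))) v)
      \<subseteq> {w \<in> WS n. sp w (- int k) = int n}" for k
  proof (induction k rule: dec_induct)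
    case base
    have "hi 0 \<in> idx n" "hi 0 = int (n - (n - 1))" "lo 0 = - int 1"
      using base by (auto simp: idx_def hi_def lo_def)
    then show ?case using pos[of "n - 1"] up[of "hi 0" 0] base unfolding refl_B_hi by simp
  next
    case (step k)
    have "lo k = int k" "hi k = int (Suc k)" using step.hyps by (auto simp: hi_def lo_def)
    moreover have "- lo k \<in> idx n" using calculation step by (auto simp: idx_def)
    ultimately show ?case using up[of "- lo k" k] step unfolding refl_B_minus refl_B_lo by simp
  qed
  show ?thesis
  proof (cases "0 < m")
    case True
    then show ?thesis using pos[of "n - nat m"] m by (simp add: idx_def of_nat_diff)
  next
    case False
    then have "1 \<le> nat (- m)" "nat (- m) \<le> n" "- int (nat (- m)) = m"
      using m by (auto simp: idx_def)
    then show ?thesis using neg[of "nat (- m)"] by simp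
  qed
qed

lemma wprod_opU_inj: "app (wprod (opU g g0) is) v = (\<lambda>w. 0) \<Longrightarrow> v = (\<lambda>w. 0)"
proof (induction "is")
  case Nil
  then show ?case by simp
next
  case (Cons i "is")
  let ?U = "opU g g0 i" and ?v = "app (wprod (opU g g0) is) v"
  have "(?U - scal (if i = 0 then g0 else g)) * ?U = 1"
    using opU_square[of g g0 i] by (simp add: algebra_simps)
  then have "?v = app (?U - scal (if i = 0 then g0 else g)) (app ?U ?v)"
    by (metis app_one app_times)
  also have "\<dots> = (\<lambda>w. 0)" using Cons.prems by (auto simp: app_zero_arg)
  finally show ?case by (rule Cons.IH)
qed

text \<open>Instantiated twice: with the generators \<open>t\<^sub>i\<close> (where
  \<open>cc\<close> is zero) and with their inverses (where \<open>cc\<close> is the negative of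
  \<open>al\<close>). The derived objects are parameters with defining equations, so that each
  instance keeps its own names.\<close>

locale hecke_rep = hecke q q0 for q q0 :: "'k::field" +
  fixes c0 c1 g0 g1 :: "'k::field"
  fixes gen :: "nat \<Rightarrow> fword \<Rightarrow>\<^sub>0 'k" and cc gg :: "nat \<Rightarrow> 'k" and rho :: "(fword \<Rightarrow>\<^sub>0 'k) \<Rightarrow> 'k lin_op"
    and U :: "nat \<Rightarrow> 'k lin_op"
  assumes cc_def: "cc = (\<lambda>i. if i = 0 then c0 else c1)"
    and gg_def: "gg = (\<lambda>i. if i = 0 then g0 else g1)"
    and gen_def: "gen = (\<lambda>i. free_gen i + free_scal (cc i))"
    and U_def: "U = opU g1 g0"
    and rho_def: "rho = lext scal (wprod (\<lambda>i. U i - scal (cc i)))"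
    and gen_sq: "\<And>i n. i < n \<Longrightarrow> gen i * gen i - 1 - free_scal (gg i) * gen i \<in> J n"
    and gen_far: "\<And>i j n. i < n \<Longrightarrow> j < n \<Longrightarrow> i + 2 \<le> j \<or> j + 2 \<le> i \<Longrightarrow>
      gen i * gen j - gen j * gen i \<in> J n"
    and gen_braid: "\<And>i n. 1 \<le> i \<Longrightarrow> i + 1 < n \<Longrightarrow>
      gen i * gen (i + 1) * gen i - gen (i + 1) * gen i * gen (i + 1) \<in> J n"
    and gen_braid0: "\<And>n. 1 < n \<Longrightarrow> gen 0 * gen 1 * gen 0 * gen 1 - gen 1 * gen 0 * gen 1 * gen 0 \<in> J n"
    and rho_J: "\<And>x n. x \<in> J n \<Longrightarrow> rho x = 0"
begin

sublocale rho: alg_ext scal "wprod (\<lambda>i. U i - scal (cc i))"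
  by unfold_locales (rule scal_add scal_one scal_mult scal_comm wprod_simps(1))+

lemma rho_add: "rho (x + y) = rho x + rho y" by (simp add: rho_def rho.ext_add)
lemma rho_diff: "rho (x - y) = rho x - rho y" by (simp add: rho_def rho.ext_diff)
lemma rho_mult: "rho (x * y) = rho x * rho y" by (simp add: rho_def rho.ext_mult)
lemma rho_scal: "rho (free_scal c) = scal c" by (simp add: rho_def rho.ext_scal)
lemma rho_one: "rho 1 = 1" by (simp add: rho_def)
lemma rho_free_gen: "rho (free_gen i) = U i - scal (cc i)" by (simp add: rho_def rho.ext_gen)
lemma rho_sum: "rho (\<Sum>i\<in>I. x i) = (\<Sum>i\<in>I. rho (x i))" by (simp add: rho_def rho.ext_sum)
lemma rho_gen: "rho (gen i) = U i" by (simp add: gen_def rho_add rho_free_gen rho_scal)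
lemma rho_wprod_gen: "rho (wprod gen is) = wprod U is"
  by (induction "is") (simp_all add: rho_one rho_mult rho_gen)

lemma gen_FA [simp]: "i < n \<Longrightarrow> gen i \<in> FA n"
  by (auto simp: gen_def)

lemma wprod_gen_FA [simp]: "set is \<subseteq> {..<n} \<Longrightarrow> wprod gen is \<in> FA n"
  by (auto intro!: FA_wprod)

lemma beq_J: "beq xs ys \<Longrightarrow> set xs \<subseteq> {..<n} \<Longrightarrow> wprod gen xs - wprod gen ys \<in> J n"
proof (induction rule: beq.induct)
  case (beq_sym xs ys)
  then have "wprod gen xs - wprod gen ys \<in> J n" using beq_set by metis
  then show ?case using J_uminus by fastforce
next
  case (beq_trans xs ys zs)
  then have "wprod gen xs - wprod gen ys \<in> J n" "wprod gen ys - wprod gen zs \<in> J n"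
    using beq_set by metis+
  then show ?case using J_add by fastforce
next
  case (beq_far i j p s)
  have "wprod gen p * (gen i * gen j - gen j * gen i) * wprod gen s \<in> J n"
    using beq_far by (intro J_rmult J_lmult gen_far) auto
  then show ?case by (simp add: algebra_simps)
next
  case (beq_braid i p s)
  have "wprod gen p * (gen i * gen (i + 1) * gen i - gen (i + 1) * gen i * gen (i + 1)) * wprod gen s \<in> J n"
    using beq_braid by (intro J_rmult J_lmult gen_braid) auto
  then show ?case by (simp add: algebra_simps)
next
  case (beq_braid0 p s)
  have "wprod gen p * (gen 0 * gen 1 * gen 0 * gen 1 - gen 1 * gen 0 * gen 1 * gen 0) * wprod gen s \<in> J n"
    using beq_braid0 by (intro J_rmult J_lmult gen_braid0) auto
  then show ?case by (simp add: algebra_simps)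
qed simp

text \<open>The span, modulo \<open>J n\<close>, of coset words times elements of rank
  \<open>n - 1\<close>. It is stable under left multiplication by the generators, and for
  \<open>n \<ge> 1\<close> it contains the empty coset word, so it is everything.\<close>

inductive_set CS :: "nat \<Rightarrow> (fword \<Rightarrow>\<^sub>0 'k) set" for n where
  CS_J: "x \<in> J n \<Longrightarrow> x \<in> CS n"
| CS_word: "m \<in> idx n \<Longrightarrow> h \<in> FA (n - 1) \<Longrightarrow> wprod gen (coset_word n m) * h \<in> CS n"
| CS_add: "x \<in> CS n \<Longrightarrow> y \<in> CS n \<Longrightarrow> x + y \<in> CS n"

lemma CS_scal: "x \<in> CS n \<Longrightarrow> free_scal c * x \<in> CS n"
proof (induction rule: CS.induct)
  case (CS_word m h)
  have "free_scal c * (wprod gen (coset_word n m) * h) = wprod gen (coset_word n m) * (free_scal c * h)"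
    by (metis free_scal_comm mult.assoc)
  then show ?case using CS_word CS.CS_word by simp
qed (auto simp: distrib_left intro: CS.intros J_lmult)

lemma CS_gen:
  assumes "x \<in> CS n" "i < n"
  shows "gen i * x \<in> CS n"
  using assms(1)
proof (induction rule: CS.induct)
  case (CS_J x)
  then show ?case using assms(2) by (intro CS.CS_J J_lmult) auto
next
  case (CS_add x y)
  then show ?case by (simp add: distrib_left CS.CS_add)
next
  case (CS_word m h)
  let ?w = "\<lambda>m. wprod gen (coset_word n m)"
  have h: "h \<in> FA n" using CS_word FA_le[of "n - 1" n] by auto
  have m': "refl_B i m \<in> idx n" using CS_word assms(2) idx_refl_B by blast
  show ?case
  proof (cases "refl_B i m = m")
    case True
    obtain j where j: "j < n - 1" "beq (i # coset_word n m) (coset_word n m @ [j])"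
      using coset_word_fixed[OF CS_word(1) assms(2) True] .
    have "gen i * ?w m - ?w m * gen j \<in> J n"
      using beq_J[OF j(2), of n] assms(2) set_coset_word[OF CS_word(1)] by simp
    then have "(gen i * ?w m - ?w m * gen j) * h + ?w m * (gen j * h) \<in> CS n"
      using h CS_word j by (intro CS.CS_add CS.CS_J J_rmult CS.CS_word) auto
    then show ?thesis by (simp add: algebra_simps)
  next
    case False
    then consider "coset_word n (refl_B i m) = i # coset_word n m"
      | "coset_word n m = i # coset_word n (refl_B i m)"
      using coset_word_move CS_word assms(2) by blast
    then show ?thesis
    proof cases
      case 1
      then have "gen i * (?w m * h) = ?w (refl_B i m) * h" by (simp add: mult.assoc)
      then show ?thesis using m' CS_word CS.CS_word by simp
    next
      \<comment> \<open>The coset word already begins with \<open>i\<close>; the quadratic relation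
        splits the product over the labels \<open>refl_B i m\<close> and \<open>m\<close>.\<close>
      case 2
      let ?v = "?w (refl_B i m)"
      have "gen i * (?w m * h) = (gen i * gen i - 1 - free_scal (gg i) * gen i) * (?v * h)
          + (?v * h + free_scal (gg i) * (?w m * h))"
        unfolding 2 by (simp add: algebra_simps)
      also have "\<dots> \<in> CS n"
        using h CS_word m' gen_sq[OF assms(2)] set_coset_word[OF m']
        by (intro CS.CS_add CS.CS_word CS_scal CS.CS_J J_rmult FA_mult) auto
      finally show ?thesis .
    qed
  qed
qed

lemma FA_CS:
  assumes "x \<in> FA n" "1 \<le> n"
  shows "x \<in> CS n"
  using assms(1)
proof (induction rule: FA_induct)
  case (mono c "is")
  have "fmono is \<in> CS n"
    using mono
  proof (induction "is")
    case Nil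
    have "wprod gen (coset_word n (int n)) * 1 \<in> CS n"
      by (rule CS.CS_word) (use assms(2) in \<open>auto simp: idx_def\<close>)
    moreover have "coset_word n (int n) = []" using assms(2) by (simp add: coset_word_def)
    ultimately show ?case by simp
  next
    case (Cons i "is")
    have "fmono (i # is) = gen i * fmono is + free_scal (- cc i) * fmono is"
      by (simp add: gen_def mono_Cons algebra_simps free_scal_minus)
    then show ?case using Cons by (auto intro!: CS.CS_add CS_gen CS_scal)
  qed
  then show ?case by (rule CS_scal)
qed (rule CS.CS_add)

lemma CS_sum:
  assumes "x \<in> CS n"
  shows "\<exists>h. (\<forall>m. h m \<in> FA (n - 1)) \<and> x - (\<Sum>m\<in>idx n. wprod gen (coset_word n m) * h m) \<in> J n"
  using assms
proof (induction rule: CS.induct)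
  case (CS_J x)
  then show ?case by (intro exI[of _ "\<lambda>_. 0"]) auto
next
  case (CS_word m h)
  have "(\<Sum>k\<in>idx n. wprod gen (coset_word n k) * (if k = m then h else 0)) = wprod gen (coset_word n m) * h"
    using CS_word by (subst sum.mono_neutral_right[of _ "{m}"]) auto
  then show ?case using CS_word by (intro exI[of _ "\<lambda>k. if k = m then h else 0"]) auto
next
  case (CS_add x y)
  then obtain h h' where *: "\<forall>m. h m \<in> FA (n - 1)" "\<forall>m. h' m \<in> FA (n - 1)"
    "x - (\<Sum>m\<in>idx n. wprod gen (coset_word n m) * h m) \<in> J n"
    "y - (\<Sum>m\<in>idx n. wprod gen (coset_word n m) * h' m) \<in> J n" by blast
  show ?case
    using J_add[OF *(3,4)] *(1,2)
    by (intro exI[of _ "\<lambda>m. h m + h' m"]) (auto simp: algebra_simps sum.distrib)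
qed

lemma supp_rho:
  assumes "x \<in> FA n"
  shows "supp (app (rho x) (ev sone)) \<subseteq> WS n"
  using assms
proof (induction rule: FA_induct)
  case (mono c "is")
  have "supp (app (rho (fmono is)) (ev sone)) \<subseteq> WS n"
    using mono
  proof (induction "is")
    case Nil
    then show ?case by (auto simp: rho_one supp_def ev_def split: if_splits)
  next
    case (Cons i "is")
    let ?v = "app (rho (fmono is)) (ev sone)"
    have "supp (app (U i) ?v) \<subseteq> WS n" unfolding U_def using Cons by (intro supp_opU_WS) auto
    moreover have "supp ?v \<subseteq> WS n" using Cons by auto
    moreover have "supp (app (rho (fmono (i # is))) (ev sone)) \<subseteq> supp (app (U i) ?v) \<union> supp ?v"
      by (auto simp: mono_Cons rho_mult rho_free_gen supp_def)
    ultimately show ?case by blast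
  qed
  then show ?case by (auto simp: rho_mult rho_scal supp_def)
next
  case (add x y)
  have "supp (app (rho (x + y)) (ev sone)) \<subseteq> supp (app (rho x) (ev sone)) \<union> supp (app (rho y) (ev sone))"
    by (auto simp: rho_add supp_def)
  then show ?case using add by blast
qed

lemma WS_le: "m \<le> n \<Longrightarrow> WS m \<subseteq> WS n"
  unfolding WS_def by (intro image_mono lists_mono) auto

text \<open>The vanishing of one vector suffices. It separates into the components of the coset
  expansion; each is freed of its coset word by invertibility, which leaves the same statement one
  rank lower.\<close>

theorem faithful:
  "x \<in> FA n \<Longrightarrow> app (rho x) (ev sone) = (\<lambda>w. 0) \<Longrightarrow> x \<in> J n"
proof (induction n arbitrary: x)
  case 0
  have "\<exists>c. x = free_scal c"
    using 0(1)
  proof (induction rule: FA_induct)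
    case (mono c "is")
    then show ?case by auto
  next
    case (add x y)
    then show ?case by (auto simp flip: free_scal_add)
  qed
  then obtain c where c: "x = free_scal c" by blast
  have "c = app (rho x) (ev sone) sone" by (simp add: c rho_scal ev_def)
  then show ?case using 0(2) c by simp
next
  case (Suc n)
  let ?w = "\<lambda>m. wprod gen (coset_word (Suc n) m)" and ?I = "idx (Suc n)"
  obtain h where h: "\<forall>m. h m \<in> FA n" "x - (\<Sum>m\<in>?I. ?w m * h m) \<in> J (Suc n)"
    using CS_sum[OF FA_CS[OF Suc.prems(1)]] by auto
  define v where "v m = app (rho (h m)) (ev sone)" for m
  \<comment> \<open>Elements of rank \<open>n\<close> fix \<open>Suc n\<close>, which is the label
    of the empty coset word.\<close>
  have "supp (v m) \<subseteq> {w \<in> WS (Suc n). sp w (int (Suc n)) = int (Suc n)}" for m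
    using supp_rho[of "h m" n] h(1) WS_le[of n "Suc n"] WS_fix[of _ n "int (Suc n)"]
    by (auto simp: v_def)
  then have s: "supp (app (wprod U (coset_word (Suc n) m)) (v m)) \<subseteq> {w \<in> WS (Suc n). sp w m = int (Suc n)}"
    if "m \<in> ?I" for m
    unfolding U_def using supp_coset_word that by blast
  have "rho x = (\<Sum>m\<in>?I. rho (?w m * h m))"
    using rho_J[OF h(2)] by (simp add: rho_diff rho_sum)
  then have sum0: "(\<Sum>m\<in>?I. app (wprod U (coset_word (Suc n) m)) (v m) w) = 0" for w
    using fun_cong[OF Suc.prems(2), of w] by (simp add: app_sum rho_mult rho_wprod_gen v_def)
  have "h m \<in> J (Suc n)" if m: "m \<in> ?I" for m
  proof -
    have "app (wprod U (coset_word (Suc n) m)) (v m) w = 0" for w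
    proof (rule ccontr)
      assume nz: "app (wprod U (coset_word (Suc n) m)) (v m) w \<noteq> 0"
      then have w: "sp w m = int (Suc n)" using s[OF m] by (auto simp: supp_def)
      have "app (wprod U (coset_word (Suc n) k)) (v k) w = 0" if "k \<in> ?I" "k \<noteq> m" for k
      proof (rule ccontr)
        assume "\<not> ?thesis"
        then have "sp w k = int (Suc n)" using s[OF that(1)] by (auto simp: supp_def)
        then show False using w that(2) by (metis sp_inj)
      qed
      then have "(\<Sum>m\<in>?I. app (wprod U (coset_word (Suc n) m)) (v m) w)
          = app (wprod U (coset_word (Suc n) m)) (v m) w"
        using m by (subst sum.mono_neutral_right[of _ "{m}"]) auto
      then show False using nz sum0 by simp
    qed
    then have "app (wprod U (coset_word (Suc n) m)) (v m) = (\<lambda>w. 0)" by blast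
    then have "v m = (\<lambda>w. 0)" unfolding U_def by (rule wprod_opU_inj)
    then have "h m \<in> J n" using Suc.IH h(1) unfolding v_def by blast
    then show ?thesis using J_le[of n "Suc n"] by simp
  qed
  then have "(\<Sum>m\<in>?I. ?w m * h m) \<in> J (Suc n)"
    using set_coset_word by (intro J_sum J_lmult) auto
  then show ?case using J_add[OF h(2)] by fastforce
qed

lemma rho_eq_iff: "x \<in> FA n \<Longrightarrow> y \<in> FA n \<Longrightarrow> rho x = rho y \<longleftrightarrow> x - y \<in> J n"
proof
  assume "x \<in> FA n" "y \<in> FA n" "rho x = rho y"
  then show "x - y \<in> J n" by (intro faithful) (auto simp: rho_diff)
qed (metis rho_J rho_diff eq_iff_diff_eq_0)

end

section \<open>Standard bases, bar involution and pairing\<close>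

lemma inverse_eq:
  fixes x y x' y' :: "'a::monoid_mult"
  assumes "x = y" "x * x' = 1" "y' * y = 1"
  shows "x' = y'"
  using assms by (metis mult.assoc mult_1_left mult_1_right)

lemma inverse_mult:
  fixes x y x' y' :: "'a::monoid_mult"
  assumes "x * x' = 1" "y * y' = 1"
  shows "(x * y) * (y' * x') = 1"
proof -
  have "(x * y) * (y' * x') = x * (y * y') * x'" by (simp only: mult.assoc)
  then show ?thesis using assms by simp
qed

lemma sum_ev:
  assumes "finite S" "inj_on p S" "w \<in> S"
  shows "(\<Sum>k\<in>S. c k * ev (p k) (p w)) = c w"
proof -
  have "(\<Sum>k\<in>S. c k * ev (p k) (p w)) = (\<Sum>k\<in>S. if k = w then c w else 0)"
    using assms by (intro sum.cong) (auto simp: ev_def inj_on_def)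
  then show ?thesis using assms by simp
qed

definition rword :: "nat \<Rightarrow> sperm \<Rightarrow> nat list" where
  "rword n w = (SOME is. reduced_expr n (sp w) is)"

lemma rword:
  assumes "w \<in> WS n"
  shows "reduced n (rword n w)" "sword (rword n w) = w" "set (rword n w) \<subseteq> {..<n}"
proof -
  obtain js where js: "reduced n js" "sword js = w" using exists_reduced assms by blast
  then have "reduced_expr n (sp w) js" using reduced_expr_iff[of n js js] by auto
  then have "reduced_expr n (sp w) (rword n w)" unfolding rword_def by (rule someI)
  then show "reduced n (rword n w)" "sword (rword n w) = w"
    using js(2) reduced_expr_iff[of n js "rword n w"] by auto
  then show "set (rword n w) \<subseteq> {..<n}" by (simp add: reduced_def)
qed

lemma WS_sinv: "w \<in> WS n \<Longrightarrow> sinv w \<in> WS n"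
  by (auto simp: WS_def sinv_sword)

lemma inj_sp: "inj_on sp A"
  by (auto simp: inj_on_def sp_inject)

lemma sp_mem_W_B: "sp w \<in> W_B n \<longleftrightarrow> w \<in> WS n"
  unfolding sp_image_WS[symmetric] by (auto simp: sp_inject)

context hecke
begin

text \<open>\<open>V i\<close> is the image of \<open>t\<^sub>i\<close> under \<open>pi2\<close>,
  and \<open>U i\<close> is the image of its inverse under \<open>pi1\<close>, whence the negated
  parameters. \<open>pi2\<close> sends the \<open>t\<^sub>w\<close> to point masses,
  \<open>pi1\<close> does so for their inverses.\<close>

definition V :: "nat \<Rightarrow> 'k lin_op" where "V = opU (q - inverse q) (q0 - inverse q0)"
definition U :: "nat \<Rightarrow> 'k lin_op" where "U = opU (inverse q - q) (inverse q0 - q0)"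
definition pi1 :: "(fword \<Rightarrow>\<^sub>0 'k) \<Rightarrow> 'k lin_op" where
  "pi1 = lext scal (wprod (\<lambda>i. U i + scal (al i)))"
definition pi2 :: "(fword \<Rightarrow>\<^sub>0 'k) \<Rightarrow> 'k lin_op" where "pi2 = lext scal (wprod V)"

lemma U_square: "U i * U i = 1 - scal (al i) * U i"
  using opU_square[of "inverse q - q" "inverse q0 - q0" i]
  by (cases "i = 0") (simp_all add: U_def al_def scal_diff algebra_simps)

lemma V_square: "V i * V i = 1 + scal (al i) * V i"
  using opU_square[of "q - inverse q" "q0 - inverse q0" i] by (auto simp: V_def al_def)

lemma V_far: "i + 2 \<le> j \<or> j + 2 \<le> i \<Longrightarrow> V i * V j = V j * V i"
  and V_braid: "1 \<le> i \<Longrightarrow> V i * V (i + 1) * V i = V (i + 1) * V i * V (i + 1)"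
  and V_braid0: "V 0 * V 1 * V 0 * V 1 = V 1 * V 0 * V 1 * V 0"
  unfolding V_def by (rule opU_commute opU_braid opU_braid0; assumption)+

lemma U_far: "i + 2 \<le> j \<or> j + 2 \<le> i \<Longrightarrow> U i * U j = U j * U i"
  and U_braid: "1 \<le> i \<Longrightarrow> U i * U (i + 1) * U i = U (i + 1) * U i * U (i + 1)"
  and U_braid0: "U 0 * U 1 * U 0 * U 1 = U 1 * U 0 * U 1 * U 0"
  unfolding U_def by (rule opU_commute opU_braid opU_braid0; assumption)+

lemma V_inv: "V i * (V i - scal (al i)) = 1" "(V i - scal (al i)) * V i = 1"
  using V_square[of i] by (simp_all add: algebra_simps scal_comm[of "V i"])

lemma U_inv: "U i * (U i + scal (al i)) = 1" "(U i + scal (al i)) * U i = 1"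
  using U_square[of i] by (simp_all add: algebra_simps scal_comm[of "U i"])

text \<open>Inverting both sides of a braid relation gives the relation for the inverses, since
  reversal maps each relation to itself up to exchanging its sides.\<close>

lemma braid_inverse:
  fixes f f' :: "nat \<Rightarrow> 'a::monoid_mult"
  assumes inv: "\<And>i. f i * f' i = 1" "\<And>i. f' i * f i = 1"
    and "i + 2 \<le> j \<or> j + 2 \<le> i \<Longrightarrow> f i * f j = f j * f i"
    and "1 \<le> i \<Longrightarrow> f i * f (i + 1) * f i = f (i + 1) * f i * f (i + 1)"
    and "f 0 * f 1 * f 0 * f 1 = f 1 * f 0 * f 1 * f 0"
  shows "i + 2 \<le> j \<or> j + 2 \<le> i \<Longrightarrow> f' i * f' j = f' j * f' i"
    and "1 \<le> i \<Longrightarrow> f' i * f' (i + 1) * f' i = f' (i + 1) * f' i * f' (i + 1)"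
    and "f' 0 * f' 1 * f' 0 * f' 1 = f' 1 * f' 0 * f' 1 * f' 0"
proof -
  show "f' i * f' j = f' j * f' i" if "i + 2 \<le> j \<or> j + 2 \<le> i"
    using inverse_eq[OF assms(3)[OF that, symmetric] inverse_mult[OF inv(1) inv(1)]
        inverse_mult[OF inv(2) inv(2)]] .
  show "f' i * f' (i + 1) * f' i = f' (i + 1) * f' i * f' (i + 1)" if "1 \<le> i"
  proof -
    have "f i * f (i + 1) * f i * (f' i * (f' (i + 1) * f' i)) = 1"
      by (intro inverse_mult inv)
    moreover have "f' (i + 1) * (f' i * f' (i + 1)) * (f (i + 1) * f i * f (i + 1)) = 1"
      by (intro inverse_mult inv)
    ultimately have "f' i * (f' (i + 1) * f' i) = f' (i + 1) * (f' i * f' (i + 1))"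
      by (rule inverse_eq[OF assms(4)[OF that]])
    then show ?thesis by (simp only: mult.assoc)
  qed
  show "f' 0 * f' 1 * f' 0 * f' 1 = f' 1 * f' 0 * f' 1 * f' 0"
  proof -
    have "f 0 * f 1 * f 0 * f 1 * (f' 1 * (f' 0 * (f' 1 * f' 0))) = 1"
      by (intro inverse_mult inv)
    moreover have "f' 0 * (f' 1 * (f' 0 * f' 1)) * (f 1 * f 0 * f 1 * f 0) = 1"
      by (intro inverse_mult inv)
    ultimately have "f' 1 * (f' 0 * (f' 1 * f' 0)) = f' 0 * (f' 1 * (f' 0 * f' 1))"
      by (rule inverse_eq[OF assms(5)])
    then show ?thesis by (simp only: mult.assoc)
  qed
qed

sublocale pi2: alg_ext scal "wprod V"
  by unfold_locales (rule scal_add scal_one scal_mult scal_comm wprod_simps(1))+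

sublocale pi1: alg_ext scal "wprod (\<lambda>i. U i + scal (al i))"
  by unfold_locales (rule scal_add scal_one scal_mult scal_comm wprod_simps(1))+

lemma pi2_simps:
  "pi2 (x + y) = pi2 x + pi2 y" "pi2 (x - y) = pi2 x - pi2 y" "pi2 (- x) = - pi2 x"
  "pi2 (x * y) = pi2 x * pi2 y" "pi2 0 = 0" "pi2 1 = 1" "pi2 (free_scal c) = scal c"
  "pi2 (free_gen i) = V i"
  by (simp_all add: pi2_def pi2.ext_add pi2.ext_diff pi2.ext_minus pi2.ext_mult pi2.ext_scal pi2.ext_gen)

lemma pi1_simps:
  "pi1 (x + y) = pi1 x + pi1 y" "pi1 (x - y) = pi1 x - pi1 y" "pi1 (- x) = - pi1 x"
  "pi1 (x * y) = pi1 x * pi1 y" "pi1 0 = 0" "pi1 1 = 1" "pi1 (free_scal c) = scal c"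
  "pi1 (free_gen i) = U i + scal (al i)"
  by (simp_all add: pi1_def pi1.ext_add pi1.ext_diff pi1.ext_minus pi1.ext_mult pi1.ext_scal pi1.ext_gen)

lemma pi1_ui: "pi1 (ui i) = U i"
  by (simp add: ui_def pi1_simps)

lemma pi2_ui: "pi2 (ui i) = V i - scal (al i)"
  by (simp add: ui_def pi2_simps)

lemma pi2_J: "x \<in> J n \<Longrightarrow> pi2 x = 0"
proof (induction rule: J_induct)
  case (quad i)
  then show ?case by (simp add: pi2_simps V_square)
next
  case (far i j)
  then show ?case using V_far[of i j] by (simp add: pi2_simps)
next
  case (braid i)
  then show ?case using V_braid by (simp add: pi2_simps)
next
  case braid0
  then show ?case using V_braid0 by (simp add: pi2_simps)
qed (simp_all add: pi2_simps)

lemma pi1_J: "x \<in> J n \<Longrightarrow> pi1 x = 0"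
proof (induction rule: J_induct)
  case (quad i)
  then show ?case
    by (simp add: pi1_simps algebra_simps U_square scal_comm[of "U i"])
next
  case (far i j)
  then show ?case using braid_inverse(1)[of U "\<lambda>i. U i + scal (al i)", OF U_inv U_far U_braid U_braid0, of i j]
    by (simp add: pi1_simps)
next
  case (braid i)
  then show ?case using braid_inverse(2)[of U "\<lambda>i. U i + scal (al i)", OF U_inv U_far U_braid U_braid0, of i]
    by (simp add: pi1_simps)
next
  case braid0
  then show ?case using braid_inverse(3)[of U "\<lambda>i. U i + scal (al i)", OF U_inv U_far U_braid U_braid0]
    by (simp add: pi1_simps)
qed (simp_all add: pi1_simps)

sublocale rep2: hecke_rep q q0 0 0 "q0 - inverse q0" "q - inverse q" free_gen "\<lambda>_. 0" al pi2 V
proof unfold_locales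
  show "(\<lambda>_. 0) = (\<lambda>i. if i = 0 then 0 else 0 :: 'k)" by simp
  show "al = (\<lambda>i. if i = 0 then q0 - inverse q0 else q - inverse q)" by (simp add: al_def fun_eq_iff)
  show "free_gen = (\<lambda>i. free_gen i + free_scal (0 :: 'k))" by simp
  show "V = opU (q - inverse q) (q0 - inverse q0)" by (rule V_def)
  show "pi2 = lext scal (wprod (\<lambda>i. V i - scal 0))" by (simp add: pi2_def)
  show "free_gen i * free_gen i - 1 - free_scal (al i) * free_gen i \<in> J n" if "i < n" for i n
    by (rule J_quad[OF that])
  show "free_gen i * free_gen j - free_gen j * free_gen i \<in> J n"
    if "i < n" "j < n" "i + 2 \<le> j \<or> j + 2 \<le> i" for i j n
    by (rule J_far[OF that])
  show "free_gen i * free_gen (i + 1) * free_gen i - free_gen (i + 1) * free_gen i * free_gen (i + 1) \<in> J n"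
    if "1 \<le> i" "i + 1 < n" for i n
    by (rule J_braid[OF that])
  show "free_gen 0 * free_gen 1 * free_gen 0 * free_gen 1
      - free_gen 1 * free_gen 0 * free_gen 1 * free_gen 0 \<in> J n" if "1 < n" for n
    by (rule J_braid0[OF that])
  show "pi2 x = 0" if "x \<in> J n" for x n
    by (rule pi2_J[OF that])
qed

lemma J_ui_sq: "i < n \<Longrightarrow> ui i * ui i - 1 - free_scal (- al i) * ui i \<in> J n"
  using J_quad[of i n]
  by (simp add: ui_def algebra_simps free_scal_minus free_scal_comm[of "free_gen _"])

text \<open>Modulo the ideal \<open>ui\<close> is an inverse only within a fixed rank; the relation
  is therefore checked on operators, where the inverses are genuine, and pulled back by faithfulness
  of \<open>pi2\<close>.\<close>

lemma J_ui_far: "i < n \<Longrightarrow> j < n \<Longrightarrow> i + 2 \<le> j \<or> j + 2 \<le> i \<Longrightarrow> ui i * ui j - ui j * ui i \<in> J n"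
  by (rule rep2.rho_eq_iff[THEN iffD1], simp, simp, unfold pi2_simps pi2_ui)
    (rule braid_inverse(1)[of V, OF V_inv V_far V_braid V_braid0])

lemma J_ui_braid: "1 \<le> i \<Longrightarrow> i + 1 < n \<Longrightarrow>
    ui i * ui (i + 1) * ui i - ui (i + 1) * ui i * ui (i + 1) \<in> J n"
  by (rule rep2.rho_eq_iff[THEN iffD1], simp, simp, unfold pi2_simps pi2_ui)
    (rule braid_inverse(2)[of V, OF V_inv V_far V_braid V_braid0])

lemma J_ui_braid0: "1 < n \<Longrightarrow> ui 0 * ui 1 * ui 0 * ui 1 - ui 1 * ui 0 * ui 1 * ui 0 \<in> J n"
  by (rule rep2.rho_eq_iff[THEN iffD1], simp, simp, unfold pi2_simps pi2_ui)
    (rule braid_inverse(3)[of V, OF V_inv V_far V_braid V_braid0])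

sublocale rep1: hecke_rep q q0 "inverse q0 - q0" "inverse q - q" "inverse q0 - q0" "inverse q - q" ui
  "\<lambda>i. - al i" "\<lambda>i. - al i" pi1 U
proof unfold_locales
  show "(\<lambda>i. - al i) = (\<lambda>i. if i = 0 then inverse q0 - q0 else inverse q - q)"
    by (simp add: al_def fun_eq_iff)
  show "ui = (\<lambda>i. free_gen i + free_scal (- al i))" by (simp add: ui_def fun_eq_iff free_scal_minus)
  show "U = opU (inverse q - q) (inverse q0 - q0)" by (rule U_def)
  show "pi1 = lext scal (wprod (\<lambda>i. U i - scal (- al i)))" by (simp add: pi1_def scal_minus)
  show "ui i * ui i - 1 - free_scal (- al i) * ui i \<in> J n" if "i < n" for i n
    by (rule J_ui_sq[OF that])
  show "ui i * ui j - ui j * ui i \<in> J n" if "i < n" "j < n" "i + 2 \<le> j \<or> j + 2 \<le> i" for i j n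
    by (rule J_ui_far[OF that])
  show "ui i * ui (i + 1) * ui i - ui (i + 1) * ui i * ui (i + 1) \<in> J n"
    if "1 \<le> i" "i + 1 < n" for i n
    by (rule J_ui_braid[OF that])
  show "ui 0 * ui 1 * ui 0 * ui 1 - ui 1 * ui 0 * ui 1 * ui 0 \<in> J n" if "1 < n" for n
    by (rule J_ui_braid0[OF that])
  show "pi1 x = 0" if "x \<in> J n" for x n
    by (rule pi1_J[OF that])
qed

end

context hecke
begin

lemma cls_eqI: "x \<in> FA n \<Longrightarrow> y \<in> FA n \<Longrightarrow> x - y \<in> J n \<Longrightarrow> cls n x = cls n y"
  by (simp only: cls_eq_iff)

lemma sum_W_B_cls:
  assumes "\<And>w. w \<in> WS n \<Longrightarrow> B w \<in> FA n" "\<And>w. w \<in> WS n \<Longrightarrow> b (sp w) = cls n (B w)"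
  shows "(\<Oplus>\<^bsub>H n\<^esub>w\<in>W_B n. c w \<odot>\<^bsub>H n\<^esub> b w) = cls n (\<Sum>w\<in>WS n. free_scal (c (sp w)) * B w)"
proof -
  interpret ring "H n" by (rule ring_H)
  have "(\<Oplus>\<^bsub>H n\<^esub>w\<in>sp ` WS n. c w \<odot>\<^bsub>H n\<^esub> b w) = (\<Oplus>\<^bsub>H n\<^esub>w\<in>WS n. c (sp w) \<odot>\<^bsub>H n\<^esub> b (sp w))"
    using assms inj_sp by (intro finsum_reindex) (auto simp: smult_H)
  also have "\<dots> = (\<Oplus>\<^bsub>H n\<^esub>w\<in>WS n. cls n (free_scal (c (sp w)) * B w))"
    using assms by (intro finsum_cong') (auto simp: smult_H)
  also have "\<dots> = cls n (\<Sum>w\<in>WS n. free_scal (c (sp w)) * B w)"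
    using assms finite_WS by (intro finsum_H) auto
  finally show ?thesis by (simp add: sp_image_WS)
qed

definition kU :: "nat \<Rightarrow> 'k lin_op" where "kU i = wprod U (rev [1..<i] @ [0] @ [1..<i])"

end

context hecke_rep
begin

text \<open>The basis elements go to distinct point masses, so the coefficient at \<open>w\<close>
  is read off at the position \<open>p w\<close>, and faithfulness gives the expansion itself.
  \<open>p\<close> is inversion for the \<open>t\<^sub>w\<close> and the identity for their
  inverses.\<close>

lemma hecke_coeff_eq:
  assumes x: "x \<in> FA n"
    and B: "\<And>w. w \<in> WS n \<Longrightarrow> B w \<in> FA n" "\<And>w. w \<in> WS n \<Longrightarrow> b (sp w) = cls n (B w)"
      "\<And>w. w \<in> WS n \<Longrightarrow> app (rho (B w)) (ev sone) = ev (p w)"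
    and p: "bij_betw p (WS n) (WS n)"
  shows "w \<in> WS n \<Longrightarrow> hecke_coeff q q0 n b (cls n x) (sp w) = app (rho x) (ev sone) (p w)"
    and "x - (\<Sum>w\<in>WS n. free_scal (app (rho x) (ev sone) (p w)) * B w) \<in> J n"
proof -
  have fin: "(\<Oplus>\<^bsub>H n\<^esub>w\<in>W_B n. c w \<odot>\<^bsub>H n\<^esub> b w) = cls n (\<Sum>w\<in>WS n. free_scal (c (sp w)) * B w)" for c
    by (rule sum_W_B_cls) (use B in auto)
  have sumFA: "(\<Sum>w\<in>WS n. free_scal (c w) * B w) \<in> FA n" for c
    using B(1) by (intro FA_sum) auto
  have val: "app (rho (\<Sum>w\<in>WS n. free_scal (c w) * B w)) (ev sone) (p w) = c w" if "w \<in> WS n" for c w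
  proof -
    have "app (rho (\<Sum>w\<in>WS n. free_scal (c w) * B w)) (ev sone) (p w)
        = (\<Sum>k\<in>WS n. c k * ev (p k) (p w))"
      using B(3) by (simp add: rho_sum app_sum rho_mult rho_scal)
    then show ?thesis using sum_ev finite_WS that p by (metis bij_betw_def)
  qed
  have iff: "cls n x = cls n (\<Sum>w\<in>WS n. free_scal (c w) * B w) \<longleftrightarrow>
      (\<forall>w\<in>WS n. c w = app (rho x) (ev sone) (p w))" for c
  proof
    assume "cls n x = cls n (\<Sum>w\<in>WS n. free_scal (c w) * B w)"
    then have "rho x = rho (\<Sum>w\<in>WS n. free_scal (c w) * B w)"
      using x sumFA by (simp add: cls_eq_iff rho_eq_iff)
    then show "\<forall>w\<in>WS n. c w = app (rho x) (ev sone) (p w)" using val by simp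
  next
    assume c: "\<forall>w\<in>WS n. c w = app (rho x) (ev sone) (p w)"
    let ?s = "\<Sum>w\<in>WS n. free_scal (c w) * B w"
    have "app (rho (x - ?s)) (ev sone) u = 0" for u
    proof (cases "u \<in> WS n")
      case True
      then obtain w where "w \<in> WS n" "u = p w" using p by (metis bij_betw_imp_surj_on imageE)
      then show ?thesis using val c by (simp add: rho_diff)
    next
      case False
      moreover have "supp (app (rho (x - ?s)) (ev sone)) \<subseteq> WS n"
        using x sumFA by (intro supp_rho) auto
      ultimately show ?thesis by (auto simp: supp_def)
    qed
    then have "x - ?s \<in> J n" using x sumFA by (intro faithful) auto
    then show "cls n x = cls n ?s" using x sumFA by (simp add: cls_eq_iff)
  qed
  \<comment> \<open>The value zero outside \<open>W_B n\<close> is the convention that makes the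
    description in \<open>hecke_coeff\<close> unique.\<close>
  define d where "d u = (if u \<in> W_B n then app (rho x) (ev sone) (p (the_inv_into (WS n) sp u)) else 0)" for u
  have d: "d (sp w) = app (rho x) (ev sone) (p w)" if "w \<in> WS n" for w
    using that by (simp add: d_def sp_mem_W_B the_inv_into_f_f inj_sp)
  have "hecke_coeff q q0 n b (cls n x) = d"
    unfolding hecke_coeff_def fin iff
  proof (rule the_equality)
    show "(\<forall>w. w \<notin> W_B n \<longrightarrow> d w = 0) \<and> (\<forall>w\<in>WS n. d (sp w) = app (rho x) (ev sone) (p w))"
      using d by (simp add: d_def)
  next
    fix c assume c: "(\<forall>w. w \<notin> W_B n \<longrightarrow> c w = 0) \<and> (\<forall>w\<in>WS n. c (sp w) = app (rho x) (ev sone) (p w))"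
    show "c = d"
    proof
      fix u
      show "c u = d u"
      proof (cases "u \<in> W_B n")
        case True
        then obtain w where "w \<in> WS n" "u = sp w" using sp_image_WS by blast
        then show ?thesis using c d by simp
      next
        case False
        then show ?thesis using c by (simp add: d_def)
      qed
    qed
  qed
  then show "w \<in> WS n \<Longrightarrow> hecke_coeff q q0 n b (cls n x) (sp w) = app (rho x) (ev sone) (p w)"
    using d by simp
  show "x - (\<Sum>w\<in>WS n. free_scal (app (rho x) (ev sone) (p w)) * B w) \<in> J n"
    using iff[of "\<lambda>w. app (rho x) (ev sone) (p w)"] x sumFA by (simp add: cls_eq_iff)
qed

end

context hecke
begin

lemma hecke_t_sp: "w \<in> WS n \<Longrightarrow> hecke_t q q0 n (sp w) = cls n (fmono (rword n w))"
  unfolding hecke_t_def rword_def[symmetric] using rword(3) by (simp add: hecke_word_cls)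

lemma hecke_t_inv_sp: "w \<in> WS n \<Longrightarrow> hecke_t_inv q q0 n (sp w) = cls n (wprod ui (rev (rword n w)))"
  unfolding hecke_t_inv_def using rword(3) by (simp add: hecke_t_sp inv_cls_mono)

lemma pi2_fmono: "pi2 (fmono is) = wprod V is"
  by (simp add: rep2.rho_wprod_gen flip: wprod_free_gen)

lemma app_pi2_rword:
  assumes "w \<in> WS n"
  shows "app (pi2 (fmono (rword n w))) (ev sone) = ev (sinv w)"
  using app_wprod_reduced[OF reduced_rev[OF rword(1)[OF assms]]] rword(2)[OF assms]
  by (simp add: pi2_fmono V_def flip: sinv_sword)

lemma app_pi1_rword:
  assumes "w \<in> WS n"
  shows "app (pi1 (wprod ui (rev (rword n w)))) (ev sone) = ev w"
  using app_wprod_reduced[OF rword(1)[OF assms]] rword(2)[OF assms]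
  by (simp add: rep1.rho_wprod_gen U_def)

lemma bij_sinv: "bij_betw sinv (WS n) (WS n)"
  by (rule bij_betwI[of _ _ _ sinv]) (auto simp: WS_sinv)

lemma FA_rword [simp]: "w \<in> WS n \<Longrightarrow> fmono (rword n w) \<in> FA n"
  "w \<in> WS n \<Longrightarrow> wprod ui (rev (rword n w)) \<in> FA n" "w \<in> WS n \<Longrightarrow> wprod ui (rword n w) \<in> FA n"
  using rword(3) by (auto intro!: FA_wprod)

lemma coeff_t:
  assumes "x \<in> FA n"
  shows "w \<in> WS n \<Longrightarrow> hecke_coeff q q0 n (hecke_t q q0 n) (cls n x) (sp w) = app (pi2 x) (ev sone) (sinv w)"
    and "x - (\<Sum>w\<in>WS n. free_scal (app (pi2 x) (ev sone) (sinv w)) * fmono (rword n w)) \<in> J n"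
  using rep2.hecke_coeff_eq[of x n "\<lambda>w. fmono (rword n w)" "hecke_t q q0 n" sinv,
      OF assms _ hecke_t_sp app_pi2_rword bij_sinv] by auto

lemma tau_cls:
  assumes "x \<in> FA n"
  shows "hecke_tau q q0 n (cls n x) = tau (pi1 x)"
proof -
  have "hecke_coeff q q0 n (hecke_t_inv q q0 n) (cls n x) (sp sone) = app (pi1 x) (ev sone) sone"
    by (rule rep1.hecke_coeff_eq(1)[where p = "\<lambda>w. w" and B = "\<lambda>w. wprod ui (rev (rword n w))"])
      (use assms hecke_t_inv_sp app_pi1_rword in \<open>auto simp: bij_betw_def\<close>)
  moreover have "sp sone = id" by auto
  ultimately show ?thesis by (simp add: hecke_tau_def tau_def)
qed

text \<open>Independence of the chosen reduced word: reversing a reduced word of \<open>w\<close>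
  gives a reduced word of \<open>sinv w\<close>, and two reduced words of one element have the same
  point mass as image, so faithfulness identifies them.\<close>

lemma J_rword_sinv:
  assumes "w \<in> WS n"
  shows "wprod ui (rword n w) - wprod ui (rev (rword n (sinv w))) \<in> J n"
    and "fmono (rev (rword n w)) - fmono (rword n (sinv w)) \<in> J n"
proof -
  have w': "sinv w \<in> WS n" using assms WS_sinv by blast
  have r: "app (pi1 (wprod ui (rword n w))) (ev sone) = ev (sinv w)"
    using app_wprod_reduced[OF reduced_rev[OF rword(1)[OF assms]]] rword(2)[OF assms]
    by (simp add: rep1.rho_wprod_gen U_def flip: sinv_sword)
  show "wprod ui (rword n w) - wprod ui (rev (rword n (sinv w))) \<in> J n"
    using assms w' r app_pi1_rword[OF w'] by (intro rep1.faithful) (auto simp: pi1_simps)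
  have r2: "app (pi2 (fmono (rev (rword n w)))) (ev sone) = ev w"
    using app_wprod_reduced[OF rword(1)[OF assms]] rword(2)[OF assms]
    by (simp add: pi2_fmono V_def)
  have "fmono (rev (rword n w)) \<in> FA n" using rword(3)[OF assms] by simp
  then show "fmono (rev (rword n w)) - fmono (rword n (sinv w)) \<in> J n"
    using assms w' r2 app_pi2_rword[OF w'] by (intro rep2.faithful) (auto simp: pi2_simps)
qed

section \<open>Anti-involution, bar involution and pairing on representatives\<close>

definition anti :: "(fword \<Rightarrow>\<^sub>0 'k) \<Rightarrow> fword \<Rightarrow>\<^sub>0 'k" where
  "anti = lext free_scal (\<lambda>is. fmono (rev is))"

sublocale anti: alg_ext free_scal "\<lambda>is. fmono (rev is)"
  by unfold_locales (simp_all add: free_scal_add free_scal_mult, rule free_scal_comm)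

lemma anti_simps:
  "anti (x + y) = anti x + anti y" "anti (x - y) = anti x - anti y" "anti (- x) = - anti x"
  "anti (x * y) = anti y * anti x" "anti 0 = 0" "anti 1 = 1" "anti (free_scal c) = free_scal c"
  "anti (free_gen i) = free_gen i" "anti (fmono is) = fmono (rev is)"
  "anti (\<Sum>i\<in>I. z i) = (\<Sum>i\<in>I. anti (z i))"
  by (simp_all add: anti_def anti.ext_add anti.ext_diff anti.ext_minus anti.ext_anti_mult mono_append
      anti.ext_scal anti.ext_gen anti.ext_mono anti.ext_sum free_gen_mono)

lemma anti_FA [simp]: "x \<in> FA n \<Longrightarrow> anti x \<in> FA n"
  by (induction rule: FA_induct) (auto simp: anti_simps)

lemma anti_J: "x \<in> J n \<Longrightarrow> anti x \<in> J n"
proof (induction rule: J_induct)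
  case (quad i)
  then show ?case using J_quad[of i n] by (simp add: anti_simps free_scal_comm)
next
  case (far i j)
  then show ?case using J_far[of j n i] by (auto simp: anti_simps)
next
  case (braid i)
  then show ?case using J_braid[of i n] by (simp add: anti_simps mult.assoc)
next
  case braid0
  then show ?case using J_uminus[OF J_braid0[of n]] by (simp add: anti_simps mult.assoc)
qed (auto simp: anti_simps intro: J_add J_uminus J_lmult J_rmult)

lemma sum_WS_cong:
  assumes "\<And>w. w \<in> WS n \<Longrightarrow> f w - g w \<in> J n"
  shows "(\<Sum>w\<in>WS n. free_scal (c w) * f w) - (\<Sum>w\<in>WS n. free_scal (c w) * g w) \<in> J n"
proof -
  have "(\<Sum>w\<in>WS n. free_scal (c w) * (f w - g w)) \<in> J n"
    using assms by (intro J_sum J_lmult) auto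
  then show ?thesis by (simp add: algebra_simps sum_subtractf)
qed

lemma inv_sp: "inv_into UNIV (sp w) = sp (sinv w)"
  by (simp add: sinv.rep_eq)

text \<open>A \<open>\<sigma>\<close>-semilinear map \<open>g\<close> of the free algebra that
  respects the ideal agrees on classes with the map prescribed on the \<open>t\<^sub>w\<close>.
  \<open>G\<close> is the value of \<open>g\<close> on the chosen reduced word, \<open>B\<close> a
  representative of the prescribed image.\<close>

lemma sum_coeff_cls:
  assumes x: "x \<in> FA n" and J: "\<And>z. z \<in> J n \<Longrightarrow> g z \<in> J n" and gx: "g x \<in> FA n"
    and g: "\<And>c. g (x - (\<Sum>w\<in>WS n. free_scal (c w) * fmono (rword n w)))
      = g x - (\<Sum>w\<in>WS n. free_scal (\<sigma> (c w)) * G w)"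
    and GB: "\<And>w. w \<in> WS n \<Longrightarrow> G w - B w \<in> J n" "\<And>w. w \<in> WS n \<Longrightarrow> B w \<in> FA n"
    and b: "\<And>w. w \<in> WS n \<Longrightarrow> b (sp w) = cls n (B w)"
  shows "(\<Oplus>\<^bsub>H n\<^esub>w\<in>W_B n. \<sigma> (hecke_coeff q q0 n (hecke_t q q0 n) (cls n x) w) \<odot>\<^bsub>H n\<^esub> b w) = cls n (g x)"
proof -
  define c where "c w = app (pi2 x) (ev sone) (sinv w)" for w
  have "(\<Oplus>\<^bsub>H n\<^esub>w\<in>W_B n. \<sigma> (hecke_coeff q q0 n (hecke_t q q0 n) (cls n x) w) \<odot>\<^bsub>H n\<^esub> b w)
      = cls n (\<Sum>w\<in>WS n. free_scal (\<sigma> (hecke_coeff q q0 n (hecke_t q q0 n) (cls n x) (sp w))) * B w)"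
    by (rule sum_W_B_cls) (use GB(2) b in auto)
  also have "(\<Sum>w\<in>WS n. free_scal (\<sigma> (hecke_coeff q q0 n (hecke_t q q0 n) (cls n x) (sp w))) * B w)
      = (\<Sum>w\<in>WS n. free_scal (\<sigma> (c w)) * B w)"
    by (rule sum.cong) (auto simp: coeff_t(1)[OF x] c_def)
  also have "cls n \<dots> = cls n (g x)"
  proof -
    have "g x - (\<Sum>w\<in>WS n. free_scal (\<sigma> (c w)) * G w) \<in> J n"
      unfolding g[symmetric] unfolding c_def by (rule J[OF coeff_t(2)[OF x]])
    from J_add[OF this sum_WS_cong[of n G B "\<lambda>w. \<sigma> (c w)", OF GB(1)]]
    have "g x - (\<Sum>w\<in>WS n. free_scal (\<sigma> (c w)) * B w) \<in> J n" by simp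
    moreover have "(\<Sum>w\<in>WS n. free_scal (\<sigma> (c w)) * B w) \<in> FA n"
      using GB(2) by (intro FA_sum FA_mult) auto
    ultimately show ?thesis using gx by (intro cls_eqI[symmetric])
  qed
  finally show ?thesis .
qed

lemma hecke_anti_cls:
  assumes x: "x \<in> FA n"
  shows "hecke_anti q q0 n (cls n x) = cls n (anti x)"
  unfolding hecke_anti_def
  by (rule sum_coeff_cls[where g = anti and \<sigma> = "\<lambda>c. c" and G = "\<lambda>w. fmono (rev (rword n w))"
        and B = "\<lambda>w. fmono (rword n (sinv w))"])
    (simp_all add: x anti_J J_rword_sinv(2) anti_simps free_scal_comm inv_sp hecke_t_sp WS_sinv)

end

locale hecke_conj = hecke q q0 for q q0 :: "'k::field" +
  fixes cj :: "'k \<Rightarrow> 'k"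
  assumes cj_one [simp]: "cj 1 = 1" and cj_add: "cj (a + b) = cj a + cj b"
    and cj_mult: "cj (a * b) = cj a * cj b"
    and cj_q: "cj q = inverse q" and cj_q0: "cj q0 = inverse q0"
begin

lemma cj_zero [simp]: "cj 0 = 0"
  using cj_add[of 0 0] by (metis add_0_right add_left_cancel)
lemma cj_minus: "cj (- a) = - cj a"
  using cj_add[of a "- a"] by (simp add: eq_neg_iff_add_eq_0 add.commute)
lemma cj_diff: "cj (a - b) = cj a - cj b"
  using cj_add[of a "- b"] by (simp add: cj_minus)
lemma cj_inverse: "cj (inverse a) = inverse (cj a)"
proof (cases "a = 0")
  case False
  then have "cj a * cj (inverse a) = 1" by (simp flip: cj_mult)
  then show ?thesis by (simp add: inverse_unique)
qed simp

lemma cj_al: "cj (al i) = - al i"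
  by (simp add: al_def cj_diff cj_inverse cj_q cj_q0)

text \<open>Sending \<open>t\<^sub>w\<close> to the inverse of \<open>t\<close> at the inverse of
  \<open>w\<close> keeps the order of the letters, so the bar involution is multiplicative and sends
  \<open>t\<^sub>i\<close> to \<open>ui i\<close>.\<close>

definition bar :: "(fword \<Rightarrow>\<^sub>0 'k) \<Rightarrow> fword \<Rightarrow>\<^sub>0 'k" where
  "bar = lext (\<lambda>c. free_scal (cj c)) (wprod ui)"

sublocale bar: alg_ext "\<lambda>c. free_scal (cj c)" "wprod ui"
  by unfold_locales (simp_all add: free_scal_add free_scal_mult cj_add cj_mult, rule free_scal_comm)

lemma bar_simps:
  "bar (x + y) = bar x + bar y" "bar (x - y) = bar x - bar y" "bar (- x) = - bar x"
  "bar (x * y) = bar x * bar y" "bar 0 = 0" "bar 1 = 1" "bar (free_scal c) = free_scal (cj c)"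
  "bar (free_gen i) = ui i" "bar (fmono is) = wprod ui is"
  "bar (\<Sum>i\<in>I. z i) = (\<Sum>i\<in>I. bar (z i))"
  by (simp_all add: bar_def bar.ext_add bar.ext_diff bar.ext_minus bar.ext_mult
      bar.ext_scal bar.ext_gen bar.ext_mono bar.ext_sum)

lemma bar_FA [simp]: "x \<in> FA n \<Longrightarrow> bar x \<in> FA n"
  by (induction rule: FA_induct) (auto simp: bar_simps intro!: FA_wprod)

lemma bar_J: "x \<in> J n \<Longrightarrow> bar x \<in> J n"
proof (induction rule: J_induct)
  case (quad i)
  then show ?case using J_ui_sq[of i n] by (simp add: bar_simps cj_al)
next
  case (far i j)
  then show ?case using J_ui_far[of i n j] by (simp add: bar_simps)
next
  case (braid i)
  then show ?case using J_ui_braid[of i n] by (simp add: bar_simps)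
next
  case braid0
  then show ?case using J_ui_braid0[of n] by (simp add: bar_simps)
qed (auto simp: bar_simps intro: J_add J_uminus J_lmult J_rmult)

lemma hecke_bar_cls:
  assumes x: "x \<in> FA n"
  shows "hecke_bar cj q q0 n (cls n x) = cls n (bar x)"
  unfolding hecke_bar_def
  by (rule sum_coeff_cls[where g = bar and \<sigma> = cj and G = "\<lambda>w. wprod ui (rword n w)"
        and B = "\<lambda>w. wprod ui (rev (rword n (sinv w)))"])
    (simp_all add: x bar_J J_rword_sinv(1) bar_simps inv_sp hecke_t_inv_sp WS_sinv)

lemma hecke_pairing_cls:
  assumes "x \<in> FA n" "y \<in> FA n"
  shows "hecke_pairing cj q q0 n (cls n x) (cls n y) = tau (pi1 (anti (bar x)) * pi1 y)"
  using assms by (simp add: hecke_pairing_def hecke_bar_cls hecke_anti_cls mult_H tau_cls pi1_simps)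

lemma anti_wprod_ui: "anti (wprod ui is) = wprod ui (rev is)"
  by (induction "is") (simp_all add: anti_simps ui_def)

lemma pi1_anti_bar_wprod: "pi1 (anti (bar (wprod f is))) = wprod (\<lambda>i. pi1 (anti (bar (f i)))) (rev is)"
  by (induction "is") (simp_all add: bar_simps anti_simps pi1_simps)

lemma quadr_H:
  assumes "x \<in> FA n"
  shows "\<one>\<^bsub>H n\<^esub> \<oplus>\<^bsub>H n\<^esub> c \<odot>\<^bsub>H n\<^esub> cls n x \<oplus>\<^bsub>H n\<^esub> d \<odot>\<^bsub>H n\<^esub> (cls n x [^]\<^bsub>H n\<^esub> (2::nat))
    = cls n (1 + free_scal c * x + free_scal d * (x * x))"
  using assms by (simp add: one_H smult_H pow2_H add_H)

text \<open>Bar followed by the anti-involution reverses products, hence the order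
  \<open>rev [1..<Suc n]\<close> of the factors. The words of the Jucys--Murphy elements are
  palindromes, so each of them simply becomes \<open>kU i\<close>.\<close>

lemma beta_pairing:
  assumes "1 \<le> n" "y \<in> FA n"
  shows "hecke_pairing cj q q0 n (beta_B q q0 a yb n) (cls n y) =
    tau (wprod (\<lambda>i. 1 + scal (cj (yb + (q0 - inverse q0))) * kU i + scal (cj (inverse a)) * (kU i * kU i))
      (rev [1..<Suc n]) * pi1 y)"
proof -
  let ?w = "\<lambda>i::nat. rev [1..<i] @ [0] @ [1..<i]"
  let ?x = "\<lambda>i. 1 + free_scal (yb + (q0 - inverse q0)) * fmono (?w i) + free_scal (inverse a) * (fmono (?w i) * fmono (?w i))"
  have w: "set (?w i) \<subseteq> {..<n}" if "i \<in> set [1..<Suc n]" for i using that by auto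
  have x: "?x i \<in> FA n" if "i \<in> set [1..<Suc n]" for i using w[OF that] by (intro FA_add FA_mult) auto
  have "beta_B q q0 a yb n = ring_prod_list (H n) (map (\<lambda>i. cls n (?x i)) [1..<Suc n])"
    unfolding beta_B_def Let_def
  proof (rule arg_cong[of _ _ "ring_prod_list (H n)"], rule map_cong[OF refl])
    fix i assume i: "i \<in> set [1..<Suc n]"
    have "jm_B q q0 n i = cls n (fmono (?w i))" unfolding jm_B_def using w[OF i] by (rule hecke_word_cls)
    then show "\<one>\<^bsub>H n\<^esub> \<oplus>\<^bsub>H n\<^esub> (yb + (q0 - inverse q0)) \<odot>\<^bsub>H n\<^esub> jm_B q q0 n i \<oplus>\<^bsub>H n\<^esub>
        inverse a \<odot>\<^bsub>H n\<^esub> (jm_B q q0 n i [^]\<^bsub>H n\<^esub> (2::nat)) = cls n (?x i)"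
      using quadr_H[OF FA_mono[OF w[OF i]]] by simp
  qed
  also have "\<dots> = cls n (wprod ?x [1..<Suc n])" using x by (rule prod_list_H)
  finally have b: "beta_B q q0 a yb n = cls n (wprod ?x [1..<Suc n])" .
  have e: "pi1 (anti (bar (?x i))) = 1 + scal (cj (yb + (q0 - inverse q0))) * kU i + scal (cj (inverse a)) * (kU i * kU i)" for i
    unfolding bar_simps anti_simps pi1_simps anti_wprod_ui rep1.rho_wprod_gen
    by (simp add: kU_def scal_comm mult.assoc)
  have "wprod ?x [1..<Suc n] \<in> FA n" by (rule FA_wprod) (rule x)
  then show ?thesis
    unfolding b by (simp only: hecke_pairing_cls[OF _ assms(2)] pi1_anti_bar_wprod e)
qed

end

section \<open>The tower of algebras\<close>

context hecke
begin

sublocale UB: braid_gens U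
  by unfold_locales (rule U_far U_braid U_braid0; assumption)+

text \<open>The image under \<open>pi1\<close> of the algebra of rank \<open>n\<close>, as
  \<open>pi1_Alg\<close> and \<open>Alg_pi1\<close> show; generation by sums and products makes
  induction on elements available.\<close>

inductive_set Alg :: "nat \<Rightarrow> 'k lin_op set" for n where
  Alg_scal: "scal c \<in> Alg n"
| Alg_U: "i < n \<Longrightarrow> U i \<in> Alg n"
| Alg_add: "x \<in> Alg n \<Longrightarrow> y \<in> Alg n \<Longrightarrow> x + y \<in> Alg n"
| Alg_mult: "x \<in> Alg n \<Longrightarrow> y \<in> Alg n \<Longrightarrow> x * y \<in> Alg n"

lemma Alg_one: "1 \<in> Alg n"
  using Alg_scal[of 1] by simp

lemma Alg_zero: "0 \<in> Alg n"
  using Alg_scal[of 0] by simp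

lemma Alg_uminus: "x \<in> Alg n \<Longrightarrow> - x \<in> Alg n"
  using Alg_mult[OF Alg_scal[of "- 1"], of x n] by (simp add: scal_minus)

lemma Alg_diff: "x \<in> Alg n \<Longrightarrow> y \<in> Alg n \<Longrightarrow> x - y \<in> Alg n"
  using Alg_add[OF _ Alg_uminus, of x n y] by simp

lemmas Alg_intros [simp, intro] = Alg_scal Alg_U Alg_add Alg_mult Alg_one Alg_zero Alg_uminus Alg_diff

lemma Alg_le: "x \<in> Alg m \<Longrightarrow> m \<le> n \<Longrightarrow> x \<in> Alg n"
  by (induction rule: Alg.induct) auto

lemma Alg_Suc: "x \<in> Alg m \<Longrightarrow> x \<in> Alg (Suc m)"
  by (rule Alg_le) auto

lemma Alg_wprod: "(\<And>i. i \<in> set is \<Longrightarrow> f i \<in> Alg n) \<Longrightarrow> wprod f is \<in> Alg n"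
  by (induction "is") auto

lemma pi1_Alg: "x \<in> FA n \<Longrightarrow> pi1 x \<in> Alg n"
proof (induction rule: FA_induct)
  case (mono c "is")
  have "wprod (\<lambda>i. U i + scal (al i)) is \<in> Alg n" using mono by (intro Alg_wprod) auto
  then show ?case by (simp add: pi1_simps pi1_def pi1.ext_mono pi1.ext_mult pi1.ext_scal)
qed (simp add: pi1_simps)

lemma Alg_pi1: "X \<in> Alg n \<Longrightarrow> \<exists>x\<in>FA n. pi1 x = X"
proof (induction rule: Alg.induct)
  case (Alg_scal c)
  then show ?case by (intro bexI[of _ "free_scal c"]) (auto simp: pi1_simps)
next
  case (Alg_U i)
  then show ?case by (intro bexI[of _ "ui i"]) (auto simp: pi1_ui)
qed (metis FA_add FA_mult pi1_simps(1,4))+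

lemma Alg_commR: "X \<in> Alg n \<Longrightarrow> commR (inverse q - q) (inverse q0 - q0) X"
  by (induction rule: Alg.induct) (auto simp: U_def)

lemma supp_Alg: "X \<in> Alg n \<Longrightarrow> supp (app X (ev sone)) \<subseteq> WS n"
  using Alg_pi1[of X n] rep1.supp_rho by blast

lemma tau_trace: "X \<in> Alg n \<Longrightarrow> Y \<in> Alg n \<Longrightarrow> tau (X * Y) = tau (Y * X)"
proof (induction arbitrary: Y rule: Alg.induct)
  case (Alg_scal c)
  then show ?case by (simp add: scal_comm)
next
  case (Alg_U i)
  then show ?case using tau_opU_comm(1)[OF Alg_commR[OF Alg_U(2)], of i] by (simp add: U_def)
next
  case (Alg_add x y)
  then show ?case by (simp add: algebra_simps)
next
  case (Alg_mult x y)
  have "tau (x * y * Y) = tau (x * (y * Y))" by (simp add: mult.assoc)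
  also have "\<dots> = tau (y * (Y * x))" using Alg_mult by (simp add: mult.assoc)
  also have "\<dots> = tau (Y * x * y)" using Alg_mult by (simp add: mult.assoc)
  finally show ?case by (simp add: mult.assoc)
qed

lemma commute_mult:
  fixes u x y :: "'a::monoid_mult"
  assumes "u * x = x * u" "u * y = y * u"
  shows "u * (x * y) = x * y * u"
  by (metis assms mult.assoc)

lemma scal_left: "x * (scal c * y) = scal c * (x * y)"
  by (metis mult.assoc scal_comm)

lemma kU_eq: "1 \<le> n \<Longrightarrow> kU n = wprod U (rev [1..<n] @ [0..<n])"
  by (simp add: kU_def upt_conv_Cons)

lemma kU_1: "kU (Suc 0) = U 0"
  by (simp add: kU_def)

lemma kU_Suc: "1 \<le> n \<Longrightarrow> kU (Suc n) = U n * kU n * U n"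
  by (simp add: kU_def mult.assoc)

lemma kU_Alg [simp, intro]: "1 \<le> m \<Longrightarrow> m \<le> n \<Longrightarrow> kU m \<in> Alg n"
  unfolding kU_def by (rule Alg_wprod) auto

lemma U_kU_low: "Suc i < n \<Longrightarrow> U i * kU n = kU n * U i"
  using UB.neg_low[of i n n] UB.neg_zero[of n n] by (cases "i = 0") (simp_all add: kU_eq)

lemma Alg_comm:
  assumes "x \<in> Alg n" "\<And>i. i < n \<Longrightarrow> U i * z = z * U i"
  shows "x * z = z * x"
  using assms(1)
proof (induction rule: Alg.induct)
  case (Alg_mult x y)
  then show ?case by (metis mult.assoc)
qed (auto simp: scal_comm assms(2) algebra_simps)

lemma Alg_kU: "x \<in> Alg n \<Longrightarrow> x * kU (Suc n) = kU (Suc n) * x"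
  by (rule Alg_comm) (auto intro: U_kU_low)

lemma Alg_U_far: "x \<in> Alg n \<Longrightarrow> x * U (Suc n) = U (Suc n) * x"
  by (rule Alg_comm) (auto intro: U_far)

lemma Alg_0: "x \<in> Alg 0 \<Longrightarrow> \<exists>c. x = scal c"
  by (induction rule: Alg.induct) (auto simp flip: scal_add scal_mult)

lemma U_braid': "U (Suc m) * U m * U (Suc m) = U m * U (Suc m) * U m" if "1 \<le> m"
  using U_braid[OF that] by simp

lemma U_sandwich_braid:
  assumes "1 \<le> m" "x \<in> Alg m" "y \<in> Alg m"
  shows "U (Suc m) * (x * U m * y) * U (Suc m) = (x * U m) * U (Suc m) * (U m * y)"
proof -
  let ?u = "U m" and ?v = "U (Suc m)"
  have "?v * (x * ?u * y) * ?v = (?v * x) * ?u * (y * ?v)" by (simp only: mult.assoc)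
  also have "\<dots> = (x * ?v) * ?u * (?v * y)" using Alg_U_far assms by simp
  also have "\<dots> = x * (?v * ?u * ?v) * y" by (simp only: mult.assoc)
  also have "\<dots> = (x * ?u) * ?v * (?u * y)" unfolding U_braid'[OF assms(1)] by (simp only: mult.assoc)
  finally show ?thesis .
qed

text \<open>\<open>NN m\<close> is the kernel of the conditional expectation from \<open>Alg (m + 1)\<close> to \<open>Alg m\<close>.\<close>

inductive_set NN :: "nat \<Rightarrow> 'k lin_op set" for m where
  NN_U: "1 \<le> m \<Longrightarrow> x \<in> Alg m \<Longrightarrow> y \<in> Alg m \<Longrightarrow> x * U m * y \<in> NN m"
| NN_k: "x \<in> Alg m \<Longrightarrow> x * kU (Suc m) \<in> NN m"
| NN_add: "x \<in> NN m \<Longrightarrow> y \<in> NN m \<Longrightarrow> x + y \<in> NN m"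

lemma NN_lmult: "x \<in> NN m \<Longrightarrow> z \<in> Alg m \<Longrightarrow> z * x \<in> NN m"
proof (induction rule: NN.induct)
  case (NN_U x y)
  then show ?case using NN.NN_U[of m "z * x" y] by (simp add: mult.assoc)
next
  case (NN_k x)
  then show ?case using NN.NN_k[of "z * x" m] by (simp add: mult.assoc)
qed (simp add: distrib_left NN.NN_add)

lemma NN_rmult: "x \<in> NN m \<Longrightarrow> z \<in> Alg m \<Longrightarrow> x * z \<in> NN m"
proof (induction rule: NN.induct)
  case (NN_U x y)
  then show ?case using NN.NN_U[of m x "y * z"] by (simp add: mult.assoc)
next
  case (NN_k x)
  then show ?case using NN.NN_k[of "x * z" m] Alg_kU[of z m] by (simp add: mult.assoc)
qed (simp add: distrib_right NN.NN_add)

lemma NN_zero: "0 \<in> NN m"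
  using NN_k[of 0 m] by simp

lemma NN_uminus: "x \<in> NN m \<Longrightarrow> - x \<in> NN m"
  using NN_lmult[of x m "- 1"] by simp

lemma NN_diff: "x \<in> NN m \<Longrightarrow> y \<in> NN m \<Longrightarrow> x - y \<in> NN m"
  using NN_add[OF _ NN_uminus, of x m y] by simp

lemma NN_U': "1 \<le> m \<Longrightarrow> x \<in> Alg m \<Longrightarrow> x * U m \<in> NN m" "1 \<le> m \<Longrightarrow> x \<in> Alg m \<Longrightarrow> U m * x \<in> NN m"
  "1 \<le> m \<Longrightarrow> U m \<in> NN m"
  using NN_U[of m x 1] NN_U[of m 1 x] NN_U[of m 1 1] by auto

lemma NN_k': "kU (Suc m) \<in> NN m" "x \<in> Alg m \<Longrightarrow> kU (Suc m) * x \<in> NN m"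
  using NN_k[of 1 m] NN_k[of x m] Alg_kU[of x m] by auto

lemma NN_sandwich: "x \<in> NN m \<Longrightarrow> U (Suc m) * x * U (Suc m) \<in> NN (Suc m)"
proof (induction rule: NN.induct)
  case (NN_U x y)
  have "U (Suc m) * (x * U m * y) * U (Suc m) = (x * U m) * U (Suc m) * (U m * y)"
    using NN_U by (rule U_sandwich_braid)
  also have "\<dots> \<in> NN (Suc m)"
    using NN_U by (intro NN.NN_U Alg_mult Alg_U) (auto intro: Alg_Suc)
  finally show ?case .
next
  case (NN_k x)
  have "U (Suc m) * (x * kU (Suc m)) * U (Suc m) = (U (Suc m) * x) * kU (Suc m) * U (Suc m)"
    by (simp only: mult.assoc)
  also have "\<dots> = x * kU (Suc (Suc m))"
    using Alg_U_far[OF NN_k] by (simp add: kU_Suc) (metis mult.assoc)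
  finally show ?case using NN_k by (auto intro: NN.NN_k Alg_Suc)
qed (simp add: distrib_left distrib_right NN.NN_add)

text \<open>The map \<open>x \<mapsto> u * x * u\<close> with the new generator \<open>u\<close> is
  compatible with the conditional expectations of consecutive ranks. The recursions in
  \<open>Alg_decomp\<close>, \<open>kU_square\<close> and \<open>quadr_TT\<close> rest on
  this.\<close>

lemma sandwich:
  assumes "x - z \<in> NN m" "z \<in> Alg m"
  shows "U (Suc m) * x * U (Suc m) - z \<in> NN (Suc m)"
proof -
  have "U (Suc m) * z * U (Suc m) = z * (U (Suc m) * U (Suc m))"
    using Alg_U_far[OF assms(2)] by (metis mult.assoc)
  then have "U (Suc m) * x * U (Suc m) - z
      = U (Suc m) * (x - z) * U (Suc m) - z * scal (al (Suc m)) * U (Suc m)"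
    by (simp add: U_square algebra_simps)
  then show ?thesis
    using NN_sandwich[OF assms(1)] assms(2) by (auto intro!: NN_diff NN_U' Alg_Suc)
qed

definition SS :: "nat \<Rightarrow> 'k lin_op set" where
  "SS m = {x. \<exists>z\<in>Alg m. x - z \<in> NN m}"

lemma SS_add: "x \<in> SS m \<Longrightarrow> y \<in> SS m \<Longrightarrow> x + y \<in> SS m"
  unfolding SS_def
proof (clarify)
  fix z w assume "z \<in> Alg m" "w \<in> Alg m" "x - z \<in> NN m" "y - w \<in> NN m"
  then show "\<exists>z\<in>Alg m. x + y - z \<in> NN m"
    using NN_add[of "x - z" m "y - w"] by (intro bexI[of _ "z + w"]) (auto simp: algebra_simps)
qed

lemma SS_Alg: "x \<in> Alg m \<Longrightarrow> x \<in> SS m" and SS_NN: "x \<in> NN m \<Longrightarrow> x \<in> SS m"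
  unfolding SS_def using NN_zero[of m] by (auto intro: bexI[of _ x] bexI[of _ 0])

lemma SS_lmult: "x \<in> SS m \<Longrightarrow> z \<in> Alg m \<Longrightarrow> z * x \<in> SS m"
  unfolding SS_def using NN_lmult by (force simp: algebra_simps)

lemma U_kU_Suc:
  assumes "1 \<le> m"
  shows "U m * kU (Suc m) = kU m * U m - scal (al m) * kU (Suc m)"
    and "kU (Suc m) * U m = U m * kU m - scal (al m) * kU (Suc m)"
proof -
  have "U m * kU (Suc m) = (U m * U m) * (kU m * U m)" using assms by (simp add: kU_Suc mult.assoc)
  then show "U m * kU (Suc m) = kU m * U m - scal (al m) * kU (Suc m)"
    using assms by (simp add: U_square kU_Suc algebra_simps)
  have "kU (Suc m) * U m = (U m * kU m) * (U m * U m)" using assms by (simp add: kU_Suc mult.assoc)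
  also have "\<dots> = U m * kU m - scal (al m) * (U m * kU m * U m)"
    by (simp add: U_square right_diff_distrib mult.assoc) (metis mult.assoc scal_comm)
  finally show "kU (Suc m) * U m = U m * kU m - scal (al m) * kU (Suc m)"
    using assms by (simp add: kU_Suc)
qed

text \<open>\<open>SS m\<close> contains \<open>1\<close> and is stable under left multiplication by
  the generators; only the newest one needs an argument. The base case is separate because there the
  new element \<open>kU 1\<close> is the generator \<open>U 0\<close> itself.\<close>

lemma Alg_decomp: "x \<in> Alg (Suc m) \<Longrightarrow> x \<in> SS m"
proof (induction m arbitrary: x)
  case 0
  have "U 0 * s \<in> SS 0" if s: "s \<in> SS 0" for s
  proof -
    obtain z where z: "z \<in> Alg 0" "s - z \<in> NN 0" using s by (auto simp: SS_def)
    have N: "\<exists>c. n = scal c * U 0" if "n \<in> NN 0" for n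
      using that
    proof (induction rule: NN.induct)
      case (NN_k x)
      then show ?case using Alg_0[of x] by (auto simp: kU_1)
    next
      case (NN_add x y)
      then show ?case by (metis scal_add distrib_right)
    qed simp
    obtain c d where "s - z = scal c * U 0" "z = scal d" using N[OF z(2)] Alg_0[OF z(1)] by blast
    then have "s = scal c * U 0 + scal d" by (simp add: diff_eq_eq)
    moreover have "U 0 * (scal c * U 0 + scal d) = scal c * (U 0 * U 0) + scal d * U 0"
      by (simp only: distrib_left scal_comm[of "U 0"] scal_left[of "U 0"])
    ultimately have "U 0 * s = scal c + scal (d - c * al 0) * U 0"
      by (simp add: U_square scal_diff scal_mult algebra_simps)
    also have "\<dots> \<in> SS 0"
      by (intro SS_add SS_Alg SS_NN) (use NN_k[of _ 0] in \<open>auto simp: kU_1\<close>)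
    finally show ?thesis .
  qed
  note U0 = this
  have "\<forall>s\<in>SS 0. x * s \<in> SS 0"
    using 0
  proof (induction rule: Alg.induct)
    case (Alg_scal c)
    then show ?case by (auto intro: SS_lmult)
  next
    case (Alg_U i)
    then show ?case using U0 by simp
  qed (auto simp: distrib_right mult.assoc intro: SS_add)
  then show ?case using SS_Alg[OF Alg_one] by (metis mult_1_right)
next
  case (Suc m)
  let ?u = "U (Suc m)" and ?S = "SS (Suc m)" and ?k = "kU (Suc (Suc m))"
  have uA: "?u * z \<in> ?S" if "z \<in> Alg (Suc m)" for z
    using that by (intro SS_NN NN_U') auto
  \<comment> \<open>The induction hypothesis splits the inner factor \<open>z\<close>, so that
    \<open>sandwich\<close> applies to it.\<close>
  have uu: "?u * z * ?u * w \<in> ?S" if zw: "z \<in> Alg (Suc m)" "w \<in> Alg (Suc m)" for z w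
  proof -
    obtain z0 where z0: "z0 \<in> Alg m" "z - z0 \<in> NN m" using Suc.IH[OF zw(1)] by (auto simp: SS_def)
    have "?u * z * ?u = (?u * z * ?u - z0) + z0" by simp
    then have "?u * z * ?u * w = (?u * z * ?u - z0) * w + z0 * w" by (metis distrib_right)
    also have "\<dots> \<in> ?S"
      using sandwich[OF z0(2,1)] z0 zw(2) by (intro SS_add SS_NN[OF NN_rmult] SS_Alg) (auto intro: Alg_Suc)
    finally show ?thesis .
  qed
  have uN: "?u * x \<in> ?S" if "x \<in> NN (Suc m)" for x
    using that
  proof (induction rule: NN.induct)
    case (NN_U x y)
    then show ?case using uu[of x y] by (simp add: mult.assoc)
  next
    case (NN_k x)
    have "?u * (x * ?k) = (?u * ?k) * x" using Alg_kU[OF NN_k] by (simp add: mult.assoc)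
    also have "\<dots> = kU (Suc m) * ?u * x - scal (al (Suc m)) * ?k * x"
      by (simp add: U_kU_Suc algebra_simps)
    also have "\<dots> = kU (Suc m) * ?u * x - scal (al (Suc m)) * (?k * x)" by (simp only: mult.assoc)
    also have "\<dots> \<in> ?S"
      using NN_k by (intro SS_NN NN_diff NN.NN_U NN_lmult NN_k') auto
    finally show ?case .
  qed (simp add: distrib_left SS_add)
  have US: "?u * s \<in> ?S" if s: "s \<in> ?S" for s
  proof -
    obtain z where z: "z \<in> Alg (Suc m)" "s - z \<in> NN (Suc m)" using s by (auto simp: SS_def)
    have "?u * s = ?u * (s - z) + ?u * z" by (simp add: algebra_simps)
    then show ?thesis using uN[OF z(2)] uA[OF z(1)] by (simp only: SS_add)
  qed
  have "\<forall>s\<in>?S. x * s \<in> ?S"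
    using Suc.prems
  proof (induction rule: Alg.induct)
    case (Alg_scal c)
    then show ?case by (auto intro: SS_lmult)
  next
    case (Alg_U i)
    then show ?case using US by (cases "i = Suc m") (auto intro: SS_lmult)
  qed (auto simp: distrib_right mult.assoc intro: SS_add)
  then show ?case using SS_Alg[OF Alg_one] by (metis mult_1_right)
qed

text \<open>\<open>tau\<close> reads the coefficient at the identity. By the trace property the
  first kind of element contributes the coefficient of \<open>y * x\<close> at the reflection
  \<open>m\<close>, which lies outside rank \<open>m\<close>. The second kind is supported on
  elements sending \<open>- (m + 1)\<close> to \<open>m + 1\<close>.\<close>

lemma tau_NN: "x \<in> NN m \<Longrightarrow> tau x = 0"
proof (induction rule: NN.induct)
  case (NN_U x y)
  have yx: "y * x \<in> Alg m" using NN_U by auto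
  have "rmul sone m \<notin> WS m"
  proof
    assume "rmul sone m \<in> WS m"
    then have "sp (rmul sone m) (int m + 1) = int m + 1" by (rule WS_fix) auto
    then show False using refl_B_hi[of m] by (simp add: hi_def lo_def split: if_splits)
  qed
  then have "app (y * x) (ev sone) (rmul sone m) = 0" using supp_Alg[OF yx] by (auto simp: supp_def)
  then have "tau (U m * (y * x)) = 0"
    using tau_opU_comm(2)[OF Alg_commR[OF yx], of m] by (simp add: U_def)
  moreover have "tau (U m * (y * x)) = tau (U m * y * x)" by (simp add: mult.assoc)
  moreover have "tau (x * (U m * y)) = tau (U m * y * x)"
    by (rule tau_trace[OF Alg_Suc[OF NN_U(2)] Alg_mult[OF Alg_U[OF lessI] Alg_Suc[OF NN_U(3)]]])
  ultimately show ?case by (metis mult.assoc)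
next
  case (NN_k x)
  let ?n = "Suc m"
  let ?v = "app x (ev sone)"
  have "supp ?v \<subseteq> {w \<in> WS ?n. sp w (int ?n) = int ?n}"
  proof
    fix w assume "w \<in> supp ?v"
    then have w: "w \<in> WS m" using supp_Alg[OF NN_k] by blast
    then have "w \<in> WS ?n" using rep1.WS_le[of m ?n] by auto
    moreover have "sp w (int ?n) = int ?n" using w by (rule WS_fix) simp
    ultimately show "w \<in> {w \<in> WS ?n. sp w (int ?n) = int ?n}" by simp
  qed
  then have "supp (app (wprod U (coset_word ?n (- int ?n))) ?v) \<subseteq> {w \<in> WS ?n. sp w (- int ?n) = int ?n}"
    unfolding U_def by (rule supp_coset_word) (simp add: idx_def)
  moreover have "coset_word ?n (- int ?n) = rev [1..<?n] @ [0..<?n]"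
    unfolding coset_word_def by (simp only: minus_minus nat_int) simp
  moreover have "kU ?n = wprod U (rev [1..<?n] @ [0..<?n])" by (rule kU_eq) simp
  ultimately have "supp (app (kU ?n) ?v) \<subseteq> {w \<in> WS ?n. sp w (- int ?n) = int ?n}"
    by (simp only: kU_eq[of ?n] le_SucI le0 One_nat_def Suc_le_mono)
  moreover have "sone \<notin> {w \<in> WS ?n. sp w (- int ?n) = int ?n}" by simp
  ultimately have "app (kU ?n) ?v sone = 0" unfolding supp_def by blast
  then have "tau (kU ?n * x) = 0" by (simp add: tau_def)
  then show ?case by (simp add: Alg_kU[OF NN_k])
qed simp


section \<open>The trace \<open>h \<mapsto> \<langle>\<beta>\<^sub>n, h\<rangle>\<close> is a Markov trace\<close>

text \<open>The polynomial \<open>f\<close> of the overview, with \<open>c\<close> in the role of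
  \<open>y - \<alpha>\<^sub>0\<close>; the argument order \<open>a\<close>, \<open>c\<close> puts
  the leading coefficient first.\<close>

definition quadr :: "'k \<Rightarrow> 'k \<Rightarrow> 'k lin_op \<Rightarrow> 'k lin_op" where
  "quadr a c k = 1 + scal c * k + scal a * (k * k)"

definition beta :: "'k \<Rightarrow> 'k \<Rightarrow> nat \<Rightarrow> 'k lin_op" where
  "beta a c n = wprod (\<lambda>i. quadr a c (kU i)) (rev [1..<Suc n])"

lemma beta_0 [simp]: "beta a c 0 = 1"
  by (simp add: beta_def)

lemma beta_Suc: "beta a c (Suc n) = quadr a c (kU (Suc n)) * beta a c n"
  by (simp add: beta_def)

lemma quadr_Alg: "k \<in> Alg n \<Longrightarrow> quadr a c k \<in> Alg n"
  by (auto simp: quadr_def)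

lemma beta_Alg: "beta a c n \<in> Alg n"
  unfolding beta_def by (rule Alg_wprod) (auto intro!: quadr_Alg)

lemma quadr_comm:
  assumes "x * k = k * x"
  shows "x * quadr a c k = quadr a c k * x"
proof -
  have "x * (k * k) = k * (k * x)" using assms by (metis mult.assoc)
  then show ?thesis
    unfolding quadr_def
    by (simp only: distrib_left distrib_right scal_left[of x] mult.assoc mult_1_left mult_1_right assms)
qed

text \<open>The two Jucys--Murphy elements commute, so the product is a polynomial in their sum
  \<open>s\<close> and product \<open>p\<close>, and \<open>U m\<close> commutes with both of
  these.\<close>

lemma quadr_pair_comm:
  assumes "1 \<le> m"
  shows "U m * (quadr a c (kU (Suc m)) * quadr a c (kU m)) = quadr a c (kU (Suc m)) * quadr a c (kU m) * U m"
proof -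
  let ?u = "U m" and ?k = "kU m" and ?l = "kU (Suc m)"
  define s p where "s = ?l + ?k" and "p = ?l * ?k"
  have kl: "?k * ?l = ?l * ?k" using Alg_kU[of ?k m] assms by auto
  have lu: "?l * ?u = ?u * ?k - scal (al m) * ?l" and ul: "?u * ?l = ?k * ?u - scal (al m) * ?l"
    using U_kU_Suc[OF assms] by auto
  have us: "?u * s = s * ?u" unfolding s_def by (simp add: distrib_left distrib_right lu ul)
  have up: "?u * p = p * ?u"
  proof -
    have "?u * p = (?u * ?l) * ?k" unfolding p_def by (simp only: mult.assoc)
    also have "\<dots> = ?k * (?u * ?k) - scal (al m) * (?k * ?l)"
      unfolding ul by (simp only: left_diff_distrib mult.assoc kl)
    also have "\<dots> = ?k * (?u * ?k - scal (al m) * ?l)"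
      by (simp only: right_diff_distrib scal_left[of ?k])
    also have "\<dots> = ?k * ?l * ?u" unfolding lu[symmetric] by (simp only: mult.assoc)
    also have "\<dots> = p * ?u" unfolding p_def kl ..
    finally show ?thesis .
  qed
  have "quadr a c ?l * quadr a c ?k = 1 + scal c * s + scal (c * c) * p + scal a * (s * s - 2 * p)
      + scal (c * a) * (p * s) + scal (a * a) * (p * p)"
  proof -
    have ss: "s * s - 2 * p = ?l * ?l + ?k * ?k"
      unfolding s_def p_def by (simp add: algebra_simps kl mult_2)
    have ps: "p * s = ?l * (?l * ?k) + ?l * (?k * ?k)"
      unfolding s_def p_def by (simp add: distrib_left mult.assoc kl)
    have pp: "p * p = ?l * (?l * (?k * ?k))"
      unfolding p_def by (metis kl mult.assoc)
    have ac: "scal a * (scal c * z) = scal c * (scal a * z)" for z by (rule scal_left)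
    show ?thesis
      unfolding ss ps pp quadr_def unfolding s_def p_def
      by (simp add: distrib_left distrib_right mult.assoc scal_left[of ?l] scal_left[of ?k] scal_mult ac)
  qed
  moreover have "?u * (1 + scal c * s + scal (c * c) * p + scal a * (s * s - 2 * p)
      + scal (c * a) * (p * s) + scal (a * a) * (p * p))
    = (1 + scal c * s + scal (c * c) * p + scal a * (s * s - 2 * p)
      + scal (c * a) * (p * s) + scal (a * a) * (p * p)) * ?u"
  proof -
    have cs: "?u * (scal d * z) = scal d * z * ?u" if "?u * z = z * ?u" for d z
      using that by (metis mult.assoc scal_comm)
    have "?u * (s * s - 2 * p) = (s * s - 2 * p) * ?u"
    proof -
      have "?u * (s * s) = s * s * ?u" using us by (metis mult.assoc)
      then show ?thesis
        by (simp only: right_diff_distrib left_diff_distrib mult_2 distrib_left distrib_right up)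
    qed
    moreover have "?u * (p * s) = p * s * ?u" "?u * (p * p) = p * p * ?u"
      using us up by (metis mult.assoc)+
    ultimately show ?thesis
      using us up by (simp only: distrib_left distrib_right cs mult_1_left mult_1_right)
  qed
  ultimately show ?thesis by simp
qed

text \<open>\<open>U i\<close> commutes with every factor except possibly those of
  \<open>kU i\<close> and \<open>kU (i + 1)\<close>, and \<open>quadr_pair_comm\<close> handles
  these two together.\<close>

lemma beta_U: "i < n \<Longrightarrow> U i * beta a c n = beta a c n * U i"
proof (induction n)
  case 0
  then show ?case by simp
next
  case (Suc n)
  show ?case
  proof (cases "i < n")
    case True
    have "U i * quadr a c (kU (Suc n)) = quadr a c (kU (Suc n)) * U i"
      using True by (intro quadr_comm U_kU_low) simp
    then show ?thesis using Suc.IH[OF True] unfolding beta_Suc by (rule commute_mult)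
  next
    case False
    then have i: "i = n" using Suc.prems by simp
    show ?thesis
    proof (cases n)
      case 0
      then show ?thesis unfolding i beta_Suc using quadr_comm[of "U 0" "U 0"] by (simp add: kU_1)
    next
      case (Suc m)
      have far: "U n * beta a c m = beta a c m * U n"
        using beta_Alg[of a c m] Alg_U_far[of "beta a c m" m] Suc by simp
      have "U n * (quadr a c (kU (Suc n)) * quadr a c (kU n)) = quadr a c (kU (Suc n)) * quadr a c (kU n) * U n"
        using Suc by (intro quadr_pair_comm) simp
      then have "U n * (quadr a c (kU (Suc n)) * quadr a c (kU n) * beta a c m)
          = quadr a c (kU (Suc n)) * quadr a c (kU n) * beta a c m * U n"
        using far by (rule commute_mult)
      moreover have "beta a c (Suc n) = quadr a c (kU (Suc n)) * quadr a c (kU n) * beta a c m"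
        unfolding beta_Suc by (simp add: Suc beta_Suc mult.assoc)
      ultimately show ?thesis by (simp only: i)
    qed
  qed
qed

lemma beta_central: "x \<in> Alg n \<Longrightarrow> x * beta a c n = beta a c n * x"
  by (rule Alg_comm[OF _ beta_U])

definition theta :: "'k \<Rightarrow> 'k \<Rightarrow> nat \<Rightarrow> 'k lin_op \<Rightarrow> 'k" where
  "theta a c n x = tau (beta a c n * x)"

lemma theta_trace:
  assumes "x \<in> Alg n" "y \<in> Alg n"
  shows "theta a c n (x * y) = theta a c n (y * x)"
proof -
  have "tau (beta a c n * (x * y)) = tau (x * (beta a c n * y))"
    using beta_central[OF assms(1)] by (metis mult.assoc)
  also have "\<dots> = tau (beta a c n * y * x)"
    using assms beta_Alg by (intro tau_trace) auto
  finally show ?thesis by (simp add: theta_def mult.assoc)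
qed

text \<open>The step in the rank for all three evaluations, with \<open>z\<close> equal to
  \<open>1\<close>, \<open>U n\<close> and \<open>TT (Suc n)\<close>. Here \<open>d\<close> is the
  expectation of \<open>f(k) * z\<close>; the new factor \<open>f(k)\<close> commutes past rank
  \<open>n\<close>, and \<open>tau\<close> kills the remainder.\<close>

lemma theta_Suc:
  assumes x: "x \<in> Alg n" and z: "quadr a c (kU (Suc n)) * z - scal d \<in> NN n"
  shows "theta a c (Suc n) (x * z) = d * theta a c n x"
proof -
  let ?f = "quadr a c (kU (Suc n))" and ?b = "beta a c n"
  have bx: "?b * x \<in> Alg n" using x beta_Alg by auto
  have "beta a c (Suc n) * (x * z) = ?f * (?b * x) * z" by (simp only: beta_Suc mult.assoc)
  also have "?f * (?b * x) = (?b * x) * ?f"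
    using quadr_comm[OF Alg_kU[OF bx]] by simp
  also have "(?b * x) * ?f * z = (?b * x) * (?f * z - scal d) + scal d * (?b * x)"
    by (simp only: right_diff_distrib mult.assoc[of "?b * x"] scal_comm[of "?b * x"] diff_add_cancel)
  finally have "beta a c (Suc n) * (x * z) = (?b * x) * (?f * z - scal d) + scal d * (?b * x)" .
  then show ?thesis using tau_NN[OF NN_lmult[OF z bx]] by (simp add: theta_def)
qed

lemma NN_scal: "x \<in> NN m \<Longrightarrow> scal c * x \<in> NN m"
  by (simp add: NN_lmult)

text \<open>In rank one this is the quadratic relation of \<open>U 0\<close>. One rank up the square
  differs from \<open>u * (k * k) * u\<close> by elements of \<open>NN\<close>, so
  \<open>sandwich\<close> carries the value \<open>1\<close> along.\<close>

lemma kU_square: "kU (Suc m) * kU (Suc m) - 1 \<in> NN m"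
proof (induction m)
  case 0
  show ?case using NN_uminus[OF NN_scal[OF NN_k'(1)[of 0], of "al 0"]] by (simp add: kU_1 U_square)
next
  case (Suc m)
  let ?u = "U (Suc m)" and ?k = "kU (Suc m)" and ?l = "kU (Suc (Suc m))" and ?c = "scal (al (Suc m))"
  have lu: "?l * ?u = ?u * ?k - ?c * ?l" using U_kU_Suc[of "Suc m"] by simp
  have kA: "?k \<in> Alg (Suc m)" by auto
  have "?l * ?l = (?l * ?u) * ?k * ?u" using kU_Suc[of "Suc m"] by (simp add: mult.assoc)
  also have "\<dots> = ?u * (?k * ?k) * ?u - ?c * (?l * ?k * ?u)"
    unfolding lu by (simp add: algebra_simps)
  also have "?l * ?k * ?u = ?k * (?l * ?u)" using Alg_kU[OF kA] by (metis mult.assoc)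
  also have "\<dots> = ?k * ?u * ?k - ?k * (?c * ?l)" unfolding lu by (simp add: algebra_simps)
  finally have "?l * ?l - 1 = (?u * (?k * ?k) * ?u - 1) - ?c * (?k * ?u * ?k - ?k * (?c * ?l))"
    by simp
  also have "\<dots> \<in> NN (Suc m)"
    by (intro NN_diff[OF sandwich[OF Suc Alg_one] NN_scal[OF NN_diff]] NN_U
        NN_lmult[OF NN_scal[OF NN_k'(1)]] kA) auto
  finally show ?case .
qed

lemma quadr_one: "quadr a c (kU (Suc m)) * 1 - scal (1 + a) \<in> NN m"
proof -
  have "quadr a c (kU (Suc m)) * 1 - scal (1 + a)
      = scal c * kU (Suc m) + scal a * (kU (Suc m) * kU (Suc m) - 1)"
    by (simp add: quadr_def scal_add algebra_simps)
  then show ?thesis using kU_square by (auto intro: NN_add NN_scal NN_k')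
qed

lemma kU_square_U:
  assumes "1 \<le> m"
  shows "kU (Suc m) * kU (Suc m) * U m - scal (- al m) \<in> NN m"
proof -
  let ?u = "U m" and ?k = "kU m" and ?l = "kU (Suc m)" and ?c = "scal (al m)"
  have lu: "?l * ?u = ?u * ?k - ?c * ?l" using U_kU_Suc[OF assms] by simp
  have "?l * ?l * ?u = ?l * (?l * ?u)" by (simp add: mult.assoc)
  also have "\<dots> = ?l * (?u * ?k - ?c * ?l)" by (simp only: lu)
  also have "\<dots> = (?l * ?u) * ?k - ?c * (?l * ?l)"
    by (simp only: right_diff_distrib mult.assoc scal_left[of ?l])
  also have "\<dots> = ?u * (?k * ?k) - ?c * (?l * ?k) - ?c * (?l * ?l)"
    by (simp only: lu left_diff_distrib mult.assoc)
  finally have "?l * ?l * ?u - scal (- al m) = ?u * (?k * ?k) - ?c * (?l * ?k) - ?c * (?l * ?l - 1)"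
    by (simp add: algebra_simps scal_minus)
  also have "\<dots> \<in> NN m"
    using assms NN_U'(2)[of m "?k * ?k"] NN_k'(2)[of ?k m] kU_square[of m]
    by (intro NN_diff[OF NN_diff[OF _ NN_scal] NN_scal]) auto
  finally show ?thesis .
qed

lemma kU_U_NN: "1 \<le> m \<Longrightarrow> kU (Suc m) * U m \<in> NN m"
  unfolding U_kU_Suc(2) by (intro NN_diff NN_scal NN_U' NN_k') auto

text \<open>Adding \<open>al m\<close> times the value \<open>1 + a\<close> from
  \<open>quadr_one\<close> gives \<open>al m\<close> for the generator
  \<open>U m + scal (al m)\<close>: this is the Markov constant \<open>\<mu>\<close>, and
  \<open>a\<close> has cancelled.\<close>

lemma quadr_U:
  assumes "1 \<le> m"
  shows "quadr a c (kU (Suc m)) * U m - scal (- a * al m) \<in> NN m"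
proof -
  let ?l = "kU (Suc m)"
  have "quadr a c ?l * U m - scal (- a * al m)
      = U m + scal c * (?l * U m) + scal a * (?l * ?l * U m - scal (- al m))"
    by (simp add: quadr_def algebra_simps flip: scal_mult)
  also have "\<dots> \<in> NN m"
    by (rule NN_add[OF NN_add[OF NN_U'(3)[OF assms] NN_scal[OF kU_U_NN[OF assms]]]
          NN_scal[OF kU_square_U[OF assms]]])
  finally show ?thesis .
qed

text \<open>The operator images of the \<open>T\<^sub>n\<close>: \<open>U i + scal (al i)\<close> is
  \<open>t\<^sub>i\<close>, so each step multiplies by \<open>t\<close> on the left and by its
  inverse on the right.\<close>

fun TT :: "nat \<Rightarrow> 'k lin_op" where
  "TT 0 = 1"
| "TT (Suc 0) = U 0 + scal (al 0)"
| "TT (Suc (Suc n)) = (U (Suc n) + scal (al (Suc n))) * TT (Suc n) * U (Suc n)"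

lemma TT_Alg: "TT n \<in> Alg n"
  by (induction n rule: TT.induct) (auto intro: Alg_Suc)

text \<open>In rank one the value is \<open>\<alpha>\<^sub>0 + c\<close>, which explains the choice
  \<open>c = y - \<alpha>\<^sub>0\<close>. One rank up, with \<open>\<alpha> = al (Suc m)\<close>,
  the new element is \<open>(u + \<alpha>) * T * u\<close>. Modulo \<open>NN\<close> its part
  \<open>u * T * u\<close> contributes
  \<open>u * f(k) * T * u + a * \<alpha> * \<alpha> * T\<close>, and its part
  \<open>\<alpha> * T * u\<close> contributes \<open>- a * \<alpha> * \<alpha> * T\<close>. The
  extra terms cancel and \<open>sandwich\<close> preserves the value \<open>y\<close>.\<close>

lemma quadr_TT: "quadr a (y - al 0) (kU (Suc m)) * TT (Suc m) - scal y \<in> NN m"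
proof (induction m)
  case 0
  let ?d = "al 0" and ?c = "y - al 0"
  have f: "quadr a ?c (U 0) = scal (1 + a) + scal (?c - a * ?d) * U 0"
    by (simp add: quadr_def U_square scal_add scal_diff scal_mult algebra_simps)
  have "quadr a ?c (U 0) * (U 0 + scal ?d)
      = scal (1 + a) * (U 0 + scal ?d) + scal (?c - a * ?d) * (U 0 * (U 0 + scal ?d))"
    unfolding f by (simp only: distrib_right mult.assoc)
  also have "\<dots> = scal (1 + a) * U 0 + scal ((1 + a) * ?d + (?c - a * ?d))"
    unfolding U_inv by (simp only: distrib_left scal_mult scal_add mult_1_right add.assoc)
  also have "(1 + a) * ?d + (?c - a * ?d) = y" by (simp add: algebra_simps)
  finally show ?case using NN_scal[OF NN_k'(1)[of 0], of "1 + a"] by (simp add: kU_1)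
next
  case (Suc m)
  let ?u = "U (Suc m)" and ?k = "kU (Suc m)" and ?l = "kU (Suc (Suc m))" and ?d = "al (Suc m)"
    and ?T = "TT (Suc m)" and ?c = "y - al 0"
  let ?f = "quadr a ?c ?l" and ?g = "quadr a ?c ?k" and ?D = "scal (al (Suc m))"
  \<comment> \<open>The error terms: each is an element of the smaller algebra times something
    already known to lie in \<open>NN\<close>.\<close>
  define X Y Z where "X = ?T * (?l * ?u)" and "Y = ?k * ?T * (?l * ?u)"
    and "Z = ?T * (?l * ?l * ?u - scal (- ?d))"
  have TA: "?T \<in> Alg (Suc m)" and kA: "?k \<in> Alg (Suc m)" by (auto intro: TT_Alg)
  have lT: "?l * ?T = ?T * ?l" "?l * (?k * ?T) = ?k * ?T * ?l"
    using Alg_kU[OF TA] Alg_kU[OF Alg_mult[OF kA TA]] by auto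
  have lu: "?l * ?u = ?u * ?k - ?D * ?l" using U_kU_Suc[of "Suc m"] by simp
  have NN: "X \<in> NN (Suc m)" "Y \<in> NN (Suc m)" "Z \<in> NN (Suc m)"
    unfolding X_def Y_def Z_def using TA kA by (intro NN_lmult kU_U_NN kU_square_U; auto)+
  have e1: "?l * ?u * ?T * ?u = ?u * ?k * ?T * ?u - ?D * X"
  proof -
    have "?l * ?u * ?T * ?u = ?u * ?k * ?T * ?u - ?D * ((?l * ?T) * ?u)"
      by (simp only: lu left_diff_distrib mult.assoc)
    then show ?thesis by (simp only: lT X_def mult.assoc)
  qed
  have e2: "?l * ?l * ?u * ?T * ?u = ?u * ?k * ?k * ?T * ?u - ?D * Y - ?D * Z + scal (?d * ?d) * ?T"
  proof -
    have "?l * ?l * ?u * ?T * ?u = ?l * (?l * ?u * ?T * ?u)" by (simp only: mult.assoc)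
    also have "\<dots> = ?l * ?u * ?k * ?T * ?u - ?D * (?l * X)"
      unfolding e1 by (simp only: right_diff_distrib mult.assoc scal_left[of ?l])
    also have "?l * X = ?T * (?l * ?l * ?u)" unfolding X_def by (metis lT(1) mult.assoc)
    also have "\<dots> = Z + ?T * scal (- ?d)" unfolding Z_def by (simp only: right_diff_distrib diff_add_cancel)
    also have "?T * scal (- ?d) = scal (- ?d) * ?T" by (rule scal_comm)
    also have "?l * ?u * ?k * ?T * ?u = ?u * ?k * ?k * ?T * ?u - ?D * Y"
    proof -
      have "?l * ?u * ?k * ?T * ?u = ?u * ?k * ?k * ?T * ?u - ?D * ((?l * (?k * ?T)) * ?u)"
        by (simp only: lu left_diff_distrib mult.assoc)
      then show ?thesis by (simp only: lT Y_def mult.assoc)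
    qed
    finally show ?thesis by (simp add: distrib_left right_diff_distrib scal_mult scal_minus mult.assoc)
  qed
  have A: "?f * (?u * ?T * ?u) - ?u * (?g * ?T) * ?u - scal (a * ?d * ?d) * ?T
      = scal a * (- (?D * Y) - ?D * Z) - scal ?c * (?D * X)"
  proof -
    have "?f * (?u * ?T * ?u) = ?u * ?T * ?u + scal ?c * (?l * ?u * ?T * ?u) + scal a * (?l * ?l * ?u * ?T * ?u)"
      unfolding quadr_def by (simp add: distrib_right mult.assoc)
    moreover have "?u * (?g * ?T) * ?u = ?u * ?T * ?u + scal ?c * (?u * ?k * ?T * ?u) + scal a * (?u * ?k * ?k * ?T * ?u)"
    proof -
      have *: "?u * (scal b * z) = scal b * (?u * z)" for b z by (metis scal_comm mult.assoc)
      show ?thesis unfolding quadr_def by (simp only: distrib_right distrib_left mult.assoc * mult_1_left)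
    qed
    moreover have "scal (a * ?d * ?d) * ?T = scal a * (scal (?d * ?d) * ?T)"
      by (simp only: scal_mult mult.assoc)
    ultimately show ?thesis unfolding e1 e2 by (simp add: distrib_left right_diff_distrib)
  qed
  have B: "?f * (?T * ?u) - scal (- a * ?d) * ?T = ?T * (?f * ?u - scal (- a * ?d))"
  proof -
    have "?f * ?T = ?T * ?f" using quadr_comm[OF lT(1)[symmetric]] by simp
    then show ?thesis by (simp only: right_diff_distrib scal_comm[of ?T] flip: mult.assoc)
  qed
  have "?f * TT (Suc (Suc m)) - scal y
      = (?f * (?u * ?T * ?u) - ?u * (?g * ?T) * ?u - scal (a * ?d * ?d) * ?T)
        + (?u * (?g * ?T) * ?u - scal y) + ?D * (?f * (?T * ?u) - scal (- a * ?d) * ?T)"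
  proof -
    have *: "?f * (?D * z) = ?D * (?f * z)" for z by (metis scal_comm mult.assoc)
    have "?D * (scal (- a * ?d) * ?T) = - (scal (a * ?d * ?d) * ?T)"
    proof -
      have "?D * (scal (- a * ?d) * ?T) = scal (?d * (- a * ?d)) * ?T" by (simp only: scal_mult mult.assoc)
      also have "?d * (- a * ?d) = - (a * ?d * ?d)" by simp
      finally show ?thesis by (simp only: scal_minus mult_minus_left)
    qed
    moreover have "?f * TT (Suc (Suc m)) = ?f * (?u * ?T * ?u) + ?D * (?f * (?T * ?u))"
      by (simp add: distrib_left distrib_right mult.assoc *)
    ultimately show ?thesis by (simp only: right_diff_distrib) simp
  qed
  also have "\<dots> \<in> NN (Suc m)"
    unfolding A B
    by (rule NN_add[OF NN_add[OF NN_diff[OF NN_scal[OF NN_diff[OF NN_uminus[OF NN_scal[OF NN(2)]]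
            NN_scal[OF NN(3)]]] NN_scal[OF NN_scal[OF NN(1)]]] sandwich[OF Suc Alg_scal]]
          NN_scal[OF NN_lmult[OF quadr_U TA]]]) simp
  finally show ?case .
qed

primrec TP :: "nat \<Rightarrow> 'k lin_op" where
  "TP 0 = 1"
| "TP (Suc n) = TP n * TT (Suc n)"

lemma TP_Alg: "TP n \<in> Alg n"
  by (induction n) (auto intro: Alg_Suc TT_Alg)

lemma theta_TP: "theta a (y - al 0) n (TP n) = y ^ n"
proof (induction n)
  case 0
  then show ?case by (simp add: theta_def)
next
  case (Suc n)
  then show ?case using theta_Suc[OF TP_Alg quadr_TT] by simp
qed

lemma theta_U1: "x \<in> Alg n \<Longrightarrow> theta a c (Suc n) x = (1 + a) * theta a c n x"
  using theta_Suc[OF _ quadr_one, of x] by simp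

lemma theta_U: "x \<in> Alg n \<Longrightarrow> 1 \<le> n \<Longrightarrow> theta a c (Suc n) (x * U n) = - a * al n * theta a c n x"
  by (rule theta_Suc[OF _ quadr_U])

lemma theta_add: "theta a c n (x + y) = theta a c n x + theta a c n y"
  by (simp add: theta_def distrib_left)

lemma theta_scal: "theta a c n (scal d * x) = d * theta a c n x"
  by (simp add: theta_def scal_comm[of "beta a c n"] mult.assoc flip: mult.assoc[of "beta a c n" "scal d"])


section \<open>Uniqueness of Markov traces\<close>

definition trace_on :: "nat \<Rightarrow> ('k lin_op \<Rightarrow> 'k) \<Rightarrow> bool" where
  "trace_on n D \<longleftrightarrow>
    (\<forall>x\<in>Alg n. \<forall>y\<in>Alg n. D (x + y) = D x + D y \<and> D (x * y) = D (y * x)) \<and>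
    (\<forall>c. \<forall>x\<in>Alg n. D (scal c * x) = c * D x)"

lemma trace_onD:
  assumes "trace_on n D"
  shows "x \<in> Alg n \<Longrightarrow> y \<in> Alg n \<Longrightarrow> D (x + y) = D x + D y"
    and "x \<in> Alg n \<Longrightarrow> y \<in> Alg n \<Longrightarrow> D (x * y) = D (y * x)"
    and "x \<in> Alg n \<Longrightarrow> D (scal c * x) = c * D x"
  using assms by (auto simp: trace_on_def)

lemma trace_on_diff:
  assumes "trace_on n D" "x \<in> Alg n" "y \<in> Alg n"
  shows "D (x - y) = D x - D y"
  using trace_onD(1)[OF assms(1), of "x - y" y] assms by simp

text \<open>\<open>MM m\<close> is the part of \<open>Alg (m + 1)\<close> on which a Markov trace is determined by its
  restriction to \<open>Alg m\<close>.\<close>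

inductive_set MM :: "nat \<Rightarrow> 'k lin_op set" for m where
  MM_Alg: "x \<in> Alg m \<Longrightarrow> x \<in> MM m"
| MM_U: "1 \<le> m \<Longrightarrow> x \<in> Alg m \<Longrightarrow> y \<in> Alg m \<Longrightarrow> x * U m * y \<in> MM m"
| MM_add: "x \<in> MM m \<Longrightarrow> y \<in> MM m \<Longrightarrow> x + y \<in> MM m"

lemma MM_lmult: "x \<in> MM m \<Longrightarrow> z \<in> Alg m \<Longrightarrow> z * x \<in> MM m"
proof (induction rule: MM.induct)
  case (MM_U x y)
  then show ?case using MM.MM_U[of m "z * x" y] by (simp add: mult.assoc)
qed (simp_all add: distrib_left MM.MM_add MM.MM_Alg)

lemma MM_Alg_Suc: "x \<in> MM m \<Longrightarrow> x \<in> Alg (Suc m)"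
  by (induction rule: MM.induct) (auto intro: Alg_Suc)

lemma MM_sandwich: "x \<in> MM m \<Longrightarrow> U (Suc m) * x * U (Suc m) \<in> MM (Suc m)"
proof (induction rule: MM.induct)
  case (MM_Alg x)
  have "U (Suc m) * x * U (Suc m) = x * (U (Suc m) * U (Suc m))"
    using Alg_U_far[OF MM_Alg] by (metis mult.assoc)
  also have "\<dots> = x + (x * scal (- al (Suc m))) * U (Suc m) * 1"
    by (simp add: U_square algebra_simps scal_minus)
  also have "\<dots> \<in> MM (Suc m)"
    by (rule MM.MM_add[OF MM.MM_Alg MM.MM_U])
      (use MM_Alg in \<open>simp_all add: Alg_Suc Alg_mult\<close>)
  finally show ?case .
next
  case (MM_U x y)
  have "U (Suc m) * (x * U m * y) * U (Suc m) = (x * U m) * U (Suc m) * (U m * y)"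
    using MM_U by (rule U_sandwich_braid)
  also have "\<dots> \<in> MM (Suc m)"
    using MM_U by (intro MM.MM_U Alg_mult Alg_U) (auto intro: Alg_Suc)
  finally show ?case .
qed (simp add: distrib_left distrib_right MM.MM_add)

text \<open>Writing each \<open>t\<close> in the left half of \<open>T\<close> as
  \<open>u + \<alpha>\<close> produces the Jucys--Murphy element plus terms in \<open>MM\<close>.
  This is how the prescribed values on products of the \<open>T\<^sub>i\<close> give information
  about \<open>k\<close>.\<close>

lemma TT_kU: "TT (Suc m) - kU (Suc m) \<in> MM m"
proof (induction m)
  case 0
  show ?case by (simp add: kU_1 MM_Alg)
next
  case (Suc m)
  let ?u = "U (Suc m)"
  have "TT (Suc (Suc m)) - kU (Suc (Suc m))
      = ?u * (TT (Suc m) - kU (Suc m)) * ?u + (scal (al (Suc m)) * TT (Suc m)) * ?u * 1"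
    by (simp add: kU_Suc algebra_simps)
  also have "\<dots> \<in> MM (Suc m)"
    using MM_sandwich[OF Suc] TT_Alg by (intro MM_add MM_U) auto
  finally show ?case .
qed

lemma trace_on_MM:
  assumes D: "trace_on (Suc m) D" and "\<And>x. x \<in> Alg m \<Longrightarrow> D x = 0"
    and "\<And>x. x \<in> Alg m \<Longrightarrow> 1 \<le> m \<Longrightarrow> D (x * U m) = 0"
  shows "x \<in> MM m \<Longrightarrow> D x = 0"
proof (induction rule: MM.induct)
  case (MM_U x y)
  have "D (x * U m * y) = D (y * (x * U m))"
    using MM_U by (intro trace_onD(2)[OF D]) (auto intro: Alg_Suc)
  then show ?case using assms(3)[of "y * x"] MM_U by (simp add: mult.assoc)
next
  case (MM_add x y)
  then show ?case using trace_onD(1)[OF D] MM_Alg_Suc by simp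
qed (rule assms(2))

text \<open>\<open>kU (Suc m)\<close> commutes with \<open>Alg m\<close>, so it can be moved between
  the two factors before the trace property of \<open>D\<close> is applied.\<close>

lemma trace_on_kU:
  assumes D: "trace_on (Suc m) D"
  shows "trace_on m (\<lambda>x. D (x * kU (Suc m)))"
proof -
  have k: "kU (Suc m) \<in> Alg (Suc m)" by auto
  show ?thesis
    unfolding trace_on_def
  proof (intro conjI ballI allI)
    fix x y assume xy: "x \<in> Alg m" "y \<in> Alg m"
    then have xy': "x \<in> Alg (Suc m)" "y \<in> Alg (Suc m)" by (auto intro: Alg_Suc)
    show "D ((x + y) * kU (Suc m)) = D (x * kU (Suc m)) + D (y * kU (Suc m))"
      using xy' k by (simp add: distrib_right trace_onD(1)[OF D])
    have "D (x * y * kU (Suc m)) = D (x * kU (Suc m) * y)"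
      using Alg_kU[OF xy(2)] by (simp add: mult.assoc)
    also have "\<dots> = D (y * (x * kU (Suc m)))"
      using xy' k by (intro trace_onD(2)[OF D]) auto
    finally show "D (x * y * kU (Suc m)) = D (y * x * kU (Suc m))" by (simp add: mult.assoc)
  next
    fix c x assume "x \<in> Alg m"
    then have "x \<in> Alg (Suc m)" by (rule Alg_Suc)
    then show "D (scal c * x * kU (Suc m)) = c * D (x * kU (Suc m))"
      using trace_onD(3)[OF D Alg_mult[OF _ k]] by (simp add: mult.assoc)
  qed
qed

text \<open>Vanishing on \<open>MM\<close> descends along \<open>x \<mapsto> x k\<close>: conjugating by the last generator turns
  \<open>k\<^sub>m\<^sub>+\<^sub>1\<close> into \<open>k\<^sub>m u\<^sup>2\<close>.\<close>

lemma descend_Alg: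
  assumes D: "trace_on (Suc (Suc m)) D" and M: "\<And>x. x \<in> MM (Suc m) \<Longrightarrow> D x = 0" and x: "x \<in> Alg m"
  shows "D (x * kU (Suc (Suc m))) = 0"
proof -
  let ?u = "U (Suc m)" and ?k = "kU (Suc m)"
  have A: "x \<in> Alg (Suc (Suc m))" "?u \<in> Alg (Suc (Suc m))" "?k \<in> Alg (Suc (Suc m))"
    using x by (auto intro: Alg_le)
  have xk: "x * ?k \<in> Alg (Suc m)" using x by (auto intro: Alg_Suc)
  have "x * kU (Suc (Suc m)) = ?u * (x * ?k * ?u)"
    using Alg_U_far[OF x] by (simp add: kU_Suc flip: mult.assoc)
  then have "D (x * kU (Suc (Suc m))) = D (x * ?k * ?u * ?u)"
    using A by (simp only: trace_onD(2)[OF D, of ?u "x * ?k * ?u"] Alg_mult)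
  also have "x * ?k * ?u * ?u = x * ?k + (x * ?k * scal (- al (Suc m))) * ?u * 1"
    by (simp add: mult.assoc U_square scal_minus algebra_simps)
  also have "D (x * ?k + (x * ?k * scal (- al (Suc m))) * ?u * 1) = 0"
    by (rule M, intro MM_add MM_Alg MM_U xk Alg_mult Alg_scal Alg_one) simp
  finally show ?thesis .
qed

text \<open>The braid relation brings a copy of \<open>U (Suc m)\<close> to the front. Cycling it to
  the end creates a square, and after the quadratic relation both terms contain
  \<open>U (Suc m)\<close> only once, so they lie in \<open>MM\<close>.\<close>

lemma descend_U:
  assumes D: "trace_on (Suc (Suc m)) D" and M: "\<And>x. x \<in> MM (Suc m) \<Longrightarrow> D x = 0"
    and x: "x \<in> Alg m" and m: "1 \<le> m"
  shows "D (x * U m * kU (Suc (Suc m))) = 0"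
proof -
  let ?u = "U (Suc m)" and ?v = "U m" and ?k = "kU m" and ?A = "Alg (Suc (Suc m))"
  have A: "x \<in> ?A" "?u \<in> ?A" "?v \<in> ?A" "?k \<in> ?A" using x m by (auto intro: Alg_le)
  have A': "x \<in> Alg (Suc m)" "?v \<in> Alg (Suc m)" "?k \<in> Alg (Suc m)" using x m by (auto intro: Alg_le)
  have xu: "x * ?u = ?u * x" using x by (rule Alg_U_far)
  have ku: "?k * ?u = ?u * ?k" using m by (intro Alg_U_far) auto
  have br: "?u * ?v * ?u = ?v * ?u * ?v" using m by (rule U_braid')
  have "x * ?v * kU (Suc (Suc m)) = x * (?v * ?u * ?v) * ?k * ?v * ?u"
    using m by (simp add: kU_Suc mult.assoc)
  also have "\<dots> = ?u * (x * ?v * ?u * ?k * ?v * ?u)"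
    unfolding br[symmetric] using xu by (simp flip: mult.assoc)
  finally have "D (x * ?v * kU (Suc (Suc m))) = D (x * ?v * ?u * ?k * ?v * ?u * ?u)"
    using A by (simp only: trace_onD(2)[OF D, of ?u "x * ?v * ?u * ?k * ?v * ?u"] Alg_mult)
  also have "x * ?v * ?u * ?k * ?v * ?u * ?u = x * ?v * ?u * ?k * ?v * (?u * ?u)" by (simp only: mult.assoc)
  also have "\<dots> = x * ?v * ?u * (?k * ?v) + scal (- al (Suc m)) * (x * ?v * (?u * ?k) * ?v * ?u)"
    by (simp add: U_square right_diff_distrib scal_minus mult.assoc scal_left[of x] scal_left[of ?v]
        scal_left[of ?u] scal_left[of ?k])
  also have "x * ?v * (?u * ?k) * ?v * ?u = x * ?v * ?k * (?u * ?v * ?u)"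
    unfolding ku[symmetric] by (simp only: mult.assoc)
  also have "\<dots> = x * ?v * ?k * ?v * ?u * ?v" unfolding br by (simp only: mult.assoc)
  also have "D (x * ?v * ?u * (?k * ?v) + scal (- al (Suc m)) * (x * ?v * ?k * ?v * ?u * ?v)) = 0"
    by (rule M, intro MM_add MM_lmult[OF MM_U] MM_U A' Alg_mult Alg_scal) simp_all
  finally show ?thesis .
qed

lemma trace_on_decomp:
  assumes D: "trace_on (Suc m) D" and M: "\<And>x. x \<in> MM m \<Longrightarrow> D x = 0"
    and k: "\<And>x. x \<in> Alg m \<Longrightarrow> D (x * kU (Suc m)) = 0" and x: "x \<in> Alg (Suc m)"
  shows "D x = 0"
proof -
  have N: "n \<in> Alg (Suc m) \<and> D n = 0" if "n \<in> NN m" for n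
    using that
  proof (induction rule: NN.induct)
    case (NN_U x y)
    then show ?case using M[OF MM_U] by (auto intro: Alg_Suc)
  next
    case (NN_k x)
    then show ?case using k by (auto intro: Alg_Suc)
  next
    case (NN_add x y)
    then show ?case using trace_onD(1)[OF D] by auto
  qed
  obtain z where z: "z \<in> Alg m" "x - z \<in> NN m" using Alg_decomp[OF x] by (auto simp: SS_def)
  have "D ((x - z) + z) = D (x - z) + D z"
    using N[OF z(2)] Alg_Suc[OF z(1)] by (intro trace_onD(1)[OF D]) auto
  then show ?thesis using N[OF z(2)] M[OF MM_Alg[OF z(1)]] by simp
qed

lemma trace_on_zero:
  assumes "trace_on (Suc m) D" "\<And>x. x \<in> MM m \<Longrightarrow> D x = 0" "D (TP (Suc m)) = 0"
  shows "x \<in> Alg (Suc m) \<Longrightarrow> D x = 0"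
  using assms
proof (induction m arbitrary: D x)
  case D: (0 D)
  have TP1: "TP (Suc 0) = kU (Suc 0) + scal (al 0)" by (simp add: kU_1)
  have "D (kU (Suc 0) + scal (al 0)) = D (kU (Suc 0)) + D (scal (al 0))"
    by (rule trace_onD(1)[OF D(2)]) auto
  then have k: "D (kU (Suc 0)) = 0" using D(3)[OF MM_Alg[OF Alg_scal]] D(4) unfolding TP1 by simp
  show ?case
  proof (rule trace_on_decomp[OF D(2,3) _ D(1)])
    fix z assume "z \<in> Alg 0"
    then obtain c where "z = scal c" using Alg_0 by blast
    then show "D (z * kU (Suc 0)) = 0" using k trace_onD(3)[OF D(2)] by auto
  qed
next
  case IH: (Suc m D)
  let ?k = "kU (Suc (Suc m))"
  show ?case
  proof (rule trace_on_decomp[OF IH(3,4) _ IH(2)])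
    fix y assume y: "y \<in> Alg (Suc m)"
    show "D (y * ?k) = 0"
    proof (rule IH(1)[of y "\<lambda>y. D (y * ?k)", OF y])
      show tr: "trace_on (Suc m) (\<lambda>y. D (y * ?k))" using IH(3) by (rule trace_on_kU)
      show "D (y * ?k) = 0" if "y \<in> MM m" for y
        using trace_on_MM[OF tr, of y] descend_Alg[OF IH(3,4)] descend_U[OF IH(3,4)] that by blast
      \<comment> \<open>Modulo \<open>MM\<close> the last factor of \<open>TP\<close> may be
        replaced by \<open>?k\<close>, so the vanishing on \<open>TP\<close> passes to the trace
        \<open>y \<mapsto> D (y * ?k)\<close> one rank lower.\<close>
      have d: "TP (Suc m) * (TT (Suc (Suc m)) - ?k) \<in> MM (Suc m)"
        by (rule MM_lmult[OF TT_kU TP_Alg])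
      have "TP (Suc m) * ?k = TP (Suc (Suc m)) - TP (Suc m) * (TT (Suc (Suc m)) - ?k)"
        by (simp only: TP.simps right_diff_distrib) simp
      then have "D (TP (Suc m) * ?k) = D (TP (Suc (Suc m))) - D (TP (Suc m) * (TT (Suc (Suc m)) - ?k))"
        using trace_on_diff[OF IH(3) TP_Alg MM_Alg_Suc[OF d]] by (simp only:)
      then show "D (TP (Suc m) * ?k) = 0" using IH(4)[OF d] IH(5) by simp
    qed
  qed
qed

text \<open>The difference with \<open>theta\<close> is a trace that vanishes on \<open>TP\<close>,
  and on \<open>MM\<close> by the induction hypothesis on the rank; \<open>trace_on_zero\<close>
  then removes it.\<close>

theorem markov_unique:
  assumes tr: "\<And>n. 1 \<le> n \<Longrightarrow> trace_on n (\<phi> n)" and one: "\<phi> 1 1 = 1 + a"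
    and U1: "\<And>n x. 1 \<le> n \<Longrightarrow> x \<in> Alg n \<Longrightarrow> \<phi> (Suc n) x = (1 + a) * \<phi> n x"
    and M2: "\<And>n x. 1 \<le> n \<Longrightarrow> x \<in> Alg n \<Longrightarrow> \<phi> (Suc n) (x * (U n + scal (al n))) = al n * \<phi> n x"
    and T: "\<And>n. 1 \<le> n \<Longrightarrow> \<phi> n (TP n) = y ^ n"
  shows "x \<in> Alg (Suc m) \<Longrightarrow> \<phi> (Suc m) x = theta a (y - al 0) (Suc m) x"
proof (induction m arbitrary: x)
  let ?t = "theta a (y - al 0)"
  have trD: "trace_on (Suc m) (\<lambda>x. \<phi> (Suc m) x - ?t (Suc m) x)" for m
    unfolding trace_on_def
    using trace_onD[OF tr[of "Suc m"]] theta_trace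
    by (auto simp: theta_add theta_scal algebra_simps)
  have TD: "\<phi> (Suc m) (TP (Suc m)) - ?t (Suc m) (TP (Suc m)) = 0" for m
    using T[of "Suc m"] theta_TP[of a y "Suc m"] by simp
  {
    case 0
    have "\<phi> (Suc 0) z - ?t (Suc 0) z = 0" if z: "z \<in> Alg 0" for z
    proof -
      obtain c where "z = scal c * 1" using Alg_0[OF z] by auto
      then show ?thesis
        using trace_onD(3)[OF tr[of 1] Alg_one, of c] one theta_U1[OF z, of a "y - al 0"]
        by (simp add: theta_def)
    qed
    then have "\<phi> (Suc 0) x - ?t (Suc 0) x = 0"
      using trace_on_zero[OF trD trace_on_MM[OF trD] TD 0] by simp
    then show ?case by simp
  next
    case (Suc m)
    have z: "\<phi> (Suc (Suc m)) z - ?t (Suc (Suc m)) z = 0" if "z \<in> Alg (Suc m)" for z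
      using U1[of "Suc m" z] theta_U1[OF that] Suc.IH[OF that] that by simp
    have zu: "\<phi> (Suc (Suc m)) (z * U (Suc m)) - ?t (Suc (Suc m)) (z * U (Suc m)) = 0"
      if zA: "z \<in> Alg (Suc m)" for z
    proof -
      let ?d = "al (Suc m)" and ?p = "\<phi> (Suc (Suc m))"
      have zA': "z * U (Suc m) \<in> Alg (Suc (Suc m))" "z \<in> Alg (Suc (Suc m))"
        using zA by (auto intro: Alg_Suc)
      have e: "z * (U (Suc m) + scal ?d) = z * U (Suc m) + scal ?d * z"
        by (simp add: distrib_left scal_comm[of z])
      have "?p (z * (U (Suc m) + scal ?d)) = ?p (z * U (Suc m)) + ?d * ?p z"
        unfolding e using zA' trace_onD(1,3)[OF tr[of "Suc (Suc m)"]] by simp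
      \<comment> \<open>(M2) concerns \<open>t = u + \<alpha>\<close>; removing the part given by
        (U1) leaves \<open>\<alpha> - \<alpha> * (1 + a) = - a * \<alpha>\<close>, the constant of
        \<open>theta_U\<close>.\<close>
      then have "?p (z * U (Suc m)) = ?d * \<phi> (Suc m) z - ?d * ((1 + a) * \<phi> (Suc m) z)"
        using M2[of "Suc m" z] U1[of "Suc m" z] zA by simp
      then show ?thesis using theta_U[OF zA] Suc.IH[OF zA] by (simp add: algebra_simps)
    qed
    have "\<phi> (Suc (Suc m)) x - ?t (Suc (Suc m)) x = 0"
      using trace_on_zero[OF trD trace_on_MM[OF trD z zu] TD Suc.prems] by simp
    then show ?case by simp
  }
qed

end

section \<open>Base change and the main theorem\<close>

lemma rf_const_simps:
  "rf_const 0 = 0" "rf_const 1 = 1" "rf_const (a + b) = rf_const a + rf_const b"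
  "rf_const (a * b) = rf_const a * rf_const b"
  by (simp_all add: rf_const_def flip: to_fract_add to_fract_mult) (simp add: one_pCons flip: to_fract_1)

lemma rf_const_eq_0: "rf_const c = 0 \<longleftrightarrow> c = 0"
  by (simp add: rf_const_def)

lemma rf_var_neq_0: "rf_var \<noteq> 0"
  by (simp add: rf_var_def)

lemma poly_rf_var: "poly (map_poly rf_const p) rf_var = to_fract p"
proof (induction p)
  case 0
  then show ?case by simp
next
  case (pCons c p)
  have "to_fract (pCons c p) = to_fract ([:c:] + [:0, 1:] * p)" by simp
  also have "\<dots> = rf_const c + rf_var * to_fract p"
    unfolding to_fract_add to_fract_mult by (simp add: rf_const_def rf_var_def)
  finally show ?case using pCons by (simp add: map_poly_pCons rf_const_simps)
qed

text \<open>A power of the variable turns the value at its inverse into the reversed polynomial,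
  which is nonzero. Hence denominators survive the substitution in \<open>qv_bar\<close>.\<close>

lemma poly_inverse_rf_var:
  assumes "p \<noteq> 0"
  shows "poly (map_poly rf_const p) (inverse rf_var) \<noteq> 0"
proof -
  let ?p = "map_poly rf_const p"
  have deg: "degree ?p = degree p" by (rule degree_map_poly) (simp add: rf_const_eq_0)
  have "reflect_poly ?p = map_poly rf_const (reflect_poly p)"
    by (rule poly_eqI) (simp add: coeff_reflect_poly coeff_map_poly rf_const_simps deg)
  then have "poly (reflect_poly ?p) rf_var = to_fract (reflect_poly p)" by (simp add: poly_rf_var)
  then have "rf_var ^ degree ?p * poly ?p (inverse rf_var) = to_fract (reflect_poly p)"
    using poly_reflect_poly_nz[OF rf_var_neq_0, of ?p] by simp
  moreover have "to_fract (reflect_poly p) \<noteq> 0" using assms by simp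
  ultimately show ?thesis by auto
qed

text \<open>The description in \<open>qv_bar\<close> has to be resolved for all fractions
  representing the variable; these are exactly those with numerator \<open>pCons 0 g\<close> over
  \<open>g\<close>, and \<open>g\<close> cancels after substitution.\<close>

lemma qv_bar_rf_var: "qv_bar rf_var = inverse rf_var"
proof -
  define sub where "sub p = poly (map_poly rf_const p) (inverse (rf_var :: qv))" for p :: "rat poly"
  have X: "sub (pCons 0 g) = inverse rf_var * sub g" for g
    by (simp add: sub_def map_poly_pCons rf_const_simps)
  have one: "sub [:1:] = 1" by (simp add: sub_def map_poly_pCons rf_const_simps)
  have "(THE y. \<exists>f g. g \<noteq> 0 \<and> rf_var = Fract f g \<and> y = sub f / sub g) = inverse rf_var"
  proof (rule the_equality)
    show "\<exists>f g. g \<noteq> 0 \<and> rf_var = Fract f g \<and> inverse rf_var = sub f / sub g"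
      by (rule exI[of _ "pCons 0 1"], rule exI[of _ 1]) (simp add: X one rf_var_def to_fract_def one_pCons)
  next
    fix y assume "\<exists>f g. g \<noteq> 0 \<and> rf_var = Fract f g \<and> y = sub f / sub g"
    then obtain f g where fg: "g \<noteq> 0" "rf_var = Fract f g" "y = sub f / sub g" by blast
    then have "f = pCons 0 g" by (simp add: rf_var_def to_fract_def eq_fract)
    then show "y = inverse rf_var"
      using fg poly_inverse_rf_var[OF fg(1)] by (simp add: X) (simp add: sub_def)
  qed
  then show ?thesis by (simp add: qv_bar_def sub_def Let_def)
qed

lemma field_hom_simps:
  assumes "field_hom f"
  shows "f 1 = 1" "f (x + y) = f x + f y" "f (x * y) = f x * f y" "f 0 = 0" "f (- x) = - f x"
    "f (x - y) = f x - f y" "f (inverse x) = inverse (f x)" "f x = 0 \<longleftrightarrow> x = 0"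
proof -
  show one: "f 1 = 1" and add: "f (x + y) = f x + f y" and mult: "f (x * y) = f x * f y" for x y
    using assms by (auto simp: field_hom_def)
  show zero: "f 0 = 0" using add[of 0 0] by (metis add_0_right add_left_cancel)
  show minus: "f (- x) = - f x" for x using add[of x "- x"] zero by (simp add: eq_neg_iff_add_eq_0 add.commute)
  show "f (x - y) = f x - f y" using add[of x "- y"] minus by simp
  have inv: "f x * f (inverse x) = 1" if "x \<noteq> 0" for x
    using mult[of x "inverse x"] that one by simp
  show "f x = 0 \<longleftrightarrow> x = 0"
  proof (cases "x = 0")
    case False
    then have "f x * f (inverse x) = 1" by (rule inv)
    then have "f x \<noteq> 0" by auto
    then show ?thesis using False by simp
  qed (simp add: zero)
  show "f (inverse x) = inverse (f x)"
    using inv[of x] zero by (cases "x = 0") (auto simp: inverse_unique)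
qed

section \<open>Extension of scalars\<close>

locale hecke_base_change =
  fixes \<kappa> :: "'k::field \<Rightarrow> 'r::field" and q q0 :: 'k
  assumes hom: "field_hom \<kappa>" and nz: "q \<noteq> 0" "q0 \<noteq> 0"
begin

lemmas kp = field_hom_simps[OF hom]

sublocale K: hecke q q0
  by unfold_locales (rule nz)+

sublocale L: hecke "\<kappa> q" "\<kappa> q0"
  by unfold_locales (simp_all add: kp nz)

abbreviation bc :: "(fword \<Rightarrow>\<^sub>0 'k) \<Rightarrow> fword \<Rightarrow>\<^sub>0 'r" where "bc \<equiv> Poly_Mapping.map \<kappa>"

sublocale bc: alg_ext "\<lambda>c. free_scal (\<kappa> c)" "fmono :: nat list \<Rightarrow> fword \<Rightarrow>\<^sub>0 'r"
  by unfold_locales (simp_all add: free_scal_add free_scal_mult kp, rule free_scal_comm)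

lemma lookup_bc: "Poly_Mapping.lookup (bc x) w = \<kappa> (Poly_Mapping.lookup x w)"
  by (simp add: map.rep_eq when_def kp)

lemma bc_eq: "bc x = lext (\<lambda>c. free_scal (\<kappa> c)) fmono x"
proof (induction x rule: pm_induct)
  case (single w c)
  have "bc (Poly_Mapping.single w c) = Poly_Mapping.single w (\<kappa> c)"
    by (rule poly_mapping_eqI) (simp add: kp when_def lookup_single map.rep_eq)
  then show ?case unfolding bc.ext_single by (simp add: single_word)
next
  case (add x y)
  have "bc (x + y) = bc x + bc y"
    by (rule poly_mapping_eqI) (simp add: lookup_bc lookup_add kp)
  then show ?case using add by (simp add: bc.ext_add)
qed

lemma bc_simps:
  "bc (x + y) = bc x + bc y" "bc (x - y) = bc x - bc y" "bc (- x) = - bc x"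
  "bc (x * y) = bc x * bc y" "bc 0 = 0" "bc 1 = 1" "bc (free_scal c) = free_scal (\<kappa> c)"
  "bc (free_gen i) = free_gen i" "bc (fmono is) = fmono is"
  unfolding bc_eq
  by (simp_all add: bc.ext_add bc.ext_diff bc.ext_minus bc.ext_mult bc.ext_scal
      bc.ext_gen bc.ext_mono mono_append free_gen_mono)

lemma bc_FA: "x \<in> FA n \<Longrightarrow> bc x \<in> FA n"
  by (induction rule: FA_induct) (auto simp: bc_simps)

lemma al_bc: "\<kappa> (K.al i) = L.al i"
  by (simp add: K.al_def L.al_def kp)

lemma bc_J: "x \<in> K.J n \<Longrightarrow> bc x \<in> L.J n"
proof (induction rule: K.J_induct)
  case (quad i)
  then show ?case using L.J_quad[of i n] by (simp add: bc_simps al_bc)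
next
  case (far i j)
  then show ?case using L.J_far[of i n j] by (simp add: bc_simps)
next
  case (braid i)
  then show ?case using L.J_braid[of i n] by (simp add: bc_simps)
next
  case braid0
  then show ?case using L.J_braid0[of n] by (simp add: bc_simps)
qed (auto simp: bc_simps intro: L.J_add L.J_uminus L.J_lmult L.J_rmult bc_FA)

lemma ext_cls:
  assumes x: "x \<in> FA n"
  shows "hecke_ext \<kappa> q q0 n (K.cls n x) = L.cls n (bc x)"
proof -
  have *: "L.cls n (bc z) = L.cls n (bc x)" if "z \<in> K.cls n x" for z
  proof -
    have "z \<in> FA n" "z - x \<in> K.J n" using that K.mem_cls[OF x] by auto
    then show ?thesis using bc_J[of "z - x" n] bc_FA x by (intro L.cls_eqI) (auto simp: bc_simps)
  qed
  have "x \<in> K.cls n x" using x by (simp add: K.mem_cls)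
  then have "(\<lambda>_. L.cls n (bc x)) ` K.cls n x = {L.cls n (bc x)}" by (rule image_constant)
  moreover have "(\<lambda>z. L.cls n (bc z)) ` K.cls n x = (\<lambda>_. L.cls n (bc x)) ` K.cls n x"
    by (rule image_cong[OF refl *])
  ultimately show ?thesis unfolding hecke_ext_def by simp
qed

definition tb :: "nat \<Rightarrow> fword \<Rightarrow>\<^sub>0 'k" where
  "tb k = wprod free_gen (rev [1..<k] @ [0]) * wprod K.ui [1..<k]"

lemma tb_FA: "1 \<le> k \<Longrightarrow> k \<le> n \<Longrightarrow> tb k \<in> FA n"
  unfolding tb_def by (intro FA_mult FA_wprod) auto

lemma ring_prod_list_cls:
  "(\<And>z. z \<in> set zs \<Longrightarrow> z \<in> FA n) \<Longrightarrow>
    ring_prod_list (K.H n) (map (K.cls n) zs) = K.cls n (prod_list zs) \<and> prod_list zs \<in> FA n"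
  by (induction zs) (auto simp: ring_prod_list_def K.one_H K.mult_H)

lemma T_B_cls:
  assumes "1 \<le> k" "k \<le> n"
  shows "T_B q q0 n k = K.cls n (tb k)"
proof -
  let ?zs = "map free_gen (rev [1..<k] @ [0]) @ map K.ui [1..<k]"
  have "map (hecke_gen q q0 n) (rev [1..<k] @ [0])
      @ map (\<lambda>i. inv\<^bsub>K.H n\<^esub> (hecke_gen q q0 n i)) [1..<k] = map (K.cls n) ?zs"
    using assms by (auto simp: hecke_gen_def K.inv_gen[unfolded hecke_gen_def])
  moreover have "prod_list ?zs = tb k" by (simp add: tb_def wprod_def mult.assoc)
  moreover have "z \<in> FA n" if "z \<in> set ?zs" for z using that assms by auto
  ultimately show ?thesis unfolding T_B_def using ring_prod_list_cls[of ?zs n] by metis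
qed

lemma bc_ui: "bc (K.ui i) = L.ui i"
  by (simp add: K.ui_def L.ui_def bc_simps al_bc)

lemma pi1_tb: "L.pi1 (bc (tb (Suc k))) = L.TT (Suc k)"
proof (induction k)
  case 0
  then show ?case by (simp add: tb_def bc_simps L.pi1_simps)
next
  case (Suc k)
  have "tb (Suc (Suc k)) = free_gen (Suc k) * tb (Suc k) * K.ui (Suc k)"
    by (simp add: tb_def mult.assoc)
  then show ?case using Suc by (simp add: bc_simps bc_ui L.pi1_simps L.pi1_ui)
qed

lemma pi1_tp: "L.pi1 (bc (wprod tb [1..<Suc n])) = L.TP n"
proof (induction n)
  case (Suc n)
  have "[1..<Suc (Suc n)] = [1..<Suc n] @ [Suc n]" by simp
  then show ?case using Suc by (simp add: bc_simps L.pi1_simps pi1_tb del: upt_Suc)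
qed (simp add: bc_simps L.pi1_simps)

end

section \<open>The given trace as a functional on operators over the large field\<close>

locale markov_base_change = hecke_base_change \<kappa> q q0 for \<kappa> :: "'k::field \<Rightarrow> 'r::field" and q q0 +
  fixes a y :: 'r and tr :: "nat \<Rightarrow> (fword \<Rightarrow>\<^sub>0 'k) set \<Rightarrow> 'r"
  assumes mtr: "markov_trace \<kappa> q q0 (1 + a) (\<kappa> (q - inverse q)) tr"
    and tr_one: "tr 1 \<one>\<^bsub>hecke_alg q q0 1\<^esub> = 1 + a"
    and tr_T: "1 \<le> n \<Longrightarrow> tr n (ring_prod_list (hecke_alg q q0 n) (map (T_B q q0 n) [1..<Suc n])) = y ^ n"
begin

lemma tr_add: "1 \<le> n \<Longrightarrow> x \<in> FA n \<Longrightarrow> z \<in> FA n \<Longrightarrow>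
    tr n (K.cls n (x + z)) = tr n (K.cls n x) + tr n (K.cls n z)"
  using mtr unfolding markov_trace_def linear_functional_def Let_def
  by (simp add: K.add_H flip: K.add_H)

lemma tr_scal: "1 \<le> n \<Longrightarrow> x \<in> FA n \<Longrightarrow> tr n (K.cls n (free_scal c * x)) = \<kappa> c * tr n (K.cls n x)"
  using mtr unfolding markov_trace_def linear_functional_def Let_def
  by (simp flip: K.smult_H)

lemma tr_comm: "1 \<le> n \<Longrightarrow> x \<in> FA n \<Longrightarrow> z \<in> FA n \<Longrightarrow>
    tr n (K.cls n (x * z)) = tr n (K.cls n (z * x))"
  using mtr unfolding markov_trace_def by (simp flip: K.mult_H)

lemma tr_Suc:
  assumes "1 \<le> n" "x \<in> FA n"
  shows "tr (Suc n) (K.cls (Suc n) x) = (1 + a) * tr n (K.cls n x)"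
    and "tr (Suc n) (K.cls (Suc n) (x * free_gen n)) = \<kappa> (q - inverse q) * tr n (K.cls n x)"
proof -
  have x: "x \<in> FA (Suc n)" using FA_le[of n "Suc n"] assms by auto
  have e: "hecke_embed q q0 (Suc n) (K.cls n x) = K.cls (Suc n) x" using assms by (intro K.embed_cls) auto
  have n: "2 \<le> Suc n" "Suc n - 1 = n" using assms by auto
  show "tr (Suc n) (K.cls (Suc n) x) = (1 + a) * tr n (K.cls n x)"
    using mtr n assms K.carrier_H_I[of x n] unfolding markov_trace_def by (metis e)
  have "tr (Suc n) (hecke_embed q q0 (Suc n) (K.cls n x) \<otimes>\<^bsub>K.H (Suc n)\<^esub> hecke_gen q q0 (Suc n) n)
      = \<kappa> (q - inverse q) * tr n (K.cls n x)"
    using mtr n assms K.carrier_H_I[of x n] unfolding markov_trace_def by metis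
  then show "tr (Suc n) (K.cls (Suc n) (x * free_gen n)) = \<kappa> (q - inverse q) * tr n (K.cls n x)"
    unfolding e hecke_gen_def using x by (simp add: K.mult_H)
qed

text \<open>The trace is linear over the small field with values in the large one. On the free
  algebra over the large field it extends linearly because the words are a basis.\<close>

definition Fn :: "nat \<Rightarrow> (fword \<Rightarrow>\<^sub>0 'r) \<Rightarrow> 'r" where
  "Fn n = lext (\<lambda>c. c) (\<lambda>is. tr n (K.cls n (fmono is)))"

sublocale Fn: lin_ext "\<lambda>c::'r. c" "\<lambda>is. tr n (K.cls n (fmono is))" for n
  by unfold_locales simp

lemma Fn_simps:
  "Fn n (x + z) = Fn n x + Fn n z" "Fn n (x - z) = Fn n x - Fn n z" "Fn n 0 = 0" "Fn n (- x) = - Fn n x"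
  "Fn n (free_scal c * fmono is) = c * tr n (K.cls n (fmono is))"
  by (simp_all add: Fn_def Fn.ext_add Fn.ext_diff Fn.ext_minus Fn.ext_mono')

lemma Fn_fmono: "Fn n (fmono is) = tr n (K.cls n (fmono is))"
  using Fn_simps(5)[of n 1 "is"] by simp

lemma Fn_scal: "Fn n (free_scal c * x) = c * Fn n x"
proof (induction x rule: pm_induct)
  case (single w d)
  have "free_scal c * (free_scal d * fmono (letters w)) = (free_scal (c * d) * fmono (letters w) :: fword \<Rightarrow>\<^sub>0 'r)"
    by (simp only: free_scal_mult mult.assoc)
  then show ?case unfolding single_word by (simp only: Fn_simps mult.assoc)
qed (simp add: distrib_left Fn_simps)

lemma Fn_bc: "1 \<le> n \<Longrightarrow> x \<in> FA n \<Longrightarrow> Fn n (bc x) = tr n (K.cls n x)"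
proof (rotate_tac, induction rule: FA_induct)
  case (mono c "is")
  then show ?case by (simp add: bc_simps Fn_simps tr_scal)
next
  case (add x z)
  then show ?case by (simp add: bc_simps Fn_simps tr_add)
qed

lemma free_scal_left: "x * (free_scal c * z) = free_scal c * (x * z)"
  by (metis free_scal_comm mult.assoc)

lemma Fn_K_J:
  assumes "1 \<le> n" and x: "x \<in> K.J n" and b: "b \<in> FA n" "d \<in> FA n"
  shows "Fn n (b * bc x * d) = 0"
  using b(1)
proof (induction rule: FA_induct)
  case (mono c "is")
  note m = mono
  show ?case
    using b(2)
  proof (induction rule: FA_induct)
    case (mono c' js)
    have xJ: "fmono is * x * fmono js \<in> K.J n" using m mono x by (intro K.J_lmult K.J_rmult) auto
    have "free_scal c * fmono is * bc x * (free_scal c' * fmono js) = free_scal c * (free_scal c' * bc (fmono is * x * fmono js))"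
      by (simp only: bc_simps mult.assoc free_scal_left[of "bc x"] free_scal_left[of "fmono is"])
    moreover have "Fn n (bc (fmono is * x * fmono js)) = 0"
    proof -
      have "K.cls n (fmono is * x * fmono js) = K.cls n (free_scal 0 * 1)"
        using xJ K.J_FA by (intro K.cls_eqI) auto
      then show ?thesis using Fn_bc[OF assms(1) K.J_FA[OF xJ]] tr_scal[OF assms(1), of 1 0] kp(4) by simp
    qed
    ultimately show ?case by (simp add: Fn_scal)
  next
    case (add z w)
    then show ?case by (simp add: distrib_left Fn_simps)
  qed
next
  case (add z w)
  then show ?case by (simp add: distrib_right Fn_simps)
qed

text \<open>The multipliers \<open>b\<close> and \<open>d\<close> on both sides make the claim
  stable under the ideal operations. The relators are defined over the small field, where
  \<open>Fn_K_J\<close> applies.\<close>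

lemma Fn_J:
  assumes n: "1 \<le> n" and x: "x \<in> L.J n"
  shows "\<forall>b\<in>FA n. \<forall>d\<in>FA n. Fn n (b * x * d) = 0"
  using x
proof (induction rule: L.J_induct)
  case (quad i)
  have "bc (free_gen i * free_gen i - 1 - free_scal (K.al i) * free_gen i)
      = free_gen i * free_gen i - 1 - free_scal (L.al i) * free_gen i"
    by (simp add: bc_simps al_bc)
  then show ?case using Fn_K_J[OF n K.J_quad[OF quad]] by simp
next
  case (far i j)
  show ?case using Fn_K_J[OF n K.J_far[OF far]] by (simp add: bc_simps)
next
  case (braid i)
  show ?case using Fn_K_J[OF n K.J_braid[OF braid]] by (simp add: bc_simps)
next
  case braid0
  then show ?case using Fn_K_J[OF n K.J_braid0[OF braid0]] by (simp add: bc_simps)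
next
  case (lmult x c)
  show ?case
  proof (intro ballI)
    fix b d :: "fword \<Rightarrow>\<^sub>0 'r" assume "b \<in> FA n" "d \<in> FA n"
    then have "Fn n ((b * c) * x * d) = 0" using lmult by blast
    then show "Fn n (b * (c * x) * d) = 0" by (simp add: mult.assoc)
  qed
next
  case (rmult x c)
  show ?case
  proof (intro ballI)
    fix b d :: "fword \<Rightarrow>\<^sub>0 'r" assume "b \<in> FA n" "d \<in> FA n"
    then have "Fn n (b * x * (c * d)) = 0" using rmult by blast
    then show "Fn n (b * (x * c) * d) = 0" by (simp add: mult.assoc)
  qed
qed (simp_all add: distrib_left distrib_right Fn_simps)

text \<open>The choice of a preimage is harmless: by faithfulness two preimages differ by an element
  of the ideal, on which \<open>Fn\<close> vanishes.\<close>

definition phi :: "nat \<Rightarrow> 'r lin_op \<Rightarrow> 'r" where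
  "phi n X = Fn n (SOME x. x \<in> FA n \<and> L.pi1 x = X)"

lemma phi_pi1:
  assumes "1 \<le> n" "x \<in> FA n"
  shows "phi n (L.pi1 x) = Fn n x"
proof -
  define z where "z = (SOME z. z \<in> FA n \<and> L.pi1 z = L.pi1 x)"
  have z: "z \<in> FA n \<and> L.pi1 z = L.pi1 x" unfolding z_def by (rule someI[of _ x]) (use assms in simp)
  then have "z - x \<in> L.J n" using L.rep1.rho_eq_iff assms by blast
  then have "Fn n (1 * (z - x) * 1) = 0" using Fn_J[OF assms(1)] FA_one by blast
  then show ?thesis by (simp add: Fn_simps phi_def flip: z_def)
qed

lemma Fn_comm:
  assumes "1 \<le> n" "x \<in> FA n" "z \<in> FA n"
  shows "Fn n (x * z) = Fn n (z * x)"
  using assms(2)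
proof (induction rule: FA_induct)
  case (mono c "is")
  note m = mono
  show ?case
    using assms(3)
  proof (induction rule: FA_induct)
    case (mono c' js)
    have e: "free_scal c * fmono xs * (free_scal d * fmono zs) = free_scal c * (free_scal d * fmono (xs @ zs))"
      for c d :: 'r and xs zs
      by (simp only: mult.assoc free_scal_left[of "fmono xs"] mono_append)
    have "tr n (K.cls n (fmono (is @ js))) = tr n (K.cls n (fmono (js @ is)))"
      unfolding mono_append using m mono by (intro tr_comm[OF assms(1)]) auto
    then show ?case unfolding e Fn_scal Fn_fmono by simp
  qed (simp add: distrib_left distrib_right Fn_simps)
qed (simp add: distrib_left distrib_right Fn_simps)

lemma phi_trace: "1 \<le> n \<Longrightarrow> L.trace_on n (phi n)"
  unfolding L.trace_on_def
proof (intro conjI ballI allI)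
  fix X Y assume n: "1 \<le> n" and "X \<in> L.Alg n" "Y \<in> L.Alg n"
  then obtain x z where xz: "x \<in> FA n" "X = L.pi1 x" "z \<in> FA n" "Y = L.pi1 z" using L.Alg_pi1 by metis
  show "phi n (X + Y) = phi n X + phi n Y" unfolding xz(2,4)
    using xz(1,3) n by (simp add: phi_pi1 Fn_simps flip: L.pi1_simps)
  show "phi n (X * Y) = phi n (Y * X)" unfolding xz(2,4)
    using xz(1,3) n Fn_comm by (simp add: phi_pi1 flip: L.pi1_simps)
next
  fix c X assume n: "1 \<le> n" and "X \<in> L.Alg n"
  then obtain x where x: "x \<in> FA n" "X = L.pi1 x" using L.Alg_pi1 by metis
  have "scal c * L.pi1 x = L.pi1 (free_scal c * x)" by (simp add: L.pi1_simps)
  then show "phi n (scal c * X) = c * phi n X" unfolding x(2)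
    using x(1) n by (simp add: phi_pi1 Fn_scal)
qed

lemma Fn_Suc:
  assumes "1 \<le> n" "x \<in> FA n"
  shows "Fn (Suc n) x = (1 + a) * Fn n x"
    and "Fn (Suc n) (x * free_gen n) = L.al n * Fn n x"
proof -
  have "\<kappa> (q - inverse q) = L.al n" using assms(1) by (simp add: L.al_def kp)
  then have *: "tr (Suc n) (K.cls (Suc n) (fmono (is @ [n]))) = L.al n * tr n (K.cls n (fmono is))"
    if "set is \<subseteq> {..<n}" for "is"
    using tr_Suc(2)[OF assms(1), of "fmono is"] that by (simp add: mono_append free_gen_mono)
  show "Fn (Suc n) x = (1 + a) * Fn n x"
    using assms(2)
    by (induction rule: FA_induct) (simp_all add: Fn_simps tr_Suc(1)[OF assms(1)] distrib_left)
  show "Fn (Suc n) (x * free_gen n) = L.al n * Fn n x"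
    using assms(2)
  proof (induction rule: FA_induct)
    case (mono c "is")
    have "free_scal c * fmono is * free_gen n = (free_scal c * fmono (is @ [n]) :: fword \<Rightarrow>\<^sub>0 'r)"
      by (simp add: mono_append free_gen_mono mult.assoc)
    then show ?case using *[OF mono] by (simp add: Fn_simps)
  qed (simp_all add: Fn_simps distrib_left distrib_right)
qed

theorem tr_eq_theta:
  assumes "1 \<le> n" "x \<in> FA n"
  shows "tr n (K.cls n x) = L.theta a (y - L.al 0) n (L.pi1 (bc x))"
proof -
  have "phi (Suc m) X = L.theta a (y - L.al 0) (Suc m) X" if "X \<in> L.Alg (Suc m)" for m X
    using phi_trace _ _ _ _ that
  proof (rule L.markov_unique)
    have "phi 1 (L.pi1 (bc 1)) = 1 + a"
      unfolding phi_pi1[OF order.refl bc_FA[OF FA_one]] Fn_bc[OF order.refl FA_one]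
      using tr_one by (simp add: K.one_H)
    then show "phi 1 1 = 1 + a" by (simp add: bc_simps L.pi1_simps)
  next
    fix n X assume n: "1 \<le> n" and "X \<in> L.Alg n"
    then obtain x where x: "x \<in> FA n" "X = L.pi1 x" using L.Alg_pi1 by metis
    have x': "x \<in> FA (Suc n)" using FA_le[of n "Suc n"] x by auto
    show "phi (Suc n) X = (1 + a) * phi n X"
      unfolding x(2) using x(1) x' n by (simp add: phi_pi1 Fn_Suc)
    have "L.pi1 x * (L.U n + scal (L.al n)) = L.pi1 (x * free_gen n)" by (simp add: L.pi1_simps)
    moreover have "x * free_gen n \<in> FA (Suc n)" using x' by auto
    ultimately show "phi (Suc n) (X * (L.U n + scal (L.al n))) = L.al n * phi n X"
      unfolding x(2) using x(1) n phi_pi1[of "Suc n" "x * free_gen n"] by (simp add: phi_pi1 Fn_Suc)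
  next
    fix n :: nat assume n: "1 \<le> n"
    have tbF: "tb k \<in> FA n" if "k \<in> set [1..<Suc n]" for k using that by (intro tb_FA) auto
    then have F: "wprod tb [1..<Suc n] \<in> FA n" by (rule FA_wprod)
    have T: "map (T_B q q0 n) [1..<Suc n] = map (\<lambda>k. K.cls n (tb k)) [1..<Suc n]"
      by (rule map_cong[OF refl], rule T_B_cls) auto
    have "ring_prod_list (K.H n) (map (T_B q q0 n) [1..<Suc n]) = K.cls n (wprod tb [1..<Suc n])"
      unfolding T by (rule K.prod_list_H[OF tbF])
    then have "tr n (K.cls n (wprod tb [1..<Suc n])) = y ^ n" using tr_T[OF n] by (simp only:)
    then have "phi n (L.pi1 (bc (wprod tb [1..<Suc n]))) = y ^ n"
      unfolding phi_pi1[OF n bc_FA[OF F]] Fn_bc[OF n F] .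
    then show "phi n (L.TP n) = y ^ n" unfolding pi1_tp .
  qed
  then have "phi n (L.pi1 (bc x)) = L.theta a (y - L.al 0) n (L.pi1 (bc x))"
    using assms L.pi1_Alg[OF bc_FA[OF assms(2)]] by (cases n) auto
  then show ?thesis unfolding phi_pi1[OF assms(1) bc_FA[OF assms(2)]] Fn_bc[OF assms] .
qed

end

theorem theorem3p2p2:
  fixes emb :: "qv ratfun \<Rightarrow> 'r::field"
    and cj :: "'r \<Rightarrow> 'r"
    and \<kappa> :: "qv \<Rightarrow> 'r"
    and a y :: 'r
    and v v0 :: qv
    and tr :: "nat \<Rightarrow> (fword \<Rightarrow>\<^sub>0 qv) set \<Rightarrow> 'r"
  assumes v: "v = rf_var"
    and v0: "v0 \<noteq> 0" "qv_bar v0 = inverse v0"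
    and emb: "field_hom emb"
    and \<kappa>: "\<kappa> = (\<lambda>x. emb (rf_const x))"
    and a: "a = emb rf_var"
    and cj: "field_hom cj" "\<forall>x. cj (cj x) = x" "\<forall>x. cj (\<kappa> x) = \<kappa> (qv_bar x)"
      "cj a = inverse a"
    and tr: "markov_trace \<kappa> v v0 (1 + a) (\<kappa> (v - inverse v)) tr"
    and tr_one: "\<forall>n\<ge>1. tr n \<one>\<^bsub>hecke_alg v v0 n\<^esub> = (1 + a) ^ n"
    and tr_T: "\<forall>n\<ge>1. tr n (ring_prod_list (hecke_alg v v0 n)
                 (map (T_B v v0 n) [1..<Suc n])) = y ^ n"
  shows "\<forall>n\<ge>1. \<forall>h\<in>carrier (hecke_alg v v0 n).
    tr n h = hecke_pairing cj (\<kappa> v) (\<kappa> v0) n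
               (beta_B (\<kappa> v) (\<kappa> v0) a (cj y) n)
               (hecke_ext \<kappa> v v0 n h)"
proof -
  have hom: "field_hom \<kappa>"
    using emb by (simp add: \<kappa> field_hom_def rf_const_simps)
  interpret M: markov_base_change \<kappa> v v0 a y tr
    using hom v v0(1) rf_var_neq_0 tr tr_one[rule_format, of 1] tr_T by unfold_locales simp_all
  note kp = field_hom_simps[OF hom] and cp = field_hom_simps[OF cj(1)]
  interpret C: hecke_conj "\<kappa> v" "\<kappa> v0" cj
  proof unfold_locales
    show "cj (\<kappa> v) = inverse (\<kappa> v)" using cj(3) by (simp add: v qv_bar_rf_var kp)
    show "cj (\<kappa> v0) = inverse (\<kappa> v0)" using cj(3) v0(2) by (simp add: kp)
  qed (simp_all add: cp)
  \<comment> \<open>\<open>cj\<close> is an involution and inverts \<open>\<kappa> v0\<close>, hence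
    negates \<open>\<alpha>\<^sub>0\<close>: the conjugated coefficient is the shift
    \<open>y - \<alpha>\<^sub>0\<close> found in \<open>quadr_TT\<close>.\<close>
  have c: "cj (cj y + (\<kappa> v0 - inverse (\<kappa> v0))) = y - M.L.al 0"
    using cj(2) C.cj_q0 by (simp add: cp M.L.al_def)
  have ia: "cj (inverse a) = a" using cj(4) by (simp add: cp)
  show ?thesis
  proof (intro allI impI ballI)
    fix n :: nat and h assume n: "1 \<le> n" and "h \<in> carrier (hecke_alg v v0 n)"
    then obtain x where x: "x \<in> FA n" "h = M.K.cls n x" by (auto simp: M.K.carrier_H)
    show "tr n h = hecke_pairing cj (\<kappa> v) (\<kappa> v0) n (beta_B (\<kappa> v) (\<kappa> v0) a (cj y) n) (hecke_ext \<kappa> v v0 n h)"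
      unfolding x(2) M.ext_cls[OF x(1)] M.tr_eq_theta[OF n x(1)] C.beta_pairing[OF n M.bc_FA[OF x(1)]]
        M.L.theta_def M.L.beta_def M.L.quadr_def c ia ..
  qed
qed

end
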